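(* Let $G$ be a finite group and let $\sigma$ be a symmetry on the monoidal category $\mathbf{Rep}(\mathbb{K}G)$. Assume that for every object $V$ the exterior powers $\Lambda^nV$, defined using the symmetry $\sigma$, satisfy $\Lambda^nV=0$ for all large enough $n$ (depending on $V$). Then there exist a normal abelian subgroup $A$ of $G$ and a $2$-cocycle $\alpha\colon A^\vee\times A^\vee\to\mathbb{K}^\times$ which is non-degenerate and whose cohomology class is $G/A$-invariant, such that for all objects $V,W$ the symmetry $\sigma_{V,W}\colon V\otimes W\to W\otimes V$ is given by $$v\otimes w\longmapsto\frac{\alpha(\phi_1,\phi_2)}{\alpha(\phi_2,\phi_1)}\,w\otimes v$$ for all $\phi_1,\phi_2\in A^\vee$, $v\in V(\phi_1)$ and $w\in W(\phi_2)$.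
   Context: $\mathbb{K}$ is an algebraically closed field of characteristic $0$; $\mathbf{Rep}(\mathbb{K}G)$ is the category of finite-dimensional representations of $G$ over $\mathbb{K}$ with its usual tensor product. A symmetry on this monoidal category is a natural family of isomorphisms $\sigma_{V,W}\colon V\otimes W\to W\otimes V$ making it a symmetric monoidal category (so $\sigma_{W,V}\sigma_{V,W}=\mathrm{id}$ and the hexagon axioms hold); it need not be the canonical one $v\otimes w\mapsto w\otimes v$. The symmetry $\sigma$ gives an action of the symmetric group $\Sigma_n$ on $V^{\otimes n}$, and $\Lambda^nV$ is the image of the antisymmetrizer $\frac1{n!}\sum_{s\in\Sigma_n}\mathrm{sgn}(s)\,s$ on $V^{\otimes n}$. For an abelian normal subgroup $A$ of $G$, $A^\vee=\mathrm{Hom}(A,\mathbb{K}^\times)$ is its character group, on which $G/A$ acts via conjugation on $A$. For a representation $V$ of $G$, $V=\bigoplus_{\phi\in A^\vee}V(\phi)$ is the isotypical decomposition of $V$ as an $A$-representation, i.e. $V(\phi)=\{v: av=\phi(a)v\ \forall a\in A\}$. Cocycles on $A^\vee$ are for the trivial action on $\mathbb{K}^\times$. A $2$-cocycle $\alpha$ on $A^\vee$ is non-degenerate if the pairing $(\phi,\psi)\mapsto\alpha(\phi,\psi)/\alpha(\psi,\phi)$ on $A^\vee$ is non-degenerate; this depends only on the class $[\alpha]\in\mathrm{H}^2(A^\vee;\mathbb{K}^\times)$. The class is $G/A$-invariant if $[q(\alpha)]=[\alpha]$ for all $q\in G/A$. *)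

theory Defs
  imports "Jordan_Normal_Form.VS_Connect" "HOL-Algebra.Coset" "HOL-Combinatorics.Permutations"
begin

section \<open>The monoidal category of finite-dimensional representations\<close>

text \<open>
  The field is a type \<open>'k\<close>; \<^term>\<open>class_ring\<close> is the same field as a record. The objects of
  \<open>Rep(KG)\<close> are all finite-dimensional representations whose carrier is a set of elements of
  an arbitrary type \<open>'v\<close>, which plays the role of a universe. (The fields \<^const>\<open>mult\<close> and
  \<^const>\<open>one\<close> inherited from \<open>module\<close> have no meaning.)
\<close>

record ('k, 'v, 'g) rep = "('k, 'v) module" +
  act :: "'g \<Rightarrow> 'v \<Rightarrow> 'v"

definition is_rep :: "('g, 'm) monoid_scheme \<Rightarrow> ('k::field, 'v, 'g) rep \<Rightarrow> bool" where
  "is_rep G V \<longleftrightarrow>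
     vectorspace class_ring V \<and> vectorspace.fin_dim class_ring V \<and>
     (\<forall>g\<in>carrier G. linear_map class_ring V V (act V g)) \<and>
     (\<forall>v\<in>carrier V. act V \<one>\<^bsub>G\<^esub> v = v) \<and>
     (\<forall>g\<in>carrier G. \<forall>h\<in>carrier G. \<forall>v\<in>carrier V. act V (g \<otimes>\<^bsub>G\<^esub> h) v = act V g (act V h v))"

text \<open>As everywhere below, only the values of a map on the carrier of its source matter.\<close>

definition rep_hom ::
  "('g, 'm) monoid_scheme \<Rightarrow> ('k::field, 'v, 'g) rep \<Rightarrow> ('k, 'v, 'g) rep \<Rightarrow> ('v \<Rightarrow> 'v) set" where
  "rep_hom G V W =
     {f. linear_map class_ring V W f \<and>
         (\<forall>g\<in>carrier G. \<forall>v\<in>carrier V. f (act V g v) = act W g (f v))}"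

definition rep_iso ::
  "('g, 'm) monoid_scheme \<Rightarrow> ('k::field, 'v, 'g) rep \<Rightarrow> ('k, 'v, 'g) rep \<Rightarrow> ('v \<Rightarrow> 'v) set" where
  "rep_iso G V W = {f \<in> rep_hom G V W. bij_betw f (carrier V) (carrier W)}"

definition bilinear_map ::
  "('k::field, 'v, 'a) module_scheme \<Rightarrow> ('k, 'v, 'b) module_scheme \<Rightarrow> ('k, 'v, 'c) module_scheme
     \<Rightarrow> ('v \<Rightarrow> 'v \<Rightarrow> 'v) \<Rightarrow> bool" where
  "bilinear_map V W Z \<beta> \<longleftrightarrow>
     (\<forall>v\<in>carrier V. linear_map class_ring W Z (\<beta> v)) \<and>
     (\<forall>w\<in>carrier W. linear_map class_ring V Z (\<lambda>v. \<beta> v w))"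

definition is_tensor_product ::
  "('k::field, 'v, 'a) module_scheme \<Rightarrow> ('k, 'v, 'b) module_scheme \<Rightarrow> ('k, 'v, 'c) module_scheme
     \<Rightarrow> ('v \<Rightarrow> 'v \<Rightarrow> 'v) \<Rightarrow> bool" where
  "is_tensor_product V W P t \<longleftrightarrow>
     vectorspace class_ring P \<and> bilinear_map V W P t \<and>
     (\<forall>(Z :: ('k, 'v) module) \<beta>. vectorspace class_ring Z \<and> bilinear_map V W Z \<beta> \<longrightarrow>
        (\<exists>!h. h \<in> extensional (carrier P) \<and> linear_map class_ring P Z h \<and>
              (\<forall>v\<in>carrier V. \<forall>w\<in>carrier W. h (t v w) = \<beta> v w)))"

text \<open>
  The usual tensor product is only determined up to canonical isomorphism, so a choice of it is
  a parameter: \<open>tobj T V W\<close> is the representation \<open>V \<otimes> W\<close>, \<open>tpure T V W v w\<close> is its element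
  \<open>v \<otimes> w\<close>, and \<open>tunit T\<close> is the unit object. If \<open>'v\<close> is so small that there is no such choice,
  there is no monoidal category; otherwise the unit object embeds the (infinite) algebraically closed
  field into \<open>'v\<close>, and hence every finite-dimensional representation of a finite group is
  isomorphic to one in \<open>'v\<close>.
\<close>

record ('k, 'v, 'g) tensor =
  tunit :: "('k, 'v, 'g) rep"
  tobj :: "('k, 'v, 'g) rep \<Rightarrow> ('k, 'v, 'g) rep \<Rightarrow> ('k, 'v, 'g) rep"
  tpure :: "('k, 'v, 'g) rep \<Rightarrow> ('k, 'v, 'g) rep \<Rightarrow> 'v \<Rightarrow> 'v \<Rightarrow> 'v"

definition is_usual_tensor ::
  "('g, 'm) monoid_scheme \<Rightarrow> ('k::field, 'v, 'g) tensor \<Rightarrow> bool" where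
  "is_usual_tensor G T \<longleftrightarrow>
     is_rep G (tunit T) \<and> vectorspace.dim class_ring (tunit T) = 1 \<and>
     (\<forall>g\<in>carrier G. \<forall>x\<in>carrier (tunit T). act (tunit T) g x = x) \<and>
     (\<forall>V W. is_rep G V \<and> is_rep G W \<longrightarrow>
        is_rep G (tobj T V W) \<and>
        is_tensor_product V W (tobj T V W) (tpure T V W) \<and>
        (\<forall>g\<in>carrier G. \<forall>v\<in>carrier V. \<forall>w\<in>carrier W.
           act (tobj T V W) g (tpure T V W v w) = tpure T V W (act V g v) (act W g w)))"

text \<open>
  The maps \<open>f \<otimes> g\<close> and the associativity constraint; by the universal property their values on
  the carrier are determined by the values on pure tensors, so \<open>SOME\<close> involves no choice there.
\<close>

definition tmap ::
  "('k::field, 'v, 'g) tensor \<Rightarrow> ('k, 'v, 'g) rep \<Rightarrow> ('k, 'v, 'g) rep \<Rightarrow>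
     ('k, 'v, 'g) rep \<Rightarrow> ('k, 'v, 'g) rep \<Rightarrow> ('v \<Rightarrow> 'v) \<Rightarrow> ('v \<Rightarrow> 'v) \<Rightarrow> 'v \<Rightarrow> 'v" where
  "tmap T V W V' W' f g =
     (SOME h. linear_map class_ring (tobj T V W) (tobj T V' W') h \<and>
        (\<forall>v\<in>carrier V. \<forall>w\<in>carrier W. h (tpure T V W v w) = tpure T V' W' (f v) (g w)))"

definition assoc ::
  "('k::field, 'v, 'g) tensor \<Rightarrow> ('k, 'v, 'g) rep \<Rightarrow> ('k, 'v, 'g) rep \<Rightarrow> ('k, 'v, 'g) rep
     \<Rightarrow> 'v \<Rightarrow> 'v" where
  "assoc T U V W =
     (SOME h. linear_map class_ring (tobj T (tobj T U V) W) (tobj T U (tobj T V W)) h \<and>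
        (\<forall>u\<in>carrier U. \<forall>v\<in>carrier V. \<forall>w\<in>carrier W.
           h (tpure T (tobj T U V) W (tpure T U V u v) w) =
           tpure T U (tobj T V W) u (tpure T V W v w)))"

definition assoc_inv ::
  "('k::field, 'v, 'g) tensor \<Rightarrow> ('k, 'v, 'g) rep \<Rightarrow> ('k, 'v, 'g) rep \<Rightarrow> ('k, 'v, 'g) rep
     \<Rightarrow> 'v \<Rightarrow> 'v" where
  "assoc_inv T U V W = inv_into (carrier (tobj T (tobj T U V) W)) (assoc T U V W)"


section \<open>Symmetries and exterior powers\<close>

type_synonym ('k, 'v, 'g) braiding = "('k, 'v, 'g) rep \<Rightarrow> ('k, 'v, 'g) rep \<Rightarrow> 'v \<Rightarrow> 'v"

definition is_symmetry ::
  "('g, 'm) monoid_scheme \<Rightarrow> ('k::field, 'v, 'g) tensor \<Rightarrow> ('k, 'v, 'g) braiding \<Rightarrow> bool" where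
  "is_symmetry G T \<sigma> \<longleftrightarrow>
     (\<forall>V W. is_rep G V \<and> is_rep G W \<longrightarrow> \<sigma> V W \<in> rep_iso G (tobj T V W) (tobj T W V)) \<and>
     (\<comment> \<open>naturality\<close>
      \<forall>V W V' W' f g. is_rep G V \<and> is_rep G W \<and> is_rep G V' \<and> is_rep G W' \<and>
        f \<in> rep_hom G V V' \<and> g \<in> rep_hom G W W' \<longrightarrow>
        (\<forall>x\<in>carrier (tobj T V W).
           \<sigma> V' W' (tmap T V W V' W' f g x) = tmap T W V W' V' g f (\<sigma> V W x))) \<and>
     (\<comment> \<open>symmetry\<close>
      \<forall>V W. is_rep G V \<and> is_rep G W \<longrightarrow>
        (\<forall>x\<in>carrier (tobj T V W). \<sigma> W V (\<sigma> V W x) = x)) \<and>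
     (\<comment> \<open>first hexagon: \<open>(U \<otimes> V) \<otimes> W \<rightarrow> V \<otimes> (W \<otimes> U)\<close>\<close>
      \<forall>U V W. is_rep G U \<and> is_rep G V \<and> is_rep G W \<longrightarrow>
        (\<forall>x\<in>carrier (tobj T (tobj T U V) W).
           assoc T V W U (\<sigma> U (tobj T V W) (assoc T U V W x)) =
           tmap T V (tobj T U W) V (tobj T W U) (\<lambda>v. v) (\<sigma> U W)
             (assoc T V U W
               (tmap T (tobj T U V) W (tobj T V U) W (\<sigma> U V) (\<lambda>w. w) x)))) \<and>
     (\<comment> \<open>second hexagon: \<open>U \<otimes> (V \<otimes> W) \<rightarrow> (W \<otimes> U) \<otimes> V\<close>\<close>
      \<forall>U V W. is_rep G U \<and> is_rep G V \<and> is_rep G W \<longrightarrow>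
        (\<forall>x\<in>carrier (tobj T U (tobj T V W)).
           assoc_inv T W U V (\<sigma> (tobj T U V) W (assoc_inv T U V W x)) =
           tmap T (tobj T U W) V (tobj T W U) V (\<sigma> U W) (\<lambda>v. v)
             (assoc_inv T U W V
               (tmap T U (tobj T V W) U (tobj T W V) (\<lambda>u. u) (\<sigma> V W) x))))"

text \<open>\<open>V\<^sup>\<otimes>\<^sup>n\<close>, bracketed to the left: \<open>V\<^sup>\<otimes>\<^sup>n\<^sup>+\<^sup>1 = V\<^sup>\<otimes>\<^sup>n \<otimes> V\<close>.\<close>

fun tpow :: "('k::field, 'v, 'g) tensor \<Rightarrow> ('k, 'v, 'g) rep \<Rightarrow> nat \<Rightarrow> ('k, 'v, 'g) rep" where
  "tpow T V 0 = tunit T"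
| "tpow T V (Suc n) = tobj T (tpow T V n) V"

text \<open>
  \<open>swap_op T \<sigma> V n i\<close> is \<open>\<sigma>\<^bsub>V,V\<^esub>\<close> on the tensor factors \<open>i\<close> and \<open>i + 1\<close> of \<open>V\<^sup>\<otimes>\<^sup>n\<close>, which are numbered
  from \<open>0\<close>; it is meant for \<open>i + 1 < n\<close>.
\<close>

fun swap_op ::
  "('k::field, 'v, 'g) tensor \<Rightarrow> ('k, 'v, 'g) braiding \<Rightarrow> ('k, 'v, 'g) rep \<Rightarrow> nat \<Rightarrow> nat
     \<Rightarrow> 'v \<Rightarrow> 'v" where
  "swap_op T \<sigma> V (Suc (Suc n)) i =
     (if i = n
      then assoc_inv T (tpow T V n) V V
           \<circ> tmap T (tpow T V n) (tobj T V V) (tpow T V n) (tobj T V V) (\<lambda>x. x) (\<sigma> V V)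
           \<circ> assoc T (tpow T V n) V V
      else tmap T (tpow T V (Suc n)) V (tpow T V (Suc n)) V (swap_op T \<sigma> V (Suc n) i) (\<lambda>v. v))"
| "swap_op T \<sigma> V _ i = (\<lambda>x. x)"

text \<open>
  The action of \<open>p \<in> \<Sigma>\<^sub>n\<close> on \<open>V\<^sup>\<otimes>\<^sup>n\<close> is obtained by writing \<open>p\<close> as a product of adjacent transpositions;
  for a symmetry it does not depend on the chosen word, by the Coxeter relations. \<open>\<Sigma>\<^sub>n\<close> is the set
  of permutations of \<open>{..<n}\<close>.
\<close>

definition word_perm :: "nat list \<Rightarrow> nat \<Rightarrow> nat" where
  "word_perm is = foldr (\<lambda>i p. transpose i (Suc i) \<circ> p) is id"

definition perm_op ::
  "('k::field, 'v, 'g) tensor \<Rightarrow> ('k, 'v, 'g) braiding \<Rightarrow> ('k, 'v, 'g) rep \<Rightarrow> nat \<Rightarrow> (nat \<Rightarrow> nat)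
     \<Rightarrow> 'v \<Rightarrow> 'v" where
  "perm_op T \<sigma> V n p =
     foldr (\<lambda>i f. swap_op T \<sigma> V n i \<circ> f)
       (SOME is. (\<forall>i\<in>set is. Suc i < n) \<and> word_perm is = p) id"

definition antisymmetrizer ::
  "('k::field_char_0, 'v, 'g) tensor \<Rightarrow> ('k, 'v, 'g) braiding \<Rightarrow> ('k, 'v, 'g) rep \<Rightarrow> nat
     \<Rightarrow> 'v \<Rightarrow> 'v" where
  "antisymmetrizer T \<sigma> V n x =
     (1 / fact n) \<odot>\<^bsub>tpow T V n\<^esub>
       (\<Oplus>\<^bsub>tpow T V n\<^esub>p\<in>{p. p permutes {..<n}}.
          of_int (sign p) \<odot>\<^bsub>tpow T V n\<^esub> perm_op T \<sigma> V n p x)"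

definition exterior_power ::
  "('k::field_char_0, 'v, 'g) tensor \<Rightarrow> ('k, 'v, 'g) braiding \<Rightarrow> ('k, 'v, 'g) rep \<Rightarrow> nat
     \<Rightarrow> 'v set" where
  "exterior_power T \<sigma> V n = antisymmetrizer T \<sigma> V n ` carrier (tpow T V n)"


section \<open>Characters and cocycles\<close>

definition char_group ::
  "('g, 'm) monoid_scheme \<Rightarrow> 'g set \<Rightarrow> ('g \<Rightarrow> 'k::field) monoid" where
  "char_group G A =
     \<lparr>carrier = hom (G\<lparr>carrier := A\<rparr>) (units_of class_ring) \<inter> extensional A,
      mult = (\<lambda>\<phi> \<psi>. \<lambda>a\<in>A. \<phi> a * \<psi> a),
      one = (\<lambda>a\<in>A. 1)\<rparr>"

definition isotypical ::
  "'g set \<Rightarrow> ('k::field, 'v, 'g) rep \<Rightarrow> ('g \<Rightarrow> 'k) \<Rightarrow> 'v set" where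
  "isotypical A V \<phi> = {v \<in> carrier V. \<forall>a\<in>A. act V a v = \<phi> a \<odot>\<^bsub>V\<^esub> v}"

text \<open>Cocycles with values in the trivial module \<open>K\<^sup>\<times>\<close>; they are not required to be normalized.\<close>

definition two_cocycle :: "('x, 'm) monoid_scheme \<Rightarrow> ('x \<Rightarrow> 'x \<Rightarrow> 'k::field) \<Rightarrow> bool" where
  "two_cocycle X \<alpha> \<longleftrightarrow>
     (\<forall>x\<in>carrier X. \<forall>y\<in>carrier X. \<alpha> x y \<noteq> 0) \<and>
     (\<forall>x\<in>carrier X. \<forall>y\<in>carrier X. \<forall>z\<in>carrier X.
        \<alpha> x y * \<alpha> (x \<otimes>\<^bsub>X\<^esub> y) z = \<alpha> y z * \<alpha> x (y \<otimes>\<^bsub>X\<^esub> z))"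

definition cohomologous ::
  "('x, 'm) monoid_scheme \<Rightarrow> ('x \<Rightarrow> 'x \<Rightarrow> 'k::field) \<Rightarrow> ('x \<Rightarrow> 'x \<Rightarrow> 'k) \<Rightarrow> bool" where
  "cohomologous X \<alpha> \<alpha>' \<longleftrightarrow>
     (\<exists>\<gamma>. (\<forall>x\<in>carrier X. \<gamma> x \<noteq> 0) \<and>
          (\<forall>x\<in>carrier X. \<forall>y\<in>carrier X. \<alpha> x y = \<alpha>' x y * (\<gamma> x * \<gamma> y / \<gamma> (x \<otimes>\<^bsub>X\<^esub> y))))"

definition nondegenerate_pairing ::
  "('x, 'm) monoid_scheme \<Rightarrow> ('x \<Rightarrow> 'x \<Rightarrow> 'k::field) \<Rightarrow> bool" where
  "nondegenerate_pairing X \<beta> \<longleftrightarrow>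
     (\<forall>x\<in>carrier X. (\<forall>y\<in>carrier X. \<beta> x y = 1) \<longrightarrow> x = \<one>\<^bsub>X\<^esub>) \<and>
     (\<forall>y\<in>carrier X. (\<forall>x\<in>carrier X. \<beta> x y = 1) \<longrightarrow> y = \<one>\<^bsub>X\<^esub>)"

definition nondegenerate_cocycle ::
  "('x, 'm) monoid_scheme \<Rightarrow> ('x \<Rightarrow> 'x \<Rightarrow> 'k::field) \<Rightarrow> bool" where
  "nondegenerate_cocycle X \<alpha> \<longleftrightarrow> nondegenerate_pairing X (\<lambda>x y. \<alpha> x y / \<alpha> y x)"

text \<open>
  The action of a coset \<open>q \<in> G/A\<close> on a character of \<open>A\<close>. The representative \<open>g\<close> of \<open>q\<close> is irrelevant
  because \<open>A\<close> is abelian. A class is invariant under all \<open>q\<close> irrespective of the convention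
  (left or right action).
\<close>

definition coset_char ::
  "('g, 'm) monoid_scheme \<Rightarrow> 'g set \<Rightarrow> 'g set \<Rightarrow> ('g \<Rightarrow> 'k) \<Rightarrow> 'g \<Rightarrow> 'k" where
  "coset_char G A q \<phi> =
     (let g = (SOME g. g \<in> q)
      in (\<lambda>a\<in>A. \<phi> (inv\<^bsub>G\<^esub> g \<otimes>\<^bsub>G\<^esub> a \<otimes>\<^bsub>G\<^esub> g)))"

definition coset_cocycle ::
  "('g, 'm) monoid_scheme \<Rightarrow> 'g set \<Rightarrow> 'g set \<Rightarrow> (('g \<Rightarrow> 'k) \<Rightarrow> ('g \<Rightarrow> 'k) \<Rightarrow> 'k)
     \<Rightarrow> ('g \<Rightarrow> 'k) \<Rightarrow> ('g \<Rightarrow> 'k) \<Rightarrow> 'k" where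
  "coset_cocycle G A q \<alpha> \<phi> \<psi> =
     \<alpha> (coset_char G A (inv\<^bsub>G Mod A\<^esub> q) \<phi>) (coset_char G A (inv\<^bsub>G Mod A\<^esub> q) \<psi>)"

definition invariant_class ::
  "('g, 'm) monoid_scheme \<Rightarrow> 'g set \<Rightarrow> (('g \<Rightarrow> 'k::field) \<Rightarrow> ('g \<Rightarrow> 'k) \<Rightarrow> 'k) \<Rightarrow> bool" where
  "invariant_class G A \<alpha> \<longleftrightarrow>
     (\<forall>q\<in>carrier (G Mod A). cohomologous (char_group G A) (coset_cocycle G A q \<alpha>) \<alpha>)"

end

theory Submission
  imports Defs "HOL-Algebra.Multiplicative_Group" "HOL-Computational_Algebra.Fundamental_Theorem_Algebra"
begin

text \<open>
  By naturality, a symmetry is determined by its value on \<open>1 \<otimes> 1\<close> in the square of the regular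
  representation: \<open>\<sigma>(v \<otimes> w) = \<Sum> R(a, b) bw \<otimes> av\<close>. Put \<open>e\<^sub>b = \<Sum>\<^sub>a R(a, b) a\<close> and
  \<open>f\<^sub>a = \<Sum>\<^sub>b R(a, b) b\<close> in the group algebra. The two hexagons say that the \<open>e\<^sub>b\<close>, and likewise the
  \<open>f\<^sub>a\<close>, are orthogonal idempotents. As the nonzero \<open>f\<^sub>a\<close> are linearly independent, each \<open>a\<close> with
  \<open>f\<^sub>a \<noteq> 0\<close> is a linear combination of the \<open>e\<^sub>b\<close>; hence these \<open>a\<close> commute and form a subgroup \<open>A\<close>,
  which is normal by equivariance, and \<open>\<sigma>\<^sup>2 = 1\<close> forces \<open>R\<close> to be supported on \<open>A \<times> A\<close>. The Fourier
  transform of \<open>R\<close> is then a non-degenerate bicharacter \<open>\<beta>\<close> of the character group of \<open>A\<close> with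
  \<open>\<beta>(\<phi>, \<psi>) \<beta>(\<psi>, \<phi>) = 1\<close>. If \<open>\<beta>(\<phi>, \<phi>) = -1\<close>, then for \<open>v\<close> in the \<open>\<phi>\<close>-isotypical part of the regular
  representation all \<open>v\<^sup>\<otimes>\<^sup>n\<close> would be antisymmetric, so \<open>\<beta>\<close> is alternating and hence of the form
  \<open>\<alpha>(\<phi>, \<psi>) / \<alpha>(\<psi>, \<phi>)\<close>. Finally, \<open>\<beta>\<close> is invariant under conjugation, so a conjugate of \<open>\<alpha>\<close>
  differs from \<open>\<alpha>\<close> by a symmetric cocycle, which is a coboundary because the units of an
  algebraically closed field form a divisible group.
\<close>

section \<open>Finite abelian groups\<close>

text \<open>The hexagons produce idempotents because group elements act diagonally on tensor
  products: on one side of the first hexagon the same b acts on two factors, on the other side two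
  independent indices act on them, and comparing coefficients forces these to coincide. Linear
  independence of the nonzero f_a is equally direct, as one nonzero coefficient of f_a already
  yields a dual functional. The expansion of a as the sum of the \<open>dual a y\<close> e_y also
  makes each nonzero e_y a common eigenvector of A, and its eigenvalues form a character of A; these
  characters suffice to prove non-degeneracy. The representation-theoretic half is shaped by the
  fact that a tensor product is known only through its universal property, with targets in the
  universe \<open>'v\<close>: the field is not a possible target and no basis is given. Scalars
  therefore pass through the unit object, a one-dimensional space in \<open>'v\<close>, and
  identities between tensors are tested on products of linear functionals. The cocycle \<alpha> is
  the triangular half of \<beta>: after splitting off a cyclic factor, the mixed values of \<beta>
  are all put on one side.\<close>

definition mult_char :: "('x, 'm) monoid_scheme \<Rightarrow> 'x set \<Rightarrow> ('x \<Rightarrow> 'k::field) \<Rightarrow> bool" where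
  "mult_char X F f \<longleftrightarrow> (\<forall>x\<in>F. f x \<noteq> 0) \<and> (\<forall>x\<in>F. \<forall>y\<in>F. f (x \<otimes>\<^bsub>X\<^esub> y) = f x * f y)"

section \<open>Extension of characters to larger subgroups\<close>

lemma (in group) mult_char_one:
  assumes "subgroup F G" "mult_char G F f"
  shows "f \<one> = 1"
proof -
  have "\<one> \<in> F" using assms(1) by (rule subgroup.one_closed)
  then have "f (\<one> \<otimes> \<one>) = f \<one> * f \<one>" "f \<one> \<noteq> 0"
    using assms(2) unfolding mult_char_def by blast+
  then show ?thesis by simp
qed

lemma (in group) mult_char_pow:
  assumes F: "subgroup F G" "mult_char G F f" and x: "x \<in> F"
  shows "f (x [^] (n::nat)) = f x ^ n"
proof (induction n)
  case 0
  then show ?case using mult_char_one[OF F] by simp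
next
  case (Suc n)
  have "x [^] n \<in> F"
    using x by (induction n) (auto intro: subgroup.m_closed[OF F(1)] subgroup.one_closed[OF F(1)])
  then show ?case using Suc F(2) x by (simp add: mult_char_def)
qed

text \<open>One step of the argument that a divisible group is injective, with \<open>F'\<close>
  generated by \<open>F\<close> and \<open>x\<close>. If m is the least positive exponent with x^m
  in \<open>F\<close>, the value at \<open>x\<close> has to be an m-th root of f(x^m), and every
  such root works. The ambient group may be infinite; \<open>x\<close> only has to be torsion modulo
  \<open>F\<close>.\<close>

lemma (in comm_group) mult_char_extend_step:
  fixes f :: "'a \<Rightarrow> 'k::alg_closed_field"
  assumes F: "subgroup F G" and f: "mult_char G F f"
    and x: "x \<in> carrier G" and n: "n > (0::nat)" "x [^] n \<in> F"
  shows "\<exists>F' f'. subgroup F' G \<and> F \<subseteq> F' \<and> x \<in> F' \<and> mult_char G F' f' \<and> (\<forall>y\<in>F. f' y = f y)"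
proof -
  note Fc = subgroup.mem_carrier[OF F] 
  note F_cl = subgroup.m_closed[OF F] subgroup.m_inv_closed[OF F] subgroup.one_closed[OF F]
  define m where "m = (LEAST n. n > 0 \<and> x [^] (n::nat) \<in> F)"
  have m: "m > 0 \<and> x [^] m \<in> F" unfolding m_def
    by (rule LeastI[of "\<lambda>n. n > 0 \<and> x [^] (n::nat) \<in> F"]) (use n in auto)
  have Fpow: "y [^] (k::nat) \<in> F" if "y \<in> F" for y k
    using that by (induction k) (auto simp: F_cl)
  \<comment> \<open>Division with remainder: the remainder is again an exponent leading into
    \<open>F\<close>, so minimality of \<open>m\<close> makes it 0.\<close>
  have dvd: "m dvd k" if "x [^] k \<in> F" for k :: nat
  proof -
    have "x [^] k = x [^] (m * (k div m)) \<otimes> x [^] (k mod m)"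
      using x by (simp add: nat_pow_mult)
    then have "x [^] (k mod m) = inv (x [^] (m * (k div m))) \<otimes> x [^] k"
      using x by (simp add: inv_solve_left)
    also have "\<dots> \<in> F"
      using that m x Fpow[of "x [^] m" "k div m"] by (auto simp: nat_pow_pow intro!: F_cl)
    finally have "\<not> (k mod m < m) \<or> k mod m = 0"
      unfolding m_def using not_less_Least by blast
    then show ?thesis using m by auto
  qed
  obtain r where r: "r ^ m = f (x [^] m)" using nth_root_exists m by blast
  have r0: "r \<noteq> 0"
    using r m f by (auto simp: mult_char_def power_0_left)
  \<comment> \<open>Two ways of writing one element differ by a power of \<open>x\<close> that lies
    in \<open>F\<close>. Its exponent is a multiple of \<open>m\<close>, and on such powers
    \<open>f\<close> is already given by powers of \<open>r\<close>. Hence \<open>f'\<close> below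
    does not depend on the decomposition.\<close>
  have wd0: "f y * r ^ i = f y' * r ^ j"
    if "y \<in> F" "y' \<in> F" "y \<otimes> x [^] i = y' \<otimes> x [^] j" "i \<le> j" for y y' and i j :: nat
  proof -
    note yc = Fc[OF that(1)] Fc[OF that(2)]
    have "y \<otimes> x [^] i = y' \<otimes> x [^] (j - i) \<otimes> x [^] i"
      using that x yc by (simp add: m_assoc nat_pow_mult)
    then have y: "y = y' \<otimes> x [^] (j - i)" using x yc by simp
    then have "x [^] (j - i) = inv y' \<otimes> y" using x yc by (simp add: inv_solve_left)
    also have "\<dots> \<in> F" using that by (auto intro!: F_cl)
    finally have xF: "x [^] (j - i) \<in> F" .
    then obtain q where q: "j - i = m * q" using dvd by blast
    have "f (x [^] (j - i)) = r ^ (j - i)"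
      using q r mult_char_pow[OF F f, of "x [^] m" q] m x by (simp add: nat_pow_pow power_mult)
    then have "f y = f y' * r ^ (j - i)" using y f that(2) xF by (simp add: mult_char_def)
    then show ?thesis using that(4) by (simp flip: power_add)
  qed
  have wd: "f y * r ^ i = f y' * r ^ j"
    if "y \<in> F" "y' \<in> F" "y \<otimes> x [^] i = y' \<otimes> x [^] j" for y y' and i j :: nat
    using wd0[of y y' i j] wd0[of y' y j i] that by (cases "i \<le> j") auto
  define F' where "F' = {y \<otimes> x [^] (i::nat) | y i. y \<in> F}"
  define f' where "f' z = (SOME w. \<exists>y\<in>F. \<exists>i::nat. z = y \<otimes> x [^] i \<and> w = f y * r ^ i)" for z
  have f': "f' (y \<otimes> x [^] i) = f y * r ^ i" if "y \<in> F" for y and i :: nat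
  proof -
    have "\<exists>y'\<in>F. \<exists>j::nat. y \<otimes> x [^] i = y' \<otimes> x [^] j \<and> f' (y \<otimes> x [^] i) = f y' * r ^ j"
      unfolding f'_def by (rule someI_ex) (use that in blast)
    then show ?thesis using wd that by metis
  qed
  have mm: "(y \<otimes> x [^] i) \<otimes> (y' \<otimes> x [^] j) = (y \<otimes> y') \<otimes> x [^] (i + j)"
    if "y \<in> F" "y' \<in> F" for y y' and i j :: nat
    using x Fc that by (simp add: nat_pow_mult[symmetric] m_ac)
  have sub: "subgroup F' G"
  proof (rule subgroupI)
    show "F' \<subseteq> carrier G" unfolding F'_def using x Fc by auto
    show "F' \<noteq> {}" unfolding F'_def using F_cl(3) by blast
    show "a \<otimes> b \<in> F'" if "a \<in> F'" "b \<in> F'" for a b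
      using that unfolding F'_def using mm F_cl by blast
    show "inv a \<in> F'" if aF': "a \<in> F'" for a
    proof -
      obtain y i where a: "a = y \<otimes> x [^] (i::nat)" "y \<in> F" using aF' by (auto simp: F'_def)
      \<comment> \<open>Only natural exponents occur in \<open>F'\<close>, so x^(-i) is rewritten as
        x^(-m i) x^((m - 1) i), where the first factor lies in \<open>F\<close>.\<close>
      define u where "u = inv y \<otimes> inv ((x [^] m) [^] i)"
      have u: "u \<in> F" unfolding u_def using a m Fpow by (auto intro!: F_cl)
      have "m * i = i + (m - 1) * i" using m by (metis add.commute mult_eq_if not_gr0)
      then have "(x [^] m) [^] i = x [^] i \<otimes> x [^] ((m - 1) * i)"
        using x by (simp add: nat_pow_pow nat_pow_mult)
      then have "a \<otimes> (u \<otimes> x [^] ((m - 1) * i)) = \<one>"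
        unfolding a u_def using x Fc[OF a(2)] by (simp add: m_ac inv_mult)
      then have "inv a = u \<otimes> x [^] ((m - 1) * i)"
        using a u x Fc by (metis comm_inv_char m_closed nat_pow_closed)
      then show ?thesis using u by (auto simp: F'_def)
    qed
  qed
  have "F \<subseteq> F'"
  proof
    fix y assume "y \<in> F"
    then show "y \<in> F'" unfolding F'_def using Fc by (auto intro!: exI[of _ y] exI[of _ "0::nat"])
  qed
  moreover have "x \<in> F'" unfolding F'_def using F_cl(3) x
    by (auto intro!: exI[of _ \<one>] exI[of _ "1::nat"])
  moreover have "mult_char G F' f'" unfolding mult_char_def
  proof (intro conjI ballI)
    fix a assume "a \<in> F'"
    then show "f' a \<noteq> 0" using f' f r0 by (auto simp: F'_def mult_char_def)
  next
    fix a b assume "a \<in> F'" "b \<in> F'"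
    then obtain y i y' j where *: "y \<in> F" "y' \<in> F" "a = y \<otimes> x [^] (i::nat)" "b = y' \<otimes> x [^] (j::nat)"
      by (auto simp: F'_def)
    then show "f' (a \<otimes> b) = f' a * f' b"
      using mm[of y y' i j] f f' F_cl(1)[of y y'] by (simp add: mult_char_def power_add)
  qed
  moreover have "\<forall>y\<in>F. f' y = f y" using f'[of _ 0] Fc by simp
  ultimately show ?thesis using sub by blast
qed

text \<open>Finiteness is imposed on \<open>S\<close> and not on the group, because the lemma is
  later applied to an infinite extension of a finite group by the units of the field. Elements of
  \<open>S\<close> stay torsion modulo each enlarged subgroup.\<close>

lemma (in comm_group) mult_char_extend:
  fixes f :: "'a \<Rightarrow> 'k::alg_closed_field"
  assumes "finite S" and F: "subgroup F G" "mult_char G F f"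
    and S: "\<And>x. x \<in> S \<Longrightarrow> x \<in> carrier G \<and> (\<exists>n>(0::nat). x [^] n \<in> F)"
  shows "\<exists>F' f'. subgroup F' G \<and> F \<subseteq> F' \<and> S \<subseteq> F' \<and> mult_char G F' f' \<and> (\<forall>y\<in>F. f' y = f y)"
  using \<open>finite S\<close> S
proof (induction S rule: finite_induct)
  case empty
  then show ?case using F by blast
next
  case (insert x S)
  then obtain F' f' where *: "subgroup F' G" "F \<subseteq> F'" "S \<subseteq> F'" "mult_char G F' f'" "\<forall>y\<in>F. f' y = f y"
    by (metis insertCI)
  obtain n where "n > (0::nat)" "x [^] n \<in> F'" "x \<in> carrier G" using insert.prems[of x] *(2) by auto
  from mult_char_extend_step[OF *(1,4) this(3,1,2)]
  obtain F'' f'' where **: "subgroup F'' G \<and> F' \<subseteq> F'' \<and> x \<in> F'' \<and> mult_char G F'' f'' \<and> (\<forall>y\<in>F'. f'' y = f' y)"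
    by blast
  have "insert x S \<subseteq> F''" "F \<subseteq> F''" "\<forall>y\<in>F. f'' y = f y" using * ** by auto
  then show ?case using ** by blast
qed

section \<open>Splitting off a cyclic subgroup of maximal order\<close>

lemma complex_primitive_root:
  fixes m :: nat
  assumes "m > 0"
  shows "\<exists>\<zeta>::complex. (\<forall>k. \<zeta> ^ k = 1 \<longleftrightarrow> m dvd k) \<and> {z. z ^ m = 1} = (\<lambda>i. \<zeta> ^ i) ` {..<m}"
proof -
  define \<zeta> where "\<zeta> = cis (2 * pi / real m)"
  have pow: "\<zeta> ^ k = cis (2 * pi * real k / real m)" for k
    by (simp add: \<zeta>_def DeMoivre mult_ac)
  note bij = bij_betw_roots_unity[OF assms, folded pow]
  have "\<zeta> ^ m = 1" using assms by (simp add: pow)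
  then have "\<zeta> ^ k = \<zeta> ^ (k mod m)" for k
    by (metis mult_div_mod_eq power_add power_mult power_one mult_1)
  moreover have "\<zeta> ^ j = \<zeta> ^ 0 \<longleftrightarrow> j = 0" if "j < m" for j
    using bij that assms by (intro inj_on_eq_iff[of _ "{..<m}"]) (auto simp: bij_betw_def)
  ultimately have "\<zeta> ^ k = 1 \<longleftrightarrow> m dvd k" for k
    using assms by (metis dvd_eq_mod_eq_0 mod_less_divisor power_0)
  moreover have "{z. z ^ m = 1} = (\<lambda>i. \<zeta> ^ i) ` {..<m}"
    using bij by (simp add: bij_betw_def)
  ultimately show ?thesis by blast
qed

lemma (in comm_group) ord_mult_coprime:
  assumes x: "x \<in> carrier G" and y: "y \<in> carrier G" and cop: "coprime (ord x) (ord y)"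
  shows "ord (x \<otimes> y) = ord x * ord y"
proof -
  have half: "ord x dvd k" if "x \<in> carrier G" "y \<in> carrier G" "coprime (ord x) (ord y)" "(x \<otimes> y) [^] k = \<one>"
    for x y and k :: nat
  proof -
    \<comment> \<open>Raising to the power \<open>ord y\<close> makes the contribution of
      \<open>y\<close> disappear; coprimality then cancels \<open>ord y\<close> in the
      exponent.\<close>
    have "x [^] (k * ord y) \<otimes> y [^] (k * ord y) = \<one>"
      using that by (metis nat_pow_one nat_pow_pow pow_mult_distrib m_comm m_closed)
    moreover have "y [^] (k * ord y) = \<one>" using that by (simp add: pow_eq_id)
    ultimately have "x [^] (k * ord y) = \<one>" using that by simp
    then show ?thesis using that by (simp add: pow_eq_id coprime_dvd_mult_left_iff)
  qed
  have "ord x dvd ord (x \<otimes> y)" using half[of x y "ord (x \<otimes> y)"] assms by simp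
  moreover have "ord y dvd ord (x \<otimes> y)"
    using half[of y x "ord (x \<otimes> y)"] assms m_comm[of y x] by (simp add: coprime_commute)
  ultimately have "ord x * ord y dvd ord (x \<otimes> y)" using cop by (simp add: divides_mult)
  then show ?thesis using abelian_ord_mul_divides[OF x y] by (simp add: dvd_antisym)
qed

text \<open>An element \<open>c\<close> of maximal order works: if a prime p occurred in
  \<open>ord y\<close> with exponent k larger than its exponent j in \<open>ord c\<close>, then
  c^(p^j) and a suitable power of \<open>y\<close> would have coprime orders, and their product
  would have order p^(k - j) times that of \<open>c\<close>.\<close>

lemma (in comm_group) exponent_element_exists:
  assumes fin: "finite (carrier G)"
  shows "\<exists>c\<in>carrier G. \<forall>y\<in>carrier G. y [^] ord c = \<one>"
proof -
  define m where "m = Max (ord ` carrier G)"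
  have "m \<in> ord ` carrier G" unfolding m_def using fin by (intro Max_in) auto
  then obtain c where c: "c \<in> carrier G" "ord c = m" by auto
  have m_max: "ord y \<le> m" if "y \<in> carrier G" for y
    unfolding m_def using fin that by simp
  have pos: "ord y > 0" if "y \<in> carrier G" for y using ord_ge_1[OF fin that] by simp
  have "ord y dvd ord c" if y: "y \<in> carrier G" for y
  proof (rule ccontr)
    assume "\<not> ord y dvd ord c"
    then obtain p where p: "prime p" "multiplicity p (ord c) < multiplicity p (ord y)"
      using multiplicity_le_imp_dvd[of "ord y" "ord c"] pos[OF y] by (metis not_gr0 not_le)
    define j k where "j = multiplicity p (ord c)" and "k = multiplicity p (ord y)"
    have pp: "p > 1" using p prime_gt_1_nat by blast
    have "ord c \<noteq> 0" using pos[of c] c y by auto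
    then obtain a where a: "ord c = p ^ j * a" "\<not> p dvd a"
      using multiplicity_decompose'[of "ord c" p] pp unfolding j_def by (auto simp: mult.commute)
    have "ord y \<noteq> 0" using pos[of y] c y by auto
    then obtain b where b: "ord y = p ^ k * b" "\<not> p dvd b"
      using multiplicity_decompose'[of "ord y" p] pp unfolding k_def by (auto simp: mult.commute)
    have b0: "b \<noteq> 0" using b by (metis dvd_0_right)
    have o1: "ord (c [^] (p ^ j)) = a"
      using ord_pow[of c "p ^ j"] c(1) a pp by (metis dvd_triv_left nonzero_mult_div_cancel_left not_one_less_zero power_eq_0_iff)
    have o2: "ord (y [^] b) = p ^ k"
      using ord_pow[of y b] y b b0 by simp
    have "coprime a (p ^ k)" using a p by (metis prime_imp_coprime coprime_commute coprime_power_right_iff)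
    then have "ord (c [^] (p ^ j) \<otimes> y [^] b) = a * p ^ k"
      using ord_mult_coprime[of "c [^] (p ^ j)" "y [^] b"] o1 o2 c y by simp
    then have "a * p ^ k \<le> p ^ j * a" using m_max[of "c [^] (p ^ j) \<otimes> y [^] b"] c y a by simp
    moreover have "a > 0" using a pos[OF c(1)] by (metis gr0I mult_is_0 less_numeral_extra(3))
    ultimately have "p ^ k \<le> p ^ j" by (simp add: mult.commute)
    then show False using p pp by (simp add: j_def k_def)
  qed
  then show ?thesis using c by (auto simp: pow_eq_id)
qed

text \<open>
  A complex character that is faithful on \<open>\<langle>c\<rangle>\<close> extends to the whole group; as all its values are roots of
  unity of order \<open>ord c\<close>, it takes no values outside the image of \<open>\<langle>c\<rangle>\<close>, and so induces a retraction.
\<close>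

lemma (in comm_group) cyclic_projection_exists:
  assumes fin: "finite (carrier G)" and c: "c \<in> carrier G" and c_exp: "\<And>y. y \<in> carrier G \<Longrightarrow> y [^] ord c = \<one>"
  shows "\<exists>p. p \<in> hom G G \<and> p c = c \<and> (\<forall>x\<in>carrier G. (\<exists>i::nat. p x = c [^] i) \<and> p (p x) = p x)"
proof -
  define m where "m = ord c"
  have m: "m > 0" unfolding m_def using ord_ge_1[OF fin c] by simp
  obtain \<zeta> :: complex where z: "\<And>k. \<zeta> ^ k = 1 \<longleftrightarrow> m dvd k"
    and roots: "{z. z ^ m = 1} = (\<lambda>i. \<zeta> ^ i) ` {..<m}"
    using complex_primitive_root[OF m] by blast
  have z0: "\<zeta> \<noteq> 0" using z[of m] m by (auto simp: power_0_left)
  have zc: "\<zeta> ^ i = \<zeta> ^ j \<longleftrightarrow> c [^] i = c [^] j" for i j :: nat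
  proof (induction i j rule: linorder_wlog)
    case (le i j)
    have "\<zeta> ^ j = \<zeta> ^ i * \<zeta> ^ (j - i)" using le by (simp flip: power_add)
    then have "\<zeta> ^ i = \<zeta> ^ j \<longleftrightarrow> \<zeta> ^ (j - i) = 1" using z0 by auto
    moreover have "c [^] j = c [^] i \<otimes> c [^] (j - i)" using le c by (simp add: nat_pow_mult)
    then have "c [^] i = c [^] j \<longleftrightarrow> c [^] (j - i) = \<one>" using c by (simp add: l_cancel_one')
    ultimately show ?case using z c by (simp add: pow_eq_id m_def)
  qed auto
  define F where "F = {c [^] i | i :: nat. True}"
  define f where "f x = \<zeta> ^ (SOME i. x = c [^] (i::nat))" for x
  have f: "f (c [^] i) = \<zeta> ^ i" for i :: nat
    unfolding f_def zc by (rule someI2[of _ i]) auto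
  have F: "subgroup F G"
  proof (rule subgroupI)
    show "F \<subseteq> carrier G" "F \<noteq> {}" using c by (auto simp: F_def)
    show "a \<otimes> b \<in> F" if "a \<in> F" "b \<in> F" for a b
      using that c by (auto simp: F_def nat_pow_mult)
    show "inv a \<in> F" if aF: "a \<in> F" for a
    proof -
      obtain i where i: "a = c [^] (i::nat)" using aF by (auto simp: F_def)
      have "c [^] ((m - 1) * i) \<otimes> c [^] i = c [^] (m * i)"
        using c m by (simp add: nat_pow_mult) (metis Suc_pred add.commute mult_Suc One_nat_def)
      also have "\<dots> = \<one>" using c by (simp add: m_def pow_eq_id)
      finally have "inv a = c [^] ((m - 1) * i)" using i c by (intro inv_equality) auto
      then show ?thesis by (auto simp: F_def)
    qed
  qed
  have "mult_char G F f"
    using z0 c by (auto simp: mult_char_def F_def nat_pow_mult f power_add)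
  moreover have "x \<in> carrier G \<and> (\<exists>n>(0::nat). x [^] n \<in> F)" if "x \<in> carrier G" for x
    using that c_exp[OF that] m subgroup.one_closed[OF F] unfolding m_def by auto
  ultimately obtain F' \<chi> where F': "F \<subseteq> F'" "carrier G \<subseteq> F'" "mult_char G F' \<chi>" "\<forall>y\<in>F. \<chi> y = f y"
    using mult_char_extend[OF fin F] by metis
  have \<chi>: "\<chi> (c [^] i) = \<zeta> ^ i" for i :: nat using F'(4) f by (auto simp: F_def)
  have \<chi>c: "\<chi> c = \<zeta>" using \<chi>[of 1] c by simp
  have \<chi>m: "\<chi> (x \<otimes> y) = \<chi> x * \<chi> y" if "x \<in> carrier G" "y \<in> carrier G" for x y
    using F'(2,3) that unfolding mult_char_def by blast
  have ex: "\<exists>i. \<chi> x = \<zeta> ^ i" if x: "x \<in> carrier G" for x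
  proof -
    have "\<chi> (x [^] n) = \<chi> x ^ n" for n :: nat
      by (induction n) (use \<chi>[of 0] \<chi>m x in auto)
    then have "\<chi> x ^ m = 1" using c_exp[OF x] \<chi>[of 0] unfolding m_def by (metis nat_pow_0 power_0)
    then show ?thesis using roots by auto
  qed
  define p where "p x = c [^] (SOME i. \<chi> x = \<zeta> ^ (i::nat))" for x
  have p: "p x = c [^] i" if "\<chi> x = \<zeta> ^ i" for x i
  proof -
    have "\<chi> x = \<zeta> ^ (SOME i. \<chi> x = \<zeta> ^ (i::nat))" by (rule someI[of _ i]) (rule that)
    then show ?thesis unfolding p_def using that zc by metis
  qed
  have "p \<in> hom G G"
  proof (rule homI)
    fix x assume "x \<in> carrier G"
    then show "p x \<in> carrier G" using c by (simp add: p_def)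
  next
    fix x y assume xy: "x \<in> carrier G" "y \<in> carrier G"
    then obtain i j where ij: "\<chi> x = \<zeta> ^ i" "\<chi> y = \<zeta> ^ j" using ex by meson
    then have "\<chi> (x \<otimes> y) = \<zeta> ^ (i + j)" using xy \<chi>m by (simp add: power_add)
    then show "p (x \<otimes> y) = p x \<otimes> p y" using p ij c by (simp add: nat_pow_mult)
  qed
  moreover have "p c = c" using p[of c 1] \<chi>c c by simp
  moreover have "(\<exists>i::nat. p x = c [^] i) \<and> p (p x) = p x" if "x \<in> carrier G" for x
    using ex[OF that] p[of x] p[of "p x"] \<chi> by metis
  ultimately show ?thesis by blast
qed

text \<open>Induction on the order: for \<open>c\<close> of maximal order, \<open>X\<close> is the
  direct product of the cyclic group of \<open>c\<close> and a smaller group \<open>Y\<close>. An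
  alternating form is trivial on a cyclic group, so only the mixed values and the values on
  \<open>Y\<close> have to be accounted for.\<close>

lemma alternating_bicharacter_splits:
  fixes X :: "('x, 'm) monoid_scheme" and \<beta> :: "'x \<Rightarrow> 'x \<Rightarrow> 'k::field"
  assumes "comm_group X" "finite (carrier X)"
    and "\<And>x. x \<in> carrier X \<Longrightarrow> mult_char X (carrier X) (\<beta> x)"
    and "\<And>y. y \<in> carrier X \<Longrightarrow> mult_char X (carrier X) (\<lambda>x. \<beta> x y)"
    and "\<And>x. x \<in> carrier X \<Longrightarrow> \<beta> x x = 1"
  shows "\<exists>\<alpha>. (\<forall>x\<in>carrier X. mult_char X (carrier X) (\<alpha> x)) \<and>
             (\<forall>y\<in>carrier X. mult_char X (carrier X) (\<lambda>x. \<alpha> x y)) \<and>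
             (\<forall>x\<in>carrier X. \<forall>y\<in>carrier X. \<beta> x y = \<alpha> x y / \<alpha> y x)"
  using assms
proof (induction "card (carrier X)" arbitrary: X rule: less_induct)
  case less
  interpret comm_group X by fact
  note fin = less.prems(2)
  have b0: "\<beta> x y \<noteq> 0" if "x \<in> carrier X" "y \<in> carrier X" for x y
    using less.prems(3) that by (auto simp: mult_char_def)
  have bl: "\<beta> (x \<otimes>\<^bsub>X\<^esub> x') y = \<beta> x y * \<beta> x' y" if "x \<in> carrier X" "x' \<in> carrier X" "y \<in> carrier X" for x x' y
    using less.prems(4) that by (auto simp: mult_char_def)
  have br: "\<beta> x (y \<otimes>\<^bsub>X\<^esub> y') = \<beta> x y * \<beta> x y'" if "x \<in> carrier X" "y' \<in> carrier X" "y \<in> carrier X" for x y y'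
    using less.prems(3) that by (auto simp: mult_char_def)
  have skew: "\<beta> x y * \<beta> y x = 1" if "x \<in> carrier X" "y \<in> carrier X" for x y
  proof -
    have "\<beta> (x \<otimes>\<^bsub>X\<^esub> y) (x \<otimes>\<^bsub>X\<^esub> y) = \<beta> x x * \<beta> x y * (\<beta> y x * \<beta> y y)"
      using that by (simp add: bl br)
    then show ?thesis using that less.prems(5) by simp
  qed
  obtain c where c: "c \<in> carrier X" and c_exp: "\<And>y. y \<in> carrier X \<Longrightarrow> y [^]\<^bsub>X\<^esub> ord c = \<one>\<^bsub>X\<^esub>"
    using exponent_element_exists[OF fin] by blast
  show ?case
  proof (cases "c = \<one>\<^bsub>X\<^esub>")
    case True
    then have "carrier X = {\<one>\<^bsub>X\<^esub>}" using c_exp by force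
    then show ?thesis using less.prems(5) by (intro exI[of _ "\<lambda>_ _. 1"]) (auto simp: mult_char_def)
  next
    case False
    obtain p where p: "p \<in> hom X X" "p c = c"
        "\<And>x. x \<in> carrier X \<Longrightarrow> \<exists>i::nat. p x = c [^]\<^bsub>X\<^esub> i" "\<And>x. x \<in> carrier X \<Longrightarrow> p (p x) = p x"
      using cyclic_projection_exists[OF fin c c_exp] by blast
    interpret p: group_hom X X p using p(1) by unfold_locales
    have pX [simp]: "p x \<in> carrier X" if "x \<in> carrier X" for x using that by simp
    define Y where "Y = kernel X X p"
    have Y: "subgroup Y X" unfolding Y_def by (rule p.subgroup_kernel)
    have YX: "x \<in> carrier X" if "x \<in> Y" for x using subgroup.mem_carrier[OF Y that] .
    have "c \<notin> Y" using False p(2) by (auto simp: Y_def kernel_def)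
    then have "Y \<subset> carrier X" using c YX by blast
    then have card: "card (carrier (X\<lparr>carrier := Y\<rparr>)) < card (carrier X)"
      using fin by (simp add: psubset_card_mono)
    have cg: "comm_group (X\<lparr>carrier := Y\<rparr>)" 
      using subgroup.subgroup_is_group[OF Y group_axioms] YX m_comm by (intro group.group_comm_groupI) auto
    have "\<exists>\<alpha>. (\<forall>x\<in>Y. mult_char (X\<lparr>carrier := Y\<rparr>) Y (\<alpha> x)) \<and>
             (\<forall>y\<in>Y. mult_char (X\<lparr>carrier := Y\<rparr>) Y (\<lambda>x. \<alpha> x y)) \<and>
             (\<forall>x\<in>Y. \<forall>y\<in>Y. \<beta> x y = \<alpha> x y / \<alpha> y x)"
    proof (rule less.hyps[OF card, simplified])
      show "comm_group (X\<lparr>carrier := Y\<rparr>)" by (rule cg)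
      show "finite Y" using fin \<open>Y \<subset> carrier X\<close> by (metis finite_subset psubset_imp_subset)
    qed (use less.prems(3-5) YX in \<open>auto simp: mult_char_def\<close>)
    then obtain \<alpha> where A: "\<forall>x\<in>Y. mult_char (X\<lparr>carrier := Y\<rparr>) Y (\<alpha> x)"
        "\<forall>y\<in>Y. mult_char (X\<lparr>carrier := Y\<rparr>) Y (\<lambda>x. \<alpha> x y)"
        "\<forall>x\<in>Y. \<forall>y\<in>Y. \<beta> x y = \<alpha> x y / \<alpha> y x" by blast
    have \<alpha>: "\<And>x y. x \<in> Y \<Longrightarrow> y \<in> Y \<Longrightarrow> \<alpha> x y \<noteq> 0"
        "\<And>x y y'. x \<in> Y \<Longrightarrow> y \<in> Y \<Longrightarrow> y' \<in> Y \<Longrightarrow> \<alpha> x (y \<otimes>\<^bsub>X\<^esub> y') = \<alpha> x y * \<alpha> x y'"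
        "\<And>x x' y. x \<in> Y \<Longrightarrow> x' \<in> Y \<Longrightarrow> y \<in> Y \<Longrightarrow> \<alpha> (x \<otimes>\<^bsub>X\<^esub> x') y = \<alpha> x y * \<alpha> x' y"
        "\<And>x y. x \<in> Y \<Longrightarrow> y \<in> Y \<Longrightarrow> \<beta> x y = \<alpha> x y / \<alpha> y x"
      using A(1,2) A(3)[rule_format] by (simp_all add: mult_char_def)
    \<comment> \<open>\<open>p\<close> and \<open>q\<close> are the two projections of the
      decomposition of \<open>X\<close> into the cyclic group of \<open>c\<close> and its complement
      \<open>Y\<close>.\<close>
    define q where "q x = x \<otimes>\<^bsub>X\<^esub> inv\<^bsub>X\<^esub> p x" for x
    have qY: "q x \<in> Y" if "x \<in> carrier X" for x
      using that p(4)[OF that] by (simp add: q_def Y_def kernel_def)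
    have qX: "q x \<in> carrier X" if "x \<in> carrier X" for x using that by (simp add: q_def)
    have q_mult: "q (x \<otimes>\<^bsub>X\<^esub> y) = q x \<otimes>\<^bsub>X\<^esub> q y" if "x \<in> carrier X" "y \<in> carrier X" for x y
      using that by (simp add: q_def inv_mult m_ac)
    have pq: "p x \<otimes>\<^bsub>X\<^esub> q x = x" if "x \<in> carrier X" for x
      using that by (simp add: q_def m_lcomm[of "p x"])
    \<comment> \<open>The values of \<open>p\<close> are powers of \<open>c\<close>, and \<beta>(c,
      c) = 1.\<close>
    have bpp: "\<beta> (p x) (p y) = 1" if "x \<in> carrier X" "y \<in> carrier X" for x y
    proof -
      have "mult_char X (carrier X) (\<beta> c)" using less.prems(3)[OF c] .
      then have cj: "\<beta> c (c [^]\<^bsub>X\<^esub> j) = 1" for j :: nat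
        using mult_char_pow[OF subgroup_self _ c, of "\<beta> c" j] less.prems(5)[OF c] by simp
      have "\<beta> (c [^]\<^bsub>X\<^esub> i) (c [^]\<^bsub>X\<^esub> j) = 1" for i j :: nat
        using mult_char_pow[OF subgroup_self less.prems(4) c, of "c [^]\<^bsub>X\<^esub> j" i] c cj by simp
      then show ?thesis using p(3) that by metis
    qed
    \<comment> \<open>The mixed part of \<beta> enters with only one of its two orientations. The
      other one reappears in the quotient as the denominator, by skewness.\<close>
    define \<alpha>' where "\<alpha>' x y = \<beta> (p x) (q y) * \<alpha> (q x) (q y)" for x y
    have "\<beta> x y = \<alpha>' x y / \<alpha>' y x" if xy: "x \<in> carrier X" "y \<in> carrier X" for x y
    proof -
      have "\<beta> x y = \<beta> (p x \<otimes>\<^bsub>X\<^esub> q x) (p y \<otimes>\<^bsub>X\<^esub> q y)" using xy pq by simp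
      also have "\<dots> = \<beta> (p x) (q y) * \<beta> (q x) (p y) * \<beta> (q x) (q y)"
        using xy qX bpp[OF xy] by (simp add: bl br)
      also have "\<beta> (q x) (p y) = 1 / \<beta> (p y) (q x)"
        using skew[of "q x" "p y"] b0[of "p y" "q x"] xy qX by (simp add: field_simps)
      finally show ?thesis using \<alpha>(4) qY xy by (simp add: \<alpha>'_def)
    qed
    moreover have "mult_char X (carrier X) (\<alpha>' x)" if "x \<in> carrier X" for x
      using that qY qX \<alpha>(1,2) b0 by (auto simp: mult_char_def \<alpha>'_def q_mult br)
    moreover have "mult_char X (carrier X) (\<lambda>x. \<alpha>' x y)" if "y \<in> carrier X" for y
      using that qY qX \<alpha>(1,3) b0 by (auto simp: mult_char_def \<alpha>'_def q_mult bl)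
    ultimately show ?thesis by blast
  qed
qed

text \<open>Symmetry of \<alpha> makes the associated extension commutative, so that its class lies
  in Ext(X, K^x), which vanishes because the units of an algebraically closed field are
  divisible.\<close>

lemma symmetric_two_cocycle_is_coboundary:
  fixes \<alpha> :: "'x \<Rightarrow> 'x \<Rightarrow> 'k::alg_closed_field"
  assumes "comm_group X" "finite (carrier X)" and \<alpha>: "two_cocycle X \<alpha>"
    and sym: "\<And>x y. x \<in> carrier X \<Longrightarrow> y \<in> carrier X \<Longrightarrow> \<alpha> x y = \<alpha> y x"
  shows "\<exists>\<gamma>. (\<forall>x\<in>carrier X. \<gamma> x \<noteq> 0) \<and>
             (\<forall>x\<in>carrier X. \<forall>y\<in>carrier X. \<alpha> x y = \<gamma> x * \<gamma> y / \<gamma> (x \<otimes>\<^bsub>X\<^esub> y))"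
proof -
  interpret X: comm_group X by fact
  have a0: "\<alpha> x y \<noteq> 0" if "x \<in> carrier X" "y \<in> carrier X" for x y
    using \<alpha> that by (auto simp: two_cocycle_def)
  have coc: "\<alpha> x y * \<alpha> (x \<otimes>\<^bsub>X\<^esub> y) z = \<alpha> y z * \<alpha> x (y \<otimes>\<^bsub>X\<^esub> z)"
    if "x \<in> carrier X" "y \<in> carrier X" "z \<in> carrier X" for x y z
    using \<alpha> that by (auto simp: two_cocycle_def)
  \<comment> \<open>Cocycles are not normalized here. The constant \<open>u\<close> accounts for
    this: it is the reason for the first component \<open>1 / u\<close> in the unit of the extension
    and for the factor \<open>u\<close> in \<open>f\<close>.\<close>
  define u where "u = \<alpha> \<one>\<^bsub>X\<^esub> \<one>\<^bsub>X\<^esub>"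
  have u0: "u \<noteq> 0" using a0 by (simp add: u_def)
  have a1: "\<alpha> \<one>\<^bsub>X\<^esub> z = u" if "z \<in> carrier X" for z
    using coc[of "\<one>\<^bsub>X\<^esub>" "\<one>\<^bsub>X\<^esub>" z] a0[of "\<one>\<^bsub>X\<^esub>" z] that by (simp add: u_def)
  \<comment> \<open>\<open>E\<close> is the extension of \<open>X\<close> by \<open>K\<^sup>\<times>\<close> defined by \<open>\<alpha>\<close>, and \<open>f\<close> is the isomorphism from the kernel
    to \<open>K\<^sup>\<times>\<close>; extending \<open>f\<close> to \<open>E\<close> splits the extension.\<close>
  define E where "E = \<lparr>carrier = {k::'k. k \<noteq> 0} \<times> carrier X,
      monoid.mult = (\<lambda>(k, x) (l, y). (k * l * \<alpha> x y, x \<otimes>\<^bsub>X\<^esub> y)), one = (1 / u, \<one>\<^bsub>X\<^esub>)\<rparr>"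
  have Ec: "carrier E = {k. k \<noteq> 0} \<times> carrier X" and E1: "\<one>\<^bsub>E\<^esub> = (1 / u, \<one>\<^bsub>X\<^esub>)"
    and Em: "(k, x) \<otimes>\<^bsub>E\<^esub> (l, y) = (k * l * \<alpha> x y, x \<otimes>\<^bsub>X\<^esub> y)" for k l x y
    by (simp_all add: E_def)
  interpret E: comm_group E
  proof (rule comm_groupI)
    show "\<one>\<^bsub>E\<^esub> \<in> carrier E" using u0 by (simp add: Ec E1)
  next
    fix v w assume "v \<in> carrier E" "w \<in> carrier E"
    then show "v \<otimes>\<^bsub>E\<^esub> w \<in> carrier E" "v \<otimes>\<^bsub>E\<^esub> w = w \<otimes>\<^bsub>E\<^esub> v"
      using a0 sym by (auto simp: Ec Em X.m_comm)
  next
    fix v w z assume "v \<in> carrier E" "w \<in> carrier E" "z \<in> carrier E"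
    then show "v \<otimes>\<^bsub>E\<^esub> w \<otimes>\<^bsub>E\<^esub> z = v \<otimes>\<^bsub>E\<^esub> (w \<otimes>\<^bsub>E\<^esub> z)"
      using coc by (auto simp: Ec Em X.m_assoc)
  next
    fix v assume "v \<in> carrier E"
    then show "\<one>\<^bsub>E\<^esub> \<otimes>\<^bsub>E\<^esub> v = v" using a1 u0 by (auto simp: Ec E1 Em)
  next
    fix v assume v: "v \<in> carrier E"
    then obtain k x where kx: "v = (k, x)" "k \<noteq> 0" "x \<in> carrier X" by (auto simp: Ec)
    show "\<exists>w\<in>carrier E. w \<otimes>\<^bsub>E\<^esub> v = \<one>\<^bsub>E\<^esub>"
      by (rule bexI[of _ "(1 / (k * u * \<alpha> (inv\<^bsub>X\<^esub> x) x), inv\<^bsub>X\<^esub> x)"])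
        (use kx u0 a0 in \<open>auto simp: Em E1 Ec\<close>)
  qed
  define F where "F = {k::'k. k \<noteq> 0} \<times> {\<one>\<^bsub>X\<^esub>}"
  have F: "subgroup F E"
  proof (rule E.subgroupI)
    show "F \<subseteq> carrier E" by (auto simp: F_def Ec)
    have "(1, \<one>\<^bsub>X\<^esub>) \<in> F" by (simp add: F_def)
    then show "F \<noteq> {}" by blast
    show "v \<otimes>\<^bsub>E\<^esub> w \<in> F" if "v \<in> F" "w \<in> F" for v w
      using that u0 by (auto simp: F_def Em u_def)
    show "inv\<^bsub>E\<^esub> v \<in> F" if "v \<in> F" for v
    proof -
      obtain k where k: "v = (k, \<one>\<^bsub>X\<^esub>)" "k \<noteq> 0" using \<open>v \<in> F\<close> by (auto simp: F_def)
      have "inv\<^bsub>E\<^esub> v = (1 / (k * u * u), \<one>\<^bsub>X\<^esub>)"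
        using k u0 by (intro E.inv_equality) (auto simp: Em E1 Ec u_def)
      then show ?thesis using k u0 by (simp add: F_def)
    qed
  qed
  define f where "f v = fst v * u" for v :: "'k \<times> 'x"
  have f: "mult_char E F f" using u0 by (auto simp: mult_char_def F_def f_def Em u_def)
  \<comment> \<open>The power of \<open>v\<close> with exponent |X| has trivial second component and
    therefore lies in \<open>F\<close>.\<close>
  have S: "v \<in> carrier E \<and> (\<exists>n>(0::nat). v [^]\<^bsub>E\<^esub> n \<in> F)" if v: "v \<in> {1} \<times> carrier X" for v
  proof -
    have vE: "v \<in> carrier E" using v by (auto simp: Ec)
    have "snd (v [^]\<^bsub>E\<^esub> n) = snd v [^]\<^bsub>X\<^esub> n" for n :: nat
    proof (induction n)
      case (Suc n)
      then show ?case by (cases v; cases "v [^]\<^bsub>E\<^esub> n") (simp add: Em)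
    qed (simp add: E1)
    then have "snd (v [^]\<^bsub>E\<^esub> Coset.order X) = \<one>\<^bsub>X\<^esub>" using v by (auto simp: X.pow_order_eq_1)
    moreover have "v [^]\<^bsub>E\<^esub> Coset.order X \<in> carrier E" using vE by simp
    ultimately have "v [^]\<^bsub>E\<^esub> Coset.order X \<in> F"
      by (cases "v [^]\<^bsub>E\<^esub> Coset.order X") (simp add: F_def Ec)
    moreover have "Coset.order X > 0" using assms(2) by (simp add: X.order_gt_0_iff_finite)
    ultimately show ?thesis using vE by blast
  qed
  have "finite ({1::'k} \<times> carrier X)" using assms(2) by simp
  from E.mult_char_extend[OF this F f S] obtain F' f' where
    F': "F \<subseteq> F'" "{1} \<times> carrier X \<subseteq> F'" "mult_char E F' f'" "\<forall>y\<in>F. f' y = f y" by metis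
  \<comment> \<open>The extended character on the set-theoretic section that maps x to (1, x). Its
    failure to be multiplicative is exactly \<alpha>, because (1, x)(1, y) = (\<alpha>(x, y) / u,
    1)(1, xy) in \<open>E\<close>.\<close>
  define \<gamma> where "\<gamma> x = f' (1, x)" for x
  have g0: "\<gamma> x \<noteq> 0" if "x \<in> carrier X" for x using F' that by (auto simp: \<gamma>_def mult_char_def)
  have "\<gamma> x * \<gamma> y = \<alpha> x y * \<gamma> (x \<otimes>\<^bsub>X\<^esub> y)" if xy: "x \<in> carrier X" "y \<in> carrier X" for x y
  proof -
    have in_F': "(1, x) \<in> F'" "(1, y) \<in> F'" "(1, x \<otimes>\<^bsub>X\<^esub> y) \<in> F'" "(\<alpha> x y / u, \<one>\<^bsub>X\<^esub>) \<in> F'"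
      using F'(1,2) xy a0 u0 by (auto simp: F_def)
    have "\<gamma> x * \<gamma> y = f' ((1, x) \<otimes>\<^bsub>E\<^esub> (1, y))"
      using F'(3) in_F' unfolding mult_char_def \<gamma>_def by metis
    also have "(1, x) \<otimes>\<^bsub>E\<^esub> (1, y) = (\<alpha> x y / u, \<one>\<^bsub>X\<^esub>) \<otimes>\<^bsub>E\<^esub> (1, x \<otimes>\<^bsub>X\<^esub> y)"
      using a1 u0 xy by (simp add: Em)
    also have "f' \<dots> = f' (\<alpha> x y / u, \<one>\<^bsub>X\<^esub>) * \<gamma> (x \<otimes>\<^bsub>X\<^esub> y)"
      using F'(3) in_F' unfolding mult_char_def \<gamma>_def by metis
    also have "f' (\<alpha> x y / u, \<one>\<^bsub>X\<^esub>) = \<alpha> x y" using F'(4) a0 u0 xy by (simp add: F_def f_def)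
    finally show ?thesis .
  qed
  then have "\<alpha> x y = \<gamma> x * \<gamma> y / \<gamma> (x \<otimes>\<^bsub>X\<^esub> y)" if "x \<in> carrier X" "y \<in> carrier X" for x y
    using that g0 by (simp add: field_simps)
  then show ?thesis using g0 by blast
qed

section \<open>The coefficient matrix of a symmetry\<close>

lemma sum_delta_mult:
  fixes f :: "'a \<Rightarrow> 'k::semiring_1"
  assumes "finite C" "x \<in> C"
  shows "(\<Sum>b\<in>C. f b * (if b = x then 1 else 0)) = f x"
  using assms by (simp add: if_distrib[of "(*) _"] cong: if_cong)

text \<open>
  The axioms of a triangular structure \<open>\<Sum> R(a, b) a \<otimes> b\<close> on the group algebra, where every identity
  between elements of (a tensor power of) the group algebra is tested on arbitrary functions \<open>F\<close>, \<open>H\<close>,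
  considered as linear functionals.
\<close>

locale r_matrix = group G for G (structure) +
  fixes R :: "'a \<Rightarrow> 'a \<Rightarrow> 'k::field"
  assumes finite_carrier: "finite (carrier G)"
    and hexagon1: "\<And>y z F. y \<in> carrier G \<Longrightarrow> z \<in> carrier G \<Longrightarrow>
      (\<Sum>a\<in>carrier G. \<Sum>c\<in>carrier G. R a y * R c z * F (c \<otimes> a)) =
      (if y = z then \<Sum>a\<in>carrier G. R a y * F a else 0)"
    and hexagon2: "\<And>a c F. a \<in> carrier G \<Longrightarrow> c \<in> carrier G \<Longrightarrow>
      (\<Sum>b\<in>carrier G. \<Sum>d\<in>carrier G. R a b * R c d * F (d \<otimes> b)) =
      (if a = c then \<Sum>b\<in>carrier G. R a b * F b else 0)"
    and symmetric: "\<And>F H. (\<Sum>a\<in>carrier G. \<Sum>b\<in>carrier G. \<Sum>c\<in>carrier G. \<Sum>d\<in>carrier G.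
      R a b * R c d * (F (d \<otimes> a) * H (c \<otimes> b))) = F \<one> * H \<one>"
    and equivariant: "\<And>g F H. g \<in> carrier G \<Longrightarrow>
      (\<Sum>a\<in>carrier G. \<Sum>b\<in>carrier G. R a b * (F (a \<otimes> g) * H (b \<otimes> g))) =
      (\<Sum>a\<in>carrier G. \<Sum>b\<in>carrier G. R a b * (F (g \<otimes> a) * H (g \<otimes> b)))"
begin

section \<open>The support of the matrix is an abelian normal subgroup\<close>

definition supp :: "'a set" where
  "supp = {a \<in> carrier G. \<exists>b\<in>carrier G. R a b \<noteq> 0}"

text \<open>The linear functional \<open>F\<close> evaluated at the idempotent e_b.\<close>

definition coef :: "'a \<Rightarrow> ('a \<Rightarrow> 'k) \<Rightarrow> 'k" where
  "coef b F = (\<Sum>a\<in>carrier G. R a b * F a)"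

text \<open>
  \<open>dual a y\<close> is the coefficient of \<open>x\<close> in \<open>y f\<^sub>a\<close>, divided by \<open>R(a, x) \<noteq> 0\<close>. By the orthogonality of the
  idempotents \<open>f\<^sub>c\<close>, this functional takes the value 1 on \<open>f\<^sub>a\<close> and vanishes on all other \<open>f\<^sub>c\<close>.
\<close>

definition dual :: "'a \<Rightarrow> 'a \<Rightarrow> 'k" where
  "dual a y = (let x = (SOME x. x \<in> carrier G \<and> R a x \<noteq> 0)
     in (\<Sum>b\<in>carrier G. R a b * (if y \<otimes> b = x then 1 else 0)) / R a x)"

lemma supp_carrier: "a \<in> supp \<Longrightarrow> a \<in> carrier G"
  by (simp add: supp_def)

lemma sum_dual:
  assumes a: "a \<in> supp" and c: "c \<in> carrier G"
  shows "(\<Sum>y\<in>carrier G. R c y * dual a y) = (if a = c then 1 else 0)"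
proof -
  define x where "x = (SOME x. x \<in> carrier G \<and> R a x \<noteq> 0)"
  have "x \<in> carrier G \<and> R a x \<noteq> 0"
    unfolding x_def by (rule someI_ex) (use a in \<open>auto simp: supp_def\<close>)
  then have x: "x \<in> carrier G" "R a x \<noteq> 0" by auto
  have "(\<Sum>y\<in>carrier G. R c y * dual a y) =
      (\<Sum>d\<in>carrier G. \<Sum>b\<in>carrier G. R a b * R c d * (if d \<otimes> b = x then 1 else 0)) / R a x"
    unfolding dual_def x_def[symmetric] Let_def
    by (simp add: sum_divide_distrib sum_distrib_left mult_ac)
  also have "\<dots> = (\<Sum>b\<in>carrier G. \<Sum>d\<in>carrier G. R a b * R c d * (if d \<otimes> b = x then 1 else 0)) / R a x"
    by (subst sum.swap) simp
  also have "\<dots> = (if a = c then 1 else 0)"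
    using hexagon2[OF supp_carrier[OF a] c, of "\<lambda>u. if u = x then 1 else 0"] x
    by (auto simp: sum_delta_mult finite_carrier)
  finally show ?thesis .
qed

text \<open>By \<open>sum_dual\<close>, the sum of the \<open>dual a y\<close> e_y has coefficient 1
  at \<open>a\<close> and 0 at every other group element. So \<open>a\<close> itself is a
  combination of the idempotents, here tested on a functional \<open>F\<close>.\<close>

lemma eval_dual:
  assumes a: "a \<in> supp"
  shows "F a = (\<Sum>y\<in>carrier G. dual a y * coef y F)"
proof -
  have "(\<Sum>y\<in>carrier G. dual a y * coef y F) = (\<Sum>y\<in>carrier G. \<Sum>c\<in>carrier G. R c y * dual a y * F c)"
    by (simp add: coef_def sum_distrib_left mult_ac)
  also have "\<dots> = (\<Sum>c\<in>carrier G. (\<Sum>y\<in>carrier G. R c y * dual a y) * F c)"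
    by (subst sum.swap) (simp add: sum_distrib_right)
  also have "\<dots> = (\<Sum>c\<in>carrier G. (if a = c then 1 else 0) * F c)"
    using sum_dual[OF a] by simp
  also have "\<dots> = (\<Sum>c\<in>carrier G. if a = c then F c else 0)"
    by (rule sum.cong) auto
  also have "\<dots> = F a" using supp_carrier[OF a] finite_carrier by simp
  finally show ?thesis by simp
qed

text \<open>Nesting \<open>coef\<close> evaluates \<open>F\<close> at the product e_y e_z, so this
  is the orthogonality of the idempotents expressed by the first hexagon.\<close>

lemma coef_coef:
  assumes "y \<in> carrier G" "z \<in> carrier G"
  shows "coef y (\<lambda>c. coef z (\<lambda>a. F (c \<otimes> a))) = (if y = z then coef y F else 0)"
proof -
  have "coef y (\<lambda>c. coef z (\<lambda>a. F (c \<otimes> a))) =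
      (\<Sum>c\<in>carrier G. \<Sum>a\<in>carrier G. R a z * R c y * F (c \<otimes> a))"
    by (simp add: coef_def sum_distrib_left mult_ac)
  also have "\<dots> = (\<Sum>a\<in>carrier G. \<Sum>c\<in>carrier G. R a z * R c y * F (c \<otimes> a))"
    by (rule sum.swap)
  also have "\<dots> = (if y = z then coef y F else 0)"
    using hexagon1[of z y F] assms by (auto simp: coef_def)
  finally show ?thesis .
qed

text \<open>Multiplying the expansions of \<open>a\<close> and \<open>b\<close> in the idempotents,
  orthogonality leaves only the diagonal terms.\<close>

lemma eval_prod:
  assumes a: "a \<in> supp" and b: "b \<in> supp"
  shows "F (a \<otimes> b) = (\<Sum>y\<in>carrier G. dual a y * dual b y * coef y F)"
proof -
  have "F (a \<otimes> b) = (\<Sum>y\<in>carrier G. dual a y * coef y (\<lambda>c. F (c \<otimes> b)))"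
    using eval_dual[OF a, of "\<lambda>c. F (c \<otimes> b)"] by simp
  also have "\<dots> = (\<Sum>y\<in>carrier G. dual a y * coef y (\<lambda>c. \<Sum>z\<in>carrier G. dual b z * coef z (\<lambda>u. F (c \<otimes> u))))"
    using eval_dual[OF b, of "\<lambda>u. F (c \<otimes> u)" for c] by simp
  also have "\<dots> = (\<Sum>y\<in>carrier G. dual a y * (\<Sum>z\<in>carrier G. dual b z * coef y (\<lambda>c. coef z (\<lambda>u. F (c \<otimes> u)))))"
  proof (intro sum.cong refl arg_cong2[where f = "(*)"])
    fix y
    have "coef y (\<lambda>c. \<Sum>z\<in>carrier G. dual b z * coef z (\<lambda>u. F (c \<otimes> u))) =
        (\<Sum>c\<in>carrier G. \<Sum>z\<in>carrier G. dual b z * (R c y * coef z (\<lambda>u. F (c \<otimes> u))))"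
      by (simp add: coef_def[of y] sum_distrib_left mult_ac)
    also have "\<dots> = (\<Sum>z\<in>carrier G. dual b z * coef y (\<lambda>c. coef z (\<lambda>u. F (c \<otimes> u))))"
      by (subst sum.swap) (simp add: coef_def[of y] sum_distrib_left)
    finally show "coef y (\<lambda>c. \<Sum>z\<in>carrier G. dual b z * coef z (\<lambda>u. F (c \<otimes> u))) =
        (\<Sum>z\<in>carrier G. dual b z * coef y (\<lambda>c. coef z (\<lambda>u. F (c \<otimes> u))))" .
  qed
  also have "\<dots> = (\<Sum>y\<in>carrier G. dual a y * (\<Sum>z\<in>carrier G. dual b z * (if y = z then coef y F else 0)))"
    by (simp add: coef_coef cong: sum.cong)
  also have "\<dots> = (\<Sum>y\<in>carrier G. dual a y * (\<Sum>z\<in>carrier G. if y = z then dual b z * coef y F else 0))"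
    by (intro sum.cong arg_cong2[where f = "(*)"] refl) auto
  also have "\<dots> = (\<Sum>y\<in>carrier G. dual a y * dual b y * coef y F)"
    using finite_carrier by (simp add: mult.assoc)
  finally show ?thesis .
qed

text \<open>The coefficients \<open>dual a y * dual b y\<close> of the product in terms of the e_y
  are symmetric in \<open>a\<close> and \<open>b\<close>; an indicator function then distinguishes
  group elements.\<close>

lemma supp_commute:
  assumes "a \<in> supp" "b \<in> supp"
  shows "a \<otimes> b = b \<otimes> a"
proof -
  define F where "F u = (if u = b \<otimes> a then 1 else 0 :: 'k)" for u
  have "F (a \<otimes> b) = F (b \<otimes> a)"
    using eval_prod[OF assms, of F] eval_prod[OF assms(2,1), of F] by (simp add: mult.commute)
  then show ?thesis by (simp add: F_def split: if_splits)
qed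

text \<open>The product is a combination of the e_y, and these only involve elements of
  \<open>supp\<close>. If it were outside \<open>supp\<close>, its own indicator function would
  vanish on every e_y and hence on the product.\<close>

lemma supp_mult:
  assumes "a \<in> supp" "b \<in> supp"
  shows "a \<otimes> b \<in> supp"
proof (rule ccontr)
  assume *: "a \<otimes> b \<notin> supp"
  define F where "F u = (if u = a \<otimes> b then 1 else 0 :: 'k)" for u
  have ab: "a \<otimes> b \<in> carrier G" using assms supp_carrier by simp
  have "coef y F = 0" if "y \<in> carrier G" for y
    unfolding coef_def
  proof (rule sum.neutral, rule ballI)
    fix u assume "u \<in> carrier G"
    show "R u y * F u = 0" using * ab that by (auto simp: F_def supp_def)
  qed
  then have "F (a \<otimes> b) = 0" unfolding eval_prod[OF assms] by simp
  then show False by (simp add: F_def)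
qed

lemma supp_subgroup: "subgroup supp G"
proof -
  have "supp \<noteq> {}"
  proof
    assume "supp = {}"
    then have "R a b = 0" if "a \<in> carrier G" "b \<in> carrier G" for a b
      using that by (auto simp: supp_def)
    then show False using symmetric[of "\<lambda>_. 1" "\<lambda>_. 1"] by simp
  qed
  then obtain a where a: "a \<in> supp" by blast
  have inv: "inv b \<in> supp" if b: "b \<in> supp" for b
  proof -
    \<comment> \<open>Only positive powers are available, since \<one> is not yet known to lie in
      \<open>supp\<close>. The exponent \<open>2 * ord b - 1\<close> used below is positive even if
      \<open>ord b\<close> is 1.\<close>
    have pow: "b [^] Suc n \<in> supp" for n :: nat
      using b by (induction n) (auto simp: supp_mult supp_carrier)
    have bG: "b \<in> carrier G" using b by (rule supp_carrier)
    have o: "ord b \<ge> 1" using ord_ge_1[OF finite_carrier bG] .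
    have "b [^] (2 * ord b - 1) \<otimes> b = b [^] (2 * ord b)"
      using o nat_pow_Suc[of b "2 * ord b - 1"] by simp
    also have "\<dots> = \<one>" using bG by (simp add: pow_eq_id)
    finally have "inv b = b [^] (2 * ord b - 1)" using bG by (intro inv_equality) auto
    moreover have "2 * ord b - 1 = Suc (2 * ord b - 2)" using o by simp
    ultimately show ?thesis using pow by metis
  qed
  show ?thesis
    by (rule subgroupI) (use a inv supp_mult supp_carrier in auto)
qed

text \<open>Since \<open>a\<close> is the sum of the \<open>dual a y\<close> e_y, multiplication by
  \<open>a\<close> scales e_p by \<open>dual a p\<close>: the idempotents are common eigenvectors of
  \<open>supp\<close>.\<close>

lemma coef_translate:
  assumes a: "a \<in> supp" and p: "p \<in> carrier G"
  shows "coef p (\<lambda>s. F (a \<otimes> s)) = dual a p * coef p F"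
proof -
  have "coef p (\<lambda>s. F (a \<otimes> s)) = (\<Sum>y\<in>carrier G. dual a y * coef y (\<lambda>u. coef p (\<lambda>s. F (u \<otimes> s))))"
    using eval_dual[OF a, of "\<lambda>u. coef p (\<lambda>s. F (u \<otimes> s))"] .
  also have "\<dots> = (\<Sum>y\<in>carrier G. dual a y * (if y = p then coef y F else 0))"
    using p by (simp add: coef_coef)
  also have "\<dots> = (\<Sum>y\<in>carrier G. if y = p then dual a y * coef y F else 0)"
    by (rule sum.cong) auto
  also have "\<dots> = dual a p * coef p F" using finite_carrier p by simp
  finally show ?thesis .
qed

lemma coef_indicator:
  assumes "s \<in> carrier G"
  shows "coef p (\<lambda>u. if u = s then 1 else 0) = R s p"
proof -
  have "coef p (\<lambda>u. if u = s then 1 else 0) = (\<Sum>a\<in>carrier G. if a = s then R a p else 0)"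
    unfolding coef_def by (rule sum.cong) auto
  then show ?thesis using assms finite_carrier by simp
qed

text \<open>\<open>supp\<close> only controls the first index. For the second one, the relation
  \<sigma>^2 = 1 is evaluated with the functional sending u to H(u e_p) in the first factor and the
  indicator of \<one> in the second. Orthogonality leaves only b = p, and a nonzero term provides
  some c in \<open>supp\<close> with c \<otimes> p = \<one>.\<close>

lemma right_supp:
  assumes s: "s \<in> carrier G" and p: "p \<in> carrier G" and R: "R s p \<noteq> 0"
  shows "p \<in> supp"
proof -
  \<comment> \<open>The indicator of \<open>s\<close> has the value \<open>R s p\<close> at e_p,
    which is nonzero by assumption.\<close>
  define H where "H u = (if u = s then 1 else 0 :: 'k)" for u
  define F where "F u = coef p (\<lambda>s. H (u \<otimes> s))" for u
  define I where "I u = (if u = \<one> then 1 else 0 :: 'k)" for u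
  have H: "coef p H = R s p" unfolding H_def using coef_indicator[OF s] .
  \<comment> \<open>The sum over \<open>a\<close> evaluates \<open>H\<close> at d e_b e_p.\<close>
  have aux: "(\<Sum>a\<in>carrier G. R a b * F (d \<otimes> a)) = (if b = p then coef b (\<lambda>u. H (d \<otimes> u)) else 0)"
    if bd: "b \<in> carrier G" "d \<in> carrier G" for b d
  proof -
    have "F (d \<otimes> a) = coef p (\<lambda>s. H (d \<otimes> (a \<otimes> s)))" if "a \<in> carrier G" for a
      unfolding F_def coef_def using that bd by (simp add: m_assoc)
    then have "(\<Sum>a\<in>carrier G. R a b * F (d \<otimes> a)) = coef b (\<lambda>a. coef p (\<lambda>s. H (d \<otimes> (a \<otimes> s))))"
      by (simp add: coef_def[of b])
    then show ?thesis using coef_coef[OF bd(1) p, of "\<lambda>u. H (d \<otimes> u)"] by simp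
  qed
  have "(\<Sum>a\<in>carrier G. \<Sum>b\<in>carrier G. \<Sum>c\<in>carrier G. \<Sum>d\<in>carrier G. R a b * R c d * (F (d \<otimes> a) * I (c \<otimes> b)))
     = (\<Sum>b\<in>carrier G. \<Sum>c\<in>carrier G. \<Sum>d\<in>carrier G. \<Sum>a\<in>carrier G. R a b * R c d * (F (d \<otimes> a) * I (c \<otimes> b)))"
    (is "(\<Sum>a\<in>_. \<Sum>b\<in>_. \<Sum>c\<in>_. \<Sum>d\<in>_. ?t a b c d) = _")
  proof -
    have "(\<Sum>a\<in>carrier G. \<Sum>b\<in>carrier G. \<Sum>c\<in>carrier G. \<Sum>d\<in>carrier G. ?t a b c d) =
        (\<Sum>b\<in>carrier G. \<Sum>a\<in>carrier G. \<Sum>c\<in>carrier G. \<Sum>d\<in>carrier G. ?t a b c d)"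
      by (rule sum.swap)
    also have "\<dots> = (\<Sum>b\<in>carrier G. \<Sum>c\<in>carrier G. \<Sum>a\<in>carrier G. \<Sum>d\<in>carrier G. ?t a b c d)"
      by (rule sum.cong[OF refl], rule sum.swap)
    also have "\<dots> = (\<Sum>b\<in>carrier G. \<Sum>c\<in>carrier G. \<Sum>d\<in>carrier G. \<Sum>a\<in>carrier G. ?t a b c d)"
      by (rule sum.cong[OF refl], rule sum.cong[OF refl], rule sum.swap)
    finally show ?thesis .
  qed
  also have "\<dots> = (\<Sum>b\<in>carrier G. \<Sum>c\<in>carrier G. \<Sum>d\<in>carrier G. R c d * I (c \<otimes> b) * (\<Sum>a\<in>carrier G. R a b * F (d \<otimes> a)))"
    by (simp add: sum_distrib_left mult_ac)
  also have "\<dots> = (\<Sum>b\<in>carrier G. \<Sum>c\<in>carrier G. \<Sum>d\<in>carrier G. R c d * I (c \<otimes> b) * (if b = p then coef b (\<lambda>u. H (d \<otimes> u)) else 0))"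
    using aux by simp
  also have "\<dots> = (\<Sum>b\<in>carrier G. if b = p then \<Sum>c\<in>carrier G. \<Sum>d\<in>carrier G. R c d * I (c \<otimes> b) * coef b (\<lambda>u. H (d \<otimes> u)) else 0)"
    by (rule sum.cong) auto
  also have "\<dots> = (\<Sum>c\<in>carrier G. \<Sum>d\<in>carrier G. R c d * I (c \<otimes> p) * coef p (\<lambda>u. H (d \<otimes> u)))"
    using p finite_carrier by simp
  finally have "(\<Sum>c\<in>carrier G. \<Sum>d\<in>carrier G. R c d * I (c \<otimes> p) * coef p (\<lambda>u. H (d \<otimes> u))) = F \<one> * I \<one>"
    using symmetric[of F I] by simp
  moreover have "F \<one> = R s p"
    unfolding H[symmetric] F_def coef_def by simp
  ultimately have "(\<Sum>c\<in>carrier G. \<Sum>d\<in>carrier G. R c d * I (c \<otimes> p) * coef p (\<lambda>u. H (d \<otimes> u))) \<noteq> 0"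
    using R by (simp add: I_def)
  then obtain c where c: "c \<in> carrier G" "(\<Sum>d\<in>carrier G. R c d * I (c \<otimes> p) * coef p (\<lambda>u. H (d \<otimes> u))) \<noteq> 0"
    by (rule sum.not_neutral_contains_not_neutral)
  then obtain d where d: "d \<in> carrier G" "R c d * I (c \<otimes> p) * coef p (\<lambda>u. H (d \<otimes> u)) \<noteq> 0"
    using sum.not_neutral_contains_not_neutral by blast
  then have "c \<in> supp" "c \<otimes> p = \<one>" using c by (auto simp: supp_def I_def split: if_splits)
  then have "inv c \<in> supp" "inv p = c"
    using c p by (auto simp: subgroup.m_inv_closed[OF supp_subgroup] intro: inv_equality)
  then show ?thesis using p by (metis inv_inv)
qed

text \<open>Equivariance tested on indicator functions says that \<open>R\<close> is unchanged when
  both indices are conjugated by the same element.\<close>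

lemma supp_normal: "supp \<lhd> G"
proof (rule normal_invI[OF supp_subgroup])
  fix g a assume g: "g \<in> carrier G" and "a \<in> supp"
  then obtain b where ab: "a \<in> carrier G" "b \<in> carrier G" "R a b \<noteq> 0" by (auto simp: supp_def)
  define I where "I v u = (if u = v then 1 else 0 :: 'k)" for u v :: 'a
  have *: "(\<Sum>x\<in>carrier G. \<Sum>y\<in>carrier G. R x y * (I v x * I w y)) = R v w"
    if "v \<in> carrier G" "w \<in> carrier G" for v w
  proof -
    have "(\<Sum>x\<in>carrier G. \<Sum>y\<in>carrier G. R x y * (I v x * I w y)) =
        (\<Sum>x\<in>carrier G. if x = v then \<Sum>y\<in>carrier G. if y = w then R x y else 0 else 0)"
      by (intro sum.cong refl) (auto simp: I_def intro!: sum.cong)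
    then show ?thesis using that finite_carrier by simp
  qed
  have r: "I (g \<otimes> v) (u \<otimes> g) = I (g \<otimes> v \<otimes> inv g) u" "I (g \<otimes> v) (g \<otimes> u) = I v u"
    if "u \<in> carrier G" "v \<in> carrier G" for u v
    using that g by (auto simp: I_def inv_solve_right)
  have "(\<Sum>x\<in>carrier G. \<Sum>y\<in>carrier G. R x y * (I (g \<otimes> a \<otimes> inv g) x * I (g \<otimes> b \<otimes> inv g) y)) =
     (\<Sum>x\<in>carrier G. \<Sum>y\<in>carrier G. R x y * (I a x * I b y))"
    using equivariant[OF g, of "I (g \<otimes> a)" "I (g \<otimes> b)"] ab by (simp add: r cong: sum.cong)
  then have "R (g \<otimes> a \<otimes> inv g) (g \<otimes> b \<otimes> inv g) = R a b" using ab g by (simp add: *)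
  then show "g \<otimes> a \<otimes> inv g \<in> supp" using ab g by (auto simp: supp_def intro!: bexI[of _ "g \<otimes> b \<otimes> inv g"])
qed

section \<open>The Fourier transform of the matrix as a bicharacter\<close>

definition pairing :: "('a \<Rightarrow> 'k) \<Rightarrow> ('a \<Rightarrow> 'k) \<Rightarrow> 'k" where
  "pairing \<phi> \<psi> = (\<Sum>a\<in>carrier G. \<Sum>b\<in>carrier G. R a b * (\<phi> a * \<psi> b))"

lemma R_supp:
  assumes "a \<in> carrier G" "b \<in> carrier G" "R a b \<noteq> 0"
  shows "a \<in> supp \<and> b \<in> supp"
  using assms right_supp by (auto simp: supp_def)

lemma pairing_cong:
  assumes "\<And>a. a \<in> supp \<Longrightarrow> \<phi> a = \<phi>' a" "\<And>a. a \<in> supp \<Longrightarrow> \<psi> a = \<psi>' a"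
  shows "pairing \<phi> \<psi> = pairing \<phi>' \<psi>'"
  unfolding pairing_def
proof (intro sum.cong refl)
  fix a b assume "a \<in> carrier G" "b \<in> carrier G"
  then show "R a b * (\<phi> a * \<psi> b) = R a b * (\<phi>' a * \<psi>' b)"
    using assms R_supp[of a b] by (cases "R a b = 0") auto
qed

lemma pairing_coef: "pairing \<phi> \<psi> = (\<Sum>b\<in>carrier G. coef b \<phi> * \<psi> b)"
  unfolding pairing_def coef_def by (subst sum.swap) (simp add: sum_distrib_left sum_distrib_right mult_ac)

text \<open>A character \<phi> of \<open>supp\<close> sends the e_b to scalars
  \<open>coef b \<phi>\<close> that are again orthogonal idempotents, so only the diagonal terms of
  the product of the two pairings survive.\<close>

lemma pairing_mult_right:
  assumes \<phi>: "mult_char G supp \<phi>"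
  shows "pairing \<phi> (\<lambda>a. \<psi> a * \<psi>' a) = pairing \<phi> \<psi> * pairing \<phi> \<psi>'"
proof -
  have "coef b \<phi> * coef d \<phi> = (if b = d then coef b \<phi> else 0)"
    if bd: "b \<in> carrier G" "d \<in> carrier G" for b d
  proof -
    have "coef b \<phi> * coef d \<phi> = (\<Sum>a\<in>carrier G. \<Sum>c\<in>carrier G. R a b * R c d * \<phi> (c \<otimes> a))"
      unfolding coef_def sum_product
    proof (intro sum.cong refl)
      fix a c assume "a \<in> carrier G" "c \<in> carrier G"
      then show "R a b * \<phi> a * (R c d * \<phi> c) = R a b * R c d * \<phi> (c \<otimes> a)"
        using R_supp[of a b] R_supp[of c d] bd \<phi>
        by (cases "R a b = 0 \<or> R c d = 0") (auto simp: mult_char_def)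
    qed
    then show ?thesis using hexagon1[OF bd] by (simp add: coef_def)
  qed
  then have "pairing \<phi> \<psi> * pairing \<phi> \<psi>' =
      (\<Sum>b\<in>carrier G. \<Sum>d\<in>carrier G. (if b = d then coef b \<phi> else 0) * (\<psi> b * \<psi>' d))"
    unfolding pairing_coef sum_product by (intro sum.cong refl) (simp add: mult_ac)
  also have "\<dots> = (\<Sum>b\<in>carrier G. \<Sum>d\<in>carrier G. if b = d then coef b \<phi> * (\<psi> b * \<psi>' d) else 0)"
    by (intro sum.cong refl) auto
  also have "\<dots> = pairing \<phi> (\<lambda>a. \<psi> a * \<psi>' a)"
    using finite_carrier by (simp add: pairing_coef)
  finally show ?thesis by simp
qed

lemma pairing_skew:
  assumes \<phi>: "mult_char G supp \<phi>" and \<psi>: "mult_char G supp \<psi>"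
  shows "pairing \<phi> \<psi> * pairing \<psi> \<phi> = 1"
proof -
  have "pairing \<phi> \<psi> * pairing \<psi> \<phi> = (\<Sum>a\<in>carrier G. \<Sum>c\<in>carrier G. \<Sum>b\<in>carrier G. \<Sum>d\<in>carrier G.
      (R a b * (\<phi> a * \<psi> b)) * (R c d * (\<psi> c * \<phi> d)))"
    unfolding pairing_def sum_product by simp
  also have "\<dots> = (\<Sum>a\<in>carrier G. \<Sum>b\<in>carrier G. \<Sum>c\<in>carrier G. \<Sum>d\<in>carrier G.
      (R a b * (\<phi> a * \<psi> b)) * (R c d * (\<psi> c * \<phi> d)))"
    by (intro sum.cong refl sum.swap)
  also have "\<dots> = (\<Sum>a\<in>carrier G. \<Sum>b\<in>carrier G. \<Sum>c\<in>carrier G. \<Sum>d\<in>carrier G.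
      R a b * R c d * (\<phi> (d \<otimes> a) * \<psi> (c \<otimes> b)))"
  proof (intro sum.cong refl)
    fix a b c d assume "a \<in> carrier G" "b \<in> carrier G" "c \<in> carrier G" "d \<in> carrier G"
    then show "(R a b * (\<phi> a * \<psi> b)) * (R c d * (\<psi> c * \<phi> d)) = R a b * R c d * (\<phi> (d \<otimes> a) * \<psi> (c \<otimes> b))"
      using R_supp[of a b] R_supp[of c d] \<phi> \<psi>
      by (cases "R a b = 0 \<or> R c d = 0") (auto simp: mult_char_def)
  qed
  also have "\<dots> = 1"
    using symmetric[of \<phi> \<psi>] mult_char_one[OF supp_subgroup \<phi>] mult_char_one[OF supp_subgroup \<psi>] by simp
  finally show ?thesis .
qed

lemma mult_char_times:
  "mult_char G A \<phi> \<Longrightarrow> mult_char G A \<psi> \<Longrightarrow> mult_char G A (\<lambda>a. \<phi> a * \<psi> a)"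
  by (auto simp: mult_char_def)

text \<open>Skewness reduces this to the second argument: both sides are inverse to
  \<open>pairing \<psi> \<phi> * pairing \<psi> \<phi>'\<close>.\<close>

lemma pairing_mult_left:
  assumes "mult_char G supp \<phi>" "mult_char G supp \<phi>'" "mult_char G supp \<psi>"
  shows "pairing (\<lambda>a. \<phi> a * \<phi>' a) \<psi> = pairing \<phi> \<psi> * pairing \<phi>' \<psi>"
proof -
  have "pairing (\<lambda>a. \<phi> a * \<phi>' a) \<psi> * (pairing \<psi> \<phi> * pairing \<psi> \<phi>') = 1"
    using pairing_skew[OF mult_char_times[OF assms(1,2)] assms(3)]
      pairing_mult_right[OF assms(3), of \<phi> \<phi>'] by simp
  moreover have "pairing \<phi> \<psi> * pairing \<psi> \<phi> = 1" "pairing \<phi>' \<psi> * pairing \<psi> \<phi>' = 1"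
    using pairing_skew assms by auto
  ultimately show ?thesis
    by (metis (no_types, lifting) mult.assoc mult.commute mult.right_neutral)
qed

text \<open>For nonzero e_p, the eigenvalues \<open>dual a p\<close> form a character in
  \<open>a\<close>. Testing a character \<phi> of the radical against these shows that the
  combination of the group elements b with coefficients \<phi>(e_b) is the unit of the group
  algebra, so \<phi>(e_b) is independent of \<phi>. Hence \<psi> and the trivial character agree on
  all e_b, and thus on \<open>supp\<close>.\<close>

lemma pairing_nondegenerate:
  assumes \<psi>: "mult_char G supp \<psi>" and triv: "\<And>\<phi>. mult_char G supp \<phi> \<Longrightarrow> pairing \<psi> \<phi> = 1"
    and a: "a \<in> supp"
  shows "\<psi> a = 1"
proof -
  have one: "\<one> \<in> supp" using supp_subgroup by (rule subgroup.one_closed)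
  have coef_nz: "\<exists>H. coef p H \<noteq> 0" if "p \<in> carrier G" "s \<in> carrier G" "R s p \<noteq> 0" for s p
    using that coef_indicator[of s p] by metis
  \<comment> \<open>The witness \<open>H\<close> certifies that e_p is nonzero, so that
    \<open>coef p H\<close> can be cancelled.\<close>
  have dual_char: "mult_char G supp (\<lambda>a. dual a p)" and dual_one: "dual \<one> p = 1"
    if p: "p \<in> carrier G" and H: "coef p H \<noteq> 0" for p H
  proof -
    have "coef p (\<lambda>s. H (\<one> \<otimes> s)) = coef p H" by (simp add: coef_def)
    then show d1: "dual \<one> p = 1" using coef_translate[OF one p, of H] H by simp
    have m: "dual (a \<otimes> b) p = dual a p * dual b p" if "a \<in> supp" "b \<in> supp" for a b
    proof -
      have "dual (a \<otimes> b) p * coef p H = coef p (\<lambda>s. H (a \<otimes> b \<otimes> s))"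
        using coef_translate[OF supp_mult[OF that] p, of H] by simp
      also have "\<dots> = coef p (\<lambda>s. H (a \<otimes> (b \<otimes> s)))"
        unfolding coef_def using that supp_carrier by (simp add: m_assoc)
      also have "\<dots> = dual b p * (dual a p * coef p H)"
        using coef_translate[OF that(2) p, of "\<lambda>u. H (a \<otimes> u)"] coef_translate[OF that(1) p, of H] by simp
      finally show ?thesis using H by simp
    qed
    moreover have "dual b p \<noteq> 0" if "b \<in> supp" for b
    proof -
      have "dual b p * dual (inv b) p = 1"
        using m[OF that subgroup.m_inv_closed[OF supp_subgroup that]] d1 supp_carrier[OF that] by simp
      then show ?thesis by auto
    qed
    ultimately show "mult_char G supp (\<lambda>a. dual a p)" by (simp add: mult_char_def)
  qed
  have key: "coef b \<phi> = (if b = \<one> then 1 else 0)"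
    if \<phi>: "mult_char G supp \<phi>" "\<And>\<chi>. mult_char G supp \<chi> \<Longrightarrow> pairing \<phi> \<chi> = 1" and b: "b \<in> carrier G" for \<phi> b
  proof -
    define F where "F u = (if u = b then 1 else 0 :: 'k)" for u
    have "coef b \<phi> = (\<Sum>u\<in>carrier G. if u = b then coef u \<phi> else 0)"
      using b finite_carrier by simp
    also have "\<dots> = (\<Sum>u\<in>carrier G. coef u \<phi> * F u)"
      by (rule sum.cong) (auto simp: F_def)
    also have "\<dots> = (\<Sum>u\<in>carrier G. \<Sum>p\<in>carrier G. coef u \<phi> * (dual u p * coef p F))"
    proof (rule sum.cong[OF refl])
      fix u assume u: "u \<in> carrier G"
      show "coef u \<phi> * F u = (\<Sum>p\<in>carrier G. coef u \<phi> * (dual u p * coef p F))"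
      proof (cases "u \<in> supp")
        case True
        then show ?thesis using eval_dual[OF True, of F] by (simp add: sum_distrib_left)
      next
        \<comment> \<open>For \<open>u\<close> outside \<open>supp\<close> the idempotent e_u is
          zero, because the second index of a nonzero entry also lies in
          \<open>supp\<close>.\<close>
        case False
        then have "coef u \<phi> = 0" unfolding coef_def using R_supp[of _ u] u by (intro sum.neutral) auto
        then show ?thesis by simp
      qed
    qed
    also have "\<dots> = (\<Sum>p\<in>carrier G. (\<Sum>u\<in>carrier G. coef u \<phi> * dual u p) * coef p F)"
      by (subst sum.swap) (simp add: sum_distrib_left sum_distrib_right mult_ac)
    also have "\<dots> = (\<Sum>p\<in>carrier G. dual \<one> p * coef p F)"
    proof (rule sum.cong[OF refl])
      \<comment> \<open>The inner sum is the pairing of \<phi> with the character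
        \<open>\<lambda>u. dual u p\<close>, hence 1, and so is \<open>dual \<one> p\<close>. If e_p
        is zero, the factor \<open>coef p F\<close> vanishes instead.\<close>
      fix p assume p: "p \<in> carrier G"
      show "(\<Sum>u\<in>carrier G. coef u \<phi> * dual u p) * coef p F = dual \<one> p * coef p F"
        using \<phi>(2)[OF dual_char[OF p]] dual_one[OF p] unfolding pairing_coef
        by (cases "coef p F = 0") auto
    qed
    also have "\<dots> = F \<one>" using eval_dual[OF one, of F] by simp
    finally show ?thesis by (auto simp: F_def)
  qed
  have triv_char: "mult_char G supp (\<lambda>_. 1 :: 'k)" by (simp add: mult_char_def)
  \<comment> \<open>Multiplicativity makes the value equal to its own square, and skewness makes it
    nonzero.\<close>
  have triv_pairing: "pairing (\<lambda>_. 1) \<chi> = 1" if "mult_char G supp \<chi>" for \<chi>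
    using pairing_mult_left[OF triv_char triv_char that] pairing_skew[OF triv_char that] by auto
  have "\<psi> a = (\<Sum>y\<in>carrier G. dual a y * coef y \<psi>)" by (rule eval_dual[OF a])
  also have "\<dots> = (\<Sum>y\<in>carrier G. dual a y * coef y (\<lambda>_. 1))"
    using key[OF \<psi> triv] key[OF triv_char triv_pairing] by simp
  also have "\<dots> = 1" using eval_dual[OF a, of "\<lambda>_. 1"] by simp
  finally show ?thesis .
qed

text \<open>Equivariance for functionals translated by \<open>inv g\<close>: multiplication by
  \<open>g\<close> on the right becomes conjugation, and multiplication by \<open>g\<close> on the
  left cancels.\<close>

lemma pairing_conjugate:
  assumes g: "g \<in> carrier G"
  shows "pairing (\<lambda>a. \<phi> (inv g \<otimes> a \<otimes> g)) (\<lambda>a. \<psi> (inv g \<otimes> a \<otimes> g)) = pairing \<phi> \<psi>"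
proof -
  have "inv g \<otimes> (g \<otimes> a) = a" if "a \<in> carrier G" for a
    using that g by (simp flip: m_assoc)
  then show ?thesis
    using equivariant[OF g, of "\<lambda>u. \<phi> (inv g \<otimes> u)" "\<lambda>u. \<psi> (inv g \<otimes> u)"] g
    by (simp add: pairing_def m_assoc cong: sum.cong)
qed

end

section \<open>Universal property of the tensor product\<close>

abbreviation vs :: "('k::field, 'v, 'a) module_scheme \<Rightarrow> bool" where
  "vs V \<equiv> vectorspace class_ring V"

abbreviation lin :: "('k::field, 'v, 'a) module_scheme \<Rightarrow> ('k, 'w, 'b) module_scheme \<Rightarrow> ('v \<Rightarrow> 'w) \<Rightarrow> bool" where
  "lin V W f \<equiv> linear_map class_ring V W f"

text \<open>The values lie in the field type, which is not a possible target of the universal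
  property; functionals on tensor products are obtained by a detour through the unit object.\<close>

definition linear_functional :: "('k::field, 'v, 'a) module_scheme \<Rightarrow> ('v \<Rightarrow> 'k) \<Rightarrow> bool" where
  "linear_functional V f \<longleftrightarrow>
     (\<forall>x\<in>carrier V. \<forall>y\<in>carrier V. f (x \<oplus>\<^bsub>V\<^esub> y) = f x + f y) \<and>
     (\<forall>c. \<forall>x\<in>carrier V. f (c \<odot>\<^bsub>V\<^esub> x) = c * f x)"

text \<open>The universal property of a tensor product only mentions targets that are bare module records.\<close>

definition base_module :: "('k, 'v, 'a) module_scheme \<Rightarrow> ('k, 'v) module" where
  "base_module V = \<lparr>carrier = carrier V, monoid.mult = monoid.mult V, one = one V,
     zero = zero V, add = add V, module.smult = module.smult V\<rparr>"

lemma base_module_simps [simp]: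
  "carrier (base_module V) = carrier V" "zero (base_module V) = zero V"
  "add (base_module V) = add V" "module.smult (base_module V) = module.smult V"
  by (simp_all add: base_module_def)

lemma vsD:
  assumes "vs V"
  shows "\<zero>\<^bsub>V\<^esub> \<in> carrier V"
    "x \<in> carrier V \<Longrightarrow> y \<in> carrier V \<Longrightarrow> x \<oplus>\<^bsub>V\<^esub> y \<in> carrier V"
    "x \<in> carrier V \<Longrightarrow> c \<odot>\<^bsub>V\<^esub> x \<in> carrier V"
    "x \<in> carrier V \<Longrightarrow> y \<in> carrier V \<Longrightarrow> x \<oplus>\<^bsub>V\<^esub> y = y \<oplus>\<^bsub>V\<^esub> x"
    "x \<in> carrier V \<Longrightarrow> y \<in> carrier V \<Longrightarrow> z \<in> carrier V \<Longrightarrow>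
       (x \<oplus>\<^bsub>V\<^esub> y) \<oplus>\<^bsub>V\<^esub> z = x \<oplus>\<^bsub>V\<^esub> (y \<oplus>\<^bsub>V\<^esub> z)"
    "x \<in> carrier V \<Longrightarrow> (a + b) \<odot>\<^bsub>V\<^esub> x = a \<odot>\<^bsub>V\<^esub> x \<oplus>\<^bsub>V\<^esub> b \<odot>\<^bsub>V\<^esub> x"
    "x \<in> carrier V \<Longrightarrow> y \<in> carrier V \<Longrightarrow> c \<odot>\<^bsub>V\<^esub> (x \<oplus>\<^bsub>V\<^esub> y) = c \<odot>\<^bsub>V\<^esub> x \<oplus>\<^bsub>V\<^esub> c \<odot>\<^bsub>V\<^esub> y"
    "x \<in> carrier V \<Longrightarrow> a \<odot>\<^bsub>V\<^esub> (b \<odot>\<^bsub>V\<^esub> x) = (a * b) \<odot>\<^bsub>V\<^esub> x"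
    "x \<in> carrier V \<Longrightarrow> 1 \<odot>\<^bsub>V\<^esub> x = x"
    "x \<in> carrier V \<Longrightarrow> 0 \<odot>\<^bsub>V\<^esub> x = \<zero>\<^bsub>V\<^esub>"
    "c \<odot>\<^bsub>V\<^esub> \<zero>\<^bsub>V\<^esub> = \<zero>\<^bsub>V\<^esub>"
    "x \<in> carrier V \<Longrightarrow> \<zero>\<^bsub>V\<^esub> \<oplus>\<^bsub>V\<^esub> x = x"
    "x \<in> carrier V \<Longrightarrow> x \<oplus>\<^bsub>V\<^esub> \<zero>\<^bsub>V\<^esub> = x"
    "abelian_monoid V"
proof -
  interpret vectorspace class_ring V by fact
  show "\<zero>\<^bsub>V\<^esub> \<in> carrier V"
    "x \<in> carrier V \<Longrightarrow> y \<in> carrier V \<Longrightarrow> x \<oplus>\<^bsub>V\<^esub> y \<in> carrier V"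
    "x \<in> carrier V \<Longrightarrow> y \<in> carrier V \<Longrightarrow> x \<oplus>\<^bsub>V\<^esub> y = y \<oplus>\<^bsub>V\<^esub> x"
    "x \<in> carrier V \<Longrightarrow> y \<in> carrier V \<Longrightarrow> z \<in> carrier V \<Longrightarrow>
       (x \<oplus>\<^bsub>V\<^esub> y) \<oplus>\<^bsub>V\<^esub> z = x \<oplus>\<^bsub>V\<^esub> (y \<oplus>\<^bsub>V\<^esub> z)"
    "x \<in> carrier V \<Longrightarrow> \<zero>\<^bsub>V\<^esub> \<oplus>\<^bsub>V\<^esub> x = x"
    "x \<in> carrier V \<Longrightarrow> x \<oplus>\<^bsub>V\<^esub> \<zero>\<^bsub>V\<^esub> = x"
    by (simp_all add: M.a_ac)
  show "x \<in> carrier V \<Longrightarrow> c \<odot>\<^bsub>V\<^esub> x \<in> carrier V"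
    using smult_closed by simp
  show "x \<in> carrier V \<Longrightarrow> (a + b) \<odot>\<^bsub>V\<^esub> x = a \<odot>\<^bsub>V\<^esub> x \<oplus>\<^bsub>V\<^esub> b \<odot>\<^bsub>V\<^esub> x"
    using smult_l_distr[of a b x] by simp
  show "x \<in> carrier V \<Longrightarrow> y \<in> carrier V \<Longrightarrow> c \<odot>\<^bsub>V\<^esub> (x \<oplus>\<^bsub>V\<^esub> y) = c \<odot>\<^bsub>V\<^esub> x \<oplus>\<^bsub>V\<^esub> c \<odot>\<^bsub>V\<^esub> y"
    using smult_r_distr[of c x y] by simp
  show "x \<in> carrier V \<Longrightarrow> a \<odot>\<^bsub>V\<^esub> (b \<odot>\<^bsub>V\<^esub> x) = (a * b) \<odot>\<^bsub>V\<^esub> x"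
    using smult_assoc1[of a b x] by simp
  show "x \<in> carrier V \<Longrightarrow> 1 \<odot>\<^bsub>V\<^esub> x = x" using smult_one[of x] by simp
  show "x \<in> carrier V \<Longrightarrow> 0 \<odot>\<^bsub>V\<^esub> x = \<zero>\<^bsub>V\<^esub>" using smult_l_null[of x] by simp
  show "c \<odot>\<^bsub>V\<^esub> \<zero>\<^bsub>V\<^esub> = \<zero>\<^bsub>V\<^esub>" using smult_r_null[of c] by simp
  show "abelian_monoid V" by unfold_locales
qed

lemma vs_cong:
  assumes V: "vs V" and eq: "carrier V' = carrier V" "zero V' = zero V" "add V' = add V" "module.smult V' = module.smult V"
  shows "vs V'"
proof (rule vs_criteria[OF class_field])
  have "x \<oplus>\<^bsub>V\<^esub> (- 1) \<odot>\<^bsub>V\<^esub> x = \<zero>\<^bsub>V\<^esub>" if "x \<in> carrier V" for x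
    using vsD(6)[OF V that, of 1 "- 1"] vsD(9,10)[OF V that] by simp
  then show "\<forall>v\<in>carrier V'. \<exists>w\<in>carrier V'. v \<oplus>\<^bsub>V'\<^esub> w = \<zero>\<^bsub>V'\<^esub>"
    using vsD(3)[OF V] by (auto simp: eq)
qed (use vsD[OF V] in \<open>auto simp: eq\<close>)

lemma vs_base_module [simp]: "vs (base_module V) \<longleftrightarrow> vs V"
  using vs_cong[of V "base_module V"] vs_cong[of "base_module V" V] by auto

lemma lin_iff:
  "lin V W f \<longleftrightarrow> vs V \<and> vs W \<and> (\<forall>x\<in>carrier V. f x \<in> carrier W) \<and>
     (\<forall>x\<in>carrier V. \<forall>y\<in>carrier V. f (x \<oplus>\<^bsub>V\<^esub> y) = f x \<oplus>\<^bsub>W\<^esub> f y) \<and>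
     (\<forall>c. \<forall>x\<in>carrier V. f (c \<odot>\<^bsub>V\<^esub> x) = c \<odot>\<^bsub>W\<^esub> f x)"
  unfolding linear_map_def mod_hom_def mod_hom_axioms_def LinearCombinations.module_hom_def vectorspace_def by auto

lemma lin_base_module [simp]:
  "lin (base_module V) W f \<longleftrightarrow> lin V W f" "lin V (base_module W) f \<longleftrightarrow> lin V W f"
  by (simp_all add: lin_iff)

lemma linD:
  assumes "lin V W f"
  shows "vs V" "vs W" "x \<in> carrier V \<Longrightarrow> f x \<in> carrier W"
    "x \<in> carrier V \<Longrightarrow> y \<in> carrier V \<Longrightarrow> f (x \<oplus>\<^bsub>V\<^esub> y) = f x \<oplus>\<^bsub>W\<^esub> f y"
    "x \<in> carrier V \<Longrightarrow> f (c \<odot>\<^bsub>V\<^esub> x) = c \<odot>\<^bsub>W\<^esub> f x"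
  using assms by (auto simp: lin_iff)

lemma lin_id: "vs V \<Longrightarrow> lin V V (\<lambda>x. x)"
  by (simp add: lin_iff)

lemma lin_comp: "lin U V f \<Longrightarrow> lin V W g \<Longrightarrow> lin U W (\<lambda>x. g (f x))"
  by (simp add: lin_iff)

lemma lin_add:
  assumes f: "lin U V f" and g: "lin U V g"
  shows "lin U V (\<lambda>x. f x \<oplus>\<^bsub>V\<^esub> g x)"
proof -
  interpret V: abelian_monoid V using vsD(14) linD(2)[OF f] by blast
  show ?thesis using f g by (auto simp: lin_iff vsD V.a_ac)
qed

lemma lin_smult: "lin U V f \<Longrightarrow> lin U V (\<lambda>x. c \<odot>\<^bsub>V\<^esub> f x)"
  by (auto simp: lin_iff vsD mult.commute)

lemma lin_zero: "lin V W f \<Longrightarrow> f \<zero>\<^bsub>V\<^esub> = \<zero>\<^bsub>W\<^esub>"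
  by (metis linD(1,2,3,5) vsD(1,10))

lemma lin_finsum:
  assumes f: "lin V W f" and "finite I" and v: "\<And>i. i \<in> I \<Longrightarrow> v i \<in> carrier V"
  shows "f (\<Oplus>\<^bsub>V\<^esub>i\<in>I. v i) = (\<Oplus>\<^bsub>W\<^esub>i\<in>I. f (v i))"
proof -
  interpret V: abelian_monoid V using vsD(14) linD(1)[OF f] by blast
  interpret W: abelian_monoid W using vsD(14) linD(2)[OF f] by blast
  show ?thesis using assms(2) v
  proof (induction I rule: finite_induct)
    case empty
    then show ?case using lin_zero[OF f] by simp
  next
    case (insert i I)
    then have "f (\<Oplus>\<^bsub>V\<^esub>i\<in>insert i I. v i) = f (v i \<oplus>\<^bsub>V\<^esub> (\<Oplus>\<^bsub>V\<^esub>i\<in>I. v i))"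
      by (subst V.finsum_insert) auto
    also have "\<dots> = f (v i) \<oplus>\<^bsub>W\<^esub> (\<Oplus>\<^bsub>W\<^esub>i\<in>I. f (v i))"
      using insert linD(4)[OF f, of "v i" "\<Oplus>\<^bsub>V\<^esub>i\<in>I. v i"] by (simp add: V.finsum_closed)
    also have "\<dots> = (\<Oplus>\<^bsub>W\<^esub>i\<in>insert i I. f (v i))"
      using insert linD(3)[OF f] by (subst W.finsum_insert) auto
    finally show ?case .
  qed
qed

lemma functional_finsum:
  assumes V: "vs V" and f: "linear_functional V f" and "finite I" and v: "\<And>i. i \<in> I \<Longrightarrow> v i \<in> carrier V"
  shows "f (\<Oplus>\<^bsub>V\<^esub>i\<in>I. v i) = (\<Sum>i\<in>I. f (v i))"
proof -
  interpret V: abelian_monoid V using vsD(14)[OF V] .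
  have zero: "f \<zero>\<^bsub>V\<^esub> = 0"
    using f vsD(1)[OF V] vsD(10)[OF V vsD(1)[OF V]] unfolding linear_functional_def
    by (metis mult_zero_left)
  show ?thesis using assms(3) v
  proof (induction I rule: finite_induct)
    case empty
    then show ?case using zero by simp
  next
    case (insert i I)
    then have "f (\<Oplus>\<^bsub>V\<^esub>i\<in>insert i I. v i) = f (v i \<oplus>\<^bsub>V\<^esub> (\<Oplus>\<^bsub>V\<^esub>i\<in>I. v i))"
      by (subst V.finsum_insert) auto
    then show ?case using insert f by (simp add: linear_functional_def V.finsum_closed)
  qed
qed

lemma smult_sum_finsum:
  assumes V: "vs V" and "finite I" and x: "x \<in> carrier V"
  shows "(\<Oplus>\<^bsub>V\<^esub>i\<in>I. c i \<odot>\<^bsub>V\<^esub> x) = (\<Sum>i\<in>I. c i) \<odot>\<^bsub>V\<^esub> x"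
proof -
  interpret V: abelian_monoid V using vsD(14)[OF V] .
  show ?thesis using assms(2)
  proof (induction I rule: finite_induct)
    case (insert i I)
    then show ?case using vsD[OF V] x by (subst V.finsum_insert) auto
  qed (use vsD(10)[OF V x] in simp)
qed

lemma functional_comp:
  "lin V W f \<Longrightarrow> linear_functional W L \<Longrightarrow> linear_functional V (\<lambda>x. L (f x))"
  by (simp add: linear_functional_def lin_iff)

lemma lin_functional_smult:
  assumes V: "vs V" and W: "vs W" and L: "linear_functional V L" and u: "u \<in> carrier W"
  shows "lin V W (\<lambda>x. L x \<odot>\<^bsub>W\<^esub> u)"
  using assms by (auto simp: lin_iff linear_functional_def vsD)

lemma lin_finsum_fun:
  assumes V: "vs V" and W: "vs W" and "finite I" and f: "\<And>i. i \<in> I \<Longrightarrow> lin V W (f i)"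
  shows "lin V W (\<lambda>x. \<Oplus>\<^bsub>W\<^esub>i\<in>I. f i x)"
proof -
  interpret W: abelian_monoid W using vsD(14)[OF W] .
  have cl: "(\<lambda>i. f i x) \<in> I \<rightarrow> carrier W" if "x \<in> carrier V" for x
    using linD(3)[OF f that] by auto
  show ?thesis
    unfolding lin_iff
  proof (intro conjI ballI allI)
    fix x assume x: "x \<in> carrier V"
    show "(\<Oplus>\<^bsub>W\<^esub>i\<in>I. f i x) \<in> carrier W" by (rule W.finsum_closed[OF cl[OF x]])
    fix y assume y: "y \<in> carrier V"
    have "(\<Oplus>\<^bsub>W\<^esub>i\<in>I. f i (x \<oplus>\<^bsub>V\<^esub> y)) = (\<Oplus>\<^bsub>W\<^esub>i\<in>I. f i x \<oplus>\<^bsub>W\<^esub> f i y)"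
      by (rule W.finsum_cong') (use cl[OF x] cl[OF y] linD(4)[OF f x y] in auto)
    then show "(\<Oplus>\<^bsub>W\<^esub>i\<in>I. f i (x \<oplus>\<^bsub>V\<^esub> y)) = (\<Oplus>\<^bsub>W\<^esub>i\<in>I. f i x) \<oplus>\<^bsub>W\<^esub> (\<Oplus>\<^bsub>W\<^esub>i\<in>I. f i y)"
      using W.finsum_addf[OF cl[OF x] cl[OF y]] by simp
  next
    fix c x assume x: "x \<in> carrier V"
    have "(\<Oplus>\<^bsub>W\<^esub>i\<in>I. f i (c \<odot>\<^bsub>V\<^esub> x)) = (\<Oplus>\<^bsub>W\<^esub>i\<in>I. c \<odot>\<^bsub>W\<^esub> f i x)"
      by (rule W.finsum_cong') (use cl[OF x] linD(5)[OF f x] vsD(3)[OF W] in \<open>auto simp: Pi_iff\<close>)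
    also have "\<dots> = c \<odot>\<^bsub>W\<^esub> (\<Oplus>\<^bsub>W\<^esub>i\<in>I. f i x)"
      using lin_finsum[OF lin_smult[OF lin_id[OF W]] assms(3), of "\<lambda>i. f i x" c] cl[OF x] by (simp add: Pi_iff)
    finally show "(\<Oplus>\<^bsub>W\<^esub>i\<in>I. f i (c \<odot>\<^bsub>V\<^esub> x)) = c \<odot>\<^bsub>W\<^esub> (\<Oplus>\<^bsub>W\<^esub>i\<in>I. f i x)" .
  qed (use V W in auto)
qed

lemma finsum_cong_in:
  assumes "vs V" "\<And>i. i \<in> I \<Longrightarrow> g i \<in> carrier V" "\<And>i. i \<in> I \<Longrightarrow> f i = g i"
  shows "(\<Oplus>\<^bsub>V\<^esub>i\<in>I. f i) = (\<Oplus>\<^bsub>V\<^esub>i\<in>I. g i)"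
proof -
  interpret V: abelian_monoid V using vsD(14)[OF assms(1)] .
  show ?thesis by (rule V.finsum_cong') (use assms in auto)
qed

lemma finsum_in:
  assumes "vs V" "\<And>i. i \<in> I \<Longrightarrow> g i \<in> carrier V"
  shows "(\<Oplus>\<^bsub>V\<^esub>i\<in>I. g i) \<in> carrier V"
proof -
  interpret V: abelian_monoid V using vsD(14)[OF assms(1)] .
  show ?thesis by (rule V.finsum_closed) (use assms in auto)
qed

lemma bilinear_mapI:
  assumes "\<And>v. v \<in> carrier V \<Longrightarrow> lin W Z (\<beta> v)" "\<And>w. w \<in> carrier W \<Longrightarrow> lin V Z (\<lambda>v. \<beta> v w)"
  shows "bilinear_map V W Z \<beta>"
  using assms by (simp add: bilinear_map_def)

lemma tensor_pure_linear:
  assumes "is_tensor_product V W P t"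
  shows "v \<in> carrier V \<Longrightarrow> lin W P (t v)" "w \<in> carrier W \<Longrightarrow> lin V P (\<lambda>v. t v w)"
  using assms by (auto simp: is_tensor_product_def bilinear_map_def)

lemma tensor_pure_closed:
  assumes "is_tensor_product V W P t"
  shows "v \<in> carrier V \<Longrightarrow> w \<in> carrier W \<Longrightarrow> t v w \<in> carrier P"
  using linD(3)[OF tensor_pure_linear(1)[OF assms]] .

lemma tensor_lift:
  fixes Z :: "('k::field, 'v, 'a) module_scheme"
  assumes P: "is_tensor_product V W P t" and b: "bilinear_map V W Z \<beta>" and Z: "vs Z"
  obtains h where "lin P Z h" "\<And>v w. v \<in> carrier V \<Longrightarrow> w \<in> carrier W \<Longrightarrow> h (t v w) = \<beta> v w"
proof -
  have "bilinear_map V W (base_module Z) \<beta>" using b by (simp add: bilinear_map_def)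
  then have "\<exists>!h. h \<in> extensional (carrier P) \<and> lin P (base_module Z) h \<and>
      (\<forall>v\<in>carrier V. \<forall>w\<in>carrier W. h (t v w) = \<beta> v w)"
    using Z by (intro P[unfolded is_tensor_product_def, THEN conjunct2, THEN conjunct2, rule_format] conjI) simp_all
  then show ?thesis using that by auto
qed

text \<open>The uniqueness clause concerns extensional maps into bare module records. Both maps are
  therefore restricted to the carrier and regarded as maps into the underlying module.\<close>

lemma tensor_unique:
  fixes V :: "('k::field, 'v, 'b) module_scheme" and Z :: "('k::field, 'v, 'a) module_scheme"
  assumes P: "is_tensor_product V W P t" and h: "lin P Z h" and h': "lin P Z h'"
    and eq: "\<And>v w. v \<in> carrier V \<Longrightarrow> w \<in> carrier W \<Longrightarrow> h (t v w) = h' (t v w)"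
    and x: "x \<in> carrier P"
  shows "h x = h' x"
proof -
  note pc = tensor_pure_closed[OF P]
  define \<beta> where "\<beta> v w = h (t v w)" for v w
  have "bilinear_map V W (base_module Z) \<beta>"
    unfolding \<beta>_def lin_base_module bilinear_map_def
    using lin_comp[OF tensor_pure_linear(1)[OF P] h] lin_comp[OF tensor_pure_linear(2)[OF P] h] by simp
  then have ex1: "\<exists>!h. h \<in> extensional (carrier P) \<and> lin P (base_module Z) h \<and>
      (\<forall>v\<in>carrier V. \<forall>w\<in>carrier W. h (t v w) = \<beta> v w)"
    using linD(2)[OF h]
    by (intro P[unfolded is_tensor_product_def, THEN conjunct2, THEN conjunct2, rule_format] conjI) simp_all
  have *: "restrict k (carrier P) \<in> extensional (carrier P) \<and> lin P (base_module Z) (restrict k (carrier P)) \<and>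
      (\<forall>v\<in>carrier V. \<forall>w\<in>carrier W. restrict k (carrier P) (t v w) = \<beta> v w)"
    if "lin P Z k" "\<And>v w. v \<in> carrier V \<Longrightarrow> w \<in> carrier W \<Longrightarrow> k (t v w) = \<beta> v w" for k
    using that pc by (auto simp: lin_iff vsD)
  have "restrict h (carrier P) = restrict h' (carrier P)"
    using ex1 *[OF h] *[OF h'] eq by (auto simp: \<beta>_def)
  then show ?thesis using x by (metis restrict_apply')
qed

text \<open>A generator together with its coordinate functional, the device for moving scalars into
  \<open>'v\<close> and back.\<close>

lemma one_dim_functional:
  assumes V: "vs V" and fd: "vectorspace.fin_dim class_ring V" and dim: "vectorspace.dim class_ring V = 1"
  obtains u \<kappa> where "u \<in> carrier V" "linear_functional V \<kappa>" "\<kappa> u = 1"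
proof -
  interpret vectorspace class_ring V by fact
  have ex: "\<exists>n A. finite A \<and> card A = n \<and> A \<subseteq> carrier V \<and> gen_set A"
  proof -
    obtain A where A: "finite A \<and> A \<subseteq> carrier V \<and> gen_set A"
      using fd[unfolded fin_dim_def] by (elim exE)
    show ?thesis by (rule exI[of _ "card A"], rule exI[of _ A]) (simp only: A simp_thms)
  qed
  have "\<exists>A. finite A \<and> card A = 1 \<and> A \<subseteq> carrier V \<and> gen_set A"
    using LeastI_ex[OF ex] dim unfolding dim_def by simp
  then obtain u where u: "u \<in> carrier V" "gen_set {u}" by (auto simp: card_1_singleton_iff)
  have zero_V: "\<zero>\<^bsub>V\<^esub> \<in> carrier V" using vsD(1)[OF V] .
  \<comment> \<open>If \<open>u\<close> were zero, the empty set would generate and the dimension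
    would be 0.\<close>
  have u0: "u \<noteq> \<zero>\<^bsub>V\<^esub>"
  proof
    assume "u = \<zero>\<^bsub>V\<^esub>"
    then have "carrier V \<subseteq> {\<zero>\<^bsub>V\<^esub>}"
      using u vsD(10,11)[OF V] finite_span[of "{u}"] by (auto simp: lincomb_def)
    then have "gen_set {}" using zero_V by (auto simp: span_def lincomb_def)
    then have "dim \<le> 0" unfolding dim_def by (intro Least_le) (auto intro: exI[of _ "{}"])
    then show False using dim by simp
  qed
  have gen: "\<exists>c. x = c \<odot>\<^bsub>V\<^esub> u" if "x \<in> carrier V" for x
  proof -
    have "x \<in> span {u}" using that u by simp
    then obtain a where "x = lincomb a {u}" using finite_span[of "{u}"] u(1) by auto
    then show ?thesis using u(1) vsD(3)[OF V u(1)] by (auto simp: lincomb_def)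
  qed
  have uniq: "c = d" if eq: "c \<odot>\<^bsub>V\<^esub> u = d \<odot>\<^bsub>V\<^esub> u" for c d
  proof (rule ccontr)
    assume cd: "c \<noteq> d"
    have "c \<odot>\<^bsub>V\<^esub> u = (c - d) \<odot>\<^bsub>V\<^esub> u \<oplus>\<^bsub>V\<^esub> d \<odot>\<^bsub>V\<^esub> u"
      using vsD(6)[OF V u(1), of "c - d" d] by simp
    then have "(c - d) \<odot>\<^bsub>V\<^esub> u = \<zero>\<^bsub>V\<^esub>"
      using eq vsD(3)[OF V u(1)] by simp
    then have "(1 / (c - d)) \<odot>\<^bsub>V\<^esub> ((c - d) \<odot>\<^bsub>V\<^esub> u) = \<zero>\<^bsub>V\<^esub>"
      using vsD(11)[OF V] by simp
    then show False using cd u0 vsD(8,9)[OF V u(1)] by simp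
  qed
  define \<kappa> where "\<kappa> x = (SOME c. x = c \<odot>\<^bsub>V\<^esub> u)" for x
  have k: "\<kappa> x \<odot>\<^bsub>V\<^esub> u = x" if "x \<in> carrier V" for x
    unfolding \<kappa>_def using someI_ex[OF gen[OF that]] by simp
  have ku: "\<kappa> (c \<odot>\<^bsub>V\<^esub> u) = c" for c
    using k[OF vsD(3)[OF V u(1)]] uniq by blast
  have "linear_functional V \<kappa>"
    unfolding linear_functional_def
  proof (intro conjI ballI allI)
    fix x y assume xy: "x \<in> carrier V" "y \<in> carrier V"
    have "x \<oplus>\<^bsub>V\<^esub> y = (\<kappa> x + \<kappa> y) \<odot>\<^bsub>V\<^esub> u"
      using k xy vsD(6)[OF V u(1)] by simp
    then show "\<kappa> (x \<oplus>\<^bsub>V\<^esub> y) = \<kappa> x + \<kappa> y" using ku by simp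
  next
    fix c x assume x: "x \<in> carrier V"
    have "c \<odot>\<^bsub>V\<^esub> x = (c * \<kappa> x) \<odot>\<^bsub>V\<^esub> u"
      using k[OF x] vsD(8)[OF V u(1)] by metis
    then show "\<kappa> (c \<odot>\<^bsub>V\<^esub> x) = c * \<kappa> x" using ku by simp
  qed
  moreover have "\<kappa> u = 1" using ku[of 1] vsD(9)[OF V u(1)] by simp
  ultimately show ?thesis using that u(1) by blast
qed

section \<open>Linear maps on iterated tensor products of representations\<close>

locale usual_tensor = group G for G :: "('g, 'm) monoid_scheme" (structure) +
  fixes T :: "('k::field, 'v, 'g) tensor"
  assumes usual: "is_usual_tensor G T"
begin

abbreviation "rep V \<equiv> is_rep G V"

lemma rep_vs: "rep V \<Longrightarrow> vs V"
  by (simp add: is_rep_def)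

lemma rep_tobj: "rep V \<Longrightarrow> rep W \<Longrightarrow> rep (tobj T V W)"
  using usual by (simp add: is_usual_tensor_def)

lemma rep_tunit: "rep (tunit T)"
  using usual by (simp add: is_usual_tensor_def)

lemma tunit_functional:
  obtains u \<kappa> where "u \<in> carrier (tunit T)" "linear_functional (tunit T) \<kappa>" "\<kappa> u = 1"
proof -
  have "vs (tunit T)" "vectorspace.fin_dim class_ring (tunit T)" "vectorspace.dim class_ring (tunit T) = 1"
    using usual rep_tunit by (auto simp: is_usual_tensor_def is_rep_def)
  from one_dim_functional[OF this] that show ?thesis by metis
qed

lemma is_tensor: "rep V \<Longrightarrow> rep W \<Longrightarrow> is_tensor_product V W (tobj T V W) (tpure T V W)"
  using usual by (simp add: is_usual_tensor_def)

lemma act_pure: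
  "rep V \<Longrightarrow> rep W \<Longrightarrow> g \<in> carrier G \<Longrightarrow> v \<in> carrier V \<Longrightarrow> w \<in> carrier W \<Longrightarrow>
    act (tobj T V W) g (tpure T V W v w) = tpure T V W (act V g v) (act W g w)"
  using usual by (simp add: is_usual_tensor_def)

lemma act_lin: "rep V \<Longrightarrow> g \<in> carrier G \<Longrightarrow> lin V V (act V g)"
  by (simp add: is_rep_def)

lemma act_closed: "rep V \<Longrightarrow> g \<in> carrier G \<Longrightarrow> v \<in> carrier V \<Longrightarrow> act V g v \<in> carrier V"
  using linD(3)[OF act_lin] .

lemma pure_closed:
  "rep V \<Longrightarrow> rep W \<Longrightarrow> v \<in> carrier V \<Longrightarrow> w \<in> carrier W \<Longrightarrow> tpure T V W v w \<in> carrier (tobj T V W)"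
  using tensor_pure_closed[OF is_tensor] .

lemma pure_lin_right:
  "rep V \<Longrightarrow> rep W \<Longrightarrow> v \<in> carrier V \<Longrightarrow> lin W (tobj T V W) (tpure T V W v)"
  using tensor_pure_linear(1)[OF is_tensor] .

lemma pure_lin_left:
  "rep V \<Longrightarrow> rep W \<Longrightarrow> w \<in> carrier W \<Longrightarrow> lin V (tobj T V W) (\<lambda>v. tpure T V W v w)"
  using tensor_pure_linear(2)[OF is_tensor] .

lemma pure_smult:
  assumes "rep V" "rep W" "v \<in> carrier V" "w \<in> carrier W"
  shows "tpure T V W (c \<odot>\<^bsub>V\<^esub> v) w = c \<odot>\<^bsub>tobj T V W\<^esub> tpure T V W v w"
    "tpure T V W v (c \<odot>\<^bsub>W\<^esub> w) = c \<odot>\<^bsub>tobj T V W\<^esub> tpure T V W v w"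
  using linD(5)[OF pure_lin_left[OF assms(1,2,4)] assms(3)]
    linD(5)[OF pure_lin_right[OF assms(1,2,3)] assms(4)] by simp_all

lemma unique2:
  fixes Z :: "('k, 'v, 'a) module_scheme"
  assumes V: "rep V" "rep W" and h: "lin (tobj T V W) Z h" "lin (tobj T V W) Z h'"
    and eq: "\<And>v w. v \<in> carrier V \<Longrightarrow> w \<in> carrier W \<Longrightarrow> h (tpure T V W v w) = h' (tpure T V W v w)"
    and x: "x \<in> carrier (tobj T V W)"
  shows "h x = h' x"
  using tensor_unique[OF is_tensor[OF V] h eq x] .

text \<open>A pure tensor of the outer product still has an arbitrary element of U \<otimes> V as
  its first factor. For fixed \<open>w\<close>, a second appeal to uniqueness makes this factor pure
  as well.\<close>

lemma unique3_left:
  fixes Z :: "('k, 'v, 'a) module_scheme"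
  assumes V: "rep U" "rep V" "rep W"
    and h: "lin (tobj T (tobj T U V) W) Z h" "lin (tobj T (tobj T U V) W) Z h'"
    and eq: "\<And>u v w. u \<in> carrier U \<Longrightarrow> v \<in> carrier V \<Longrightarrow> w \<in> carrier W \<Longrightarrow>
      h (tpure T (tobj T U V) W (tpure T U V u v) w) = h' (tpure T (tobj T U V) W (tpure T U V u v) w)"
    and x: "x \<in> carrier (tobj T (tobj T U V) W)"
  shows "h x = h' x"
proof (rule unique2[OF rep_tobj[OF V(1,2)] V(3) h _ x])
  fix y w assume y: "y \<in> carrier (tobj T U V)" and w: "w \<in> carrier W"
  note l = lin_comp[OF pure_lin_left[OF rep_tobj[OF V(1,2)] V(3) w]]
  show "h (tpure T (tobj T U V) W y w) = h' (tpure T (tobj T U V) W y w)"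
    by (rule unique2[OF V(1,2) l[OF h(1)] l[OF h(2)] _ y]) (rule eq[OF _ _ w])
qed

lemma unique3_right:
  fixes Z :: "('k, 'v, 'a) module_scheme"
  assumes V: "rep U" "rep V" "rep W"
    and h: "lin (tobj T U (tobj T V W)) Z h" "lin (tobj T U (tobj T V W)) Z h'"
    and eq: "\<And>u v w. u \<in> carrier U \<Longrightarrow> v \<in> carrier V \<Longrightarrow> w \<in> carrier W \<Longrightarrow>
      h (tpure T U (tobj T V W) u (tpure T V W v w)) = h' (tpure T U (tobj T V W) u (tpure T V W v w))"
    and x: "x \<in> carrier (tobj T U (tobj T V W))"
  shows "h x = h' x"
proof (rule unique2[OF V(1) rep_tobj[OF V(2,3)] h _ x])
  fix u y assume u: "u \<in> carrier U" and y: "y \<in> carrier (tobj T V W)"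
  note l = lin_comp[OF pure_lin_right[OF V(1) rep_tobj[OF V(2,3)] u]]
  show "h (tpure T U (tobj T V W) u y) = h' (tpure T U (tobj T V W) u y)"
    by (rule unique2[OF V(2,3) l[OF h(1)] l[OF h(2)] _ y]) (rule eq[OF u])
qed

lemma tmap_spec:
  assumes V: "rep V" "rep W" "rep V'" "rep W'" and f: "lin V V' f" and g: "lin W W' g"
  shows "lin (tobj T V W) (tobj T V' W') (tmap T V W V' W' f g)"
    and "v \<in> carrier V \<Longrightarrow> w \<in> carrier W \<Longrightarrow>
      tmap T V W V' W' f g (tpure T V W v w) = tpure T V' W' (f v) (g w)"
proof -
  have "bilinear_map V W (tobj T V' W') (\<lambda>v w. tpure T V' W' (f v) (g w))"
    using lin_comp[OF g pure_lin_right[OF V(3,4)]] lin_comp[OF f pure_lin_left[OF V(3,4)]]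
      linD(3)[OF f] linD(3)[OF g] by (intro bilinear_mapI) auto
  from tensor_lift[OF is_tensor[OF V(1,2)] this rep_vs[OF rep_tobj[OF V(3,4)]]]
  have "\<exists>h. lin (tobj T V W) (tobj T V' W') h \<and>
      (\<forall>v\<in>carrier V. \<forall>w\<in>carrier W. h (tpure T V W v w) = tpure T V' W' (f v) (g w))" by metis
  from someI_ex[OF this] show "lin (tobj T V W) (tobj T V' W') (tmap T V W V' W' f g)"
    and "v \<in> carrier V \<Longrightarrow> w \<in> carrier W \<Longrightarrow>
      tmap T V W V' W' f g (tpure T V W v w) = tpure T V' W' (f v) (g w)"
    by (auto simp: tmap_def)
qed

text \<open>The scalar f(v) g(w) is placed in the unit object as a multiple of \<open>u\<close>,
  where the universal property applies, and the lifted map is read off by \<kappa>.\<close>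

lemma functional_product:
  assumes V: "rep V" "rep W" and f: "linear_functional V f" and g: "linear_functional W g"
  shows "\<exists>L. linear_functional (tobj T V W) L \<and>
    (\<forall>v\<in>carrier V. \<forall>w\<in>carrier W. L (tpure T V W v w) = f v * g w)"
proof -
  obtain u \<kappa> where u: "u \<in> carrier (tunit T)" "linear_functional (tunit T) \<kappa>" "\<kappa> u = 1" using tunit_functional by metis
  have "bilinear_map V W (tunit T) (\<lambda>v w. (f v * g w) \<odot>\<^bsub>tunit T\<^esub> u)"
    using f g rep_vs[OF V(1)] rep_vs[OF V(2)] rep_vs[OF rep_tunit] u(1)
    by (intro bilinear_mapI) (auto simp: lin_iff linear_functional_def vsD algebra_simps)
  from tensor_lift[OF is_tensor[OF V] this rep_vs[OF rep_tunit]] obtain h where h: "lin (tobj T V W) (tunit T) h"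
    "\<And>v w. v \<in> carrier V \<Longrightarrow> w \<in> carrier W \<Longrightarrow> h (tpure T V W v w) = (f v * g w) \<odot>\<^bsub>tunit T\<^esub> u" by metis
  have "\<kappa> (h (tpure T V W v w)) = f v * g w" if "v \<in> carrier V" "w \<in> carrier W" for v w
    using h(2)[OF that] u by (simp add: linear_functional_def)
  then show ?thesis using functional_comp[OF h(1) u(2)] by blast
qed

text \<open>The pair (u, v) is lifted for each fixed \<open>w\<close>. The lifts depend linearly on
  \<open>w\<close>, because a linear map on U \<otimes> V is determined by its values on pure
  tensors; a second lift then takes in \<open>w\<close>.\<close>

lemma trilinear_lift_left:
  fixes Z :: "('k, 'v, 'a) module_scheme"
  assumes V: "rep U" "rep V" "rep W" and Z: "vs Z"
    and uv: "\<And>w. w \<in> carrier W \<Longrightarrow> bilinear_map U V Z (\<lambda>u v. \<tau> u v w)"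
    and w: "\<And>u v. u \<in> carrier U \<Longrightarrow> v \<in> carrier V \<Longrightarrow> lin W Z (\<tau> u v)"
  obtains h where "lin (tobj T (tobj T U V) W) Z h"
    "\<And>u v w. u \<in> carrier U \<Longrightarrow> v \<in> carrier V \<Longrightarrow> w \<in> carrier W \<Longrightarrow>
       h (tpure T (tobj T U V) W (tpure T U V u v) w) = \<tau> u v w"
proof -
  have "\<forall>w\<in>carrier W. \<exists>k. lin (tobj T U V) Z k \<and>
      (\<forall>u\<in>carrier U. \<forall>v\<in>carrier V. k (tpure T U V u v) = \<tau> u v w)"
    using tensor_lift[OF is_tensor[OF V(1,2)] uv Z] by metis
  then obtain k where k: "\<And>w. w \<in> carrier W \<Longrightarrow> lin (tobj T U V) Z (k w)"
    "\<And>u v w. u \<in> carrier U \<Longrightarrow> v \<in> carrier V \<Longrightarrow> w \<in> carrier W \<Longrightarrow> k w (tpure T U V u v) = \<tau> u v w"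
    by metis
  note Wv = vsD[OF rep_vs[OF V(3)]]
  have "lin W Z (\<lambda>w. k w y)" if y: "y \<in> carrier (tobj T U V)" for y
    unfolding lin_iff
  proof (intro conjI ballI allI)
    fix a b assume ab: "a \<in> carrier W" "b \<in> carrier W"
    show "k (a \<oplus>\<^bsub>W\<^esub> b) y = k a y \<oplus>\<^bsub>Z\<^esub> k b y"
      by (rule unique2[OF V(1,2) k(1) lin_add[OF k(1) k(1)] _ y])
        (use ab Wv(2) k(2) linD(4)[OF w] in auto)
  next
    fix c a assume a: "a \<in> carrier W"
    show "k (c \<odot>\<^bsub>W\<^esub> a) y = c \<odot>\<^bsub>Z\<^esub> k a y"
      by (rule unique2[OF V(1,2) k(1) lin_smult[OF k(1)] _ y])
        (use a Wv(3) k(2) linD(5)[OF w] in auto)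
  qed (use rep_vs[OF V(3)] Z linD(3)[OF k(1) y] in auto)
  then have "bilinear_map (tobj T U V) W Z (\<lambda>y w. k w y)"
    using k(1) by (intro bilinear_mapI) auto
  from tensor_lift[OF is_tensor[OF rep_tobj[OF V(1,2)] V(3)] this Z]
  obtain h where "lin (tobj T (tobj T U V) W) Z h"
    "\<And>y w. y \<in> carrier (tobj T U V) \<Longrightarrow> w \<in> carrier W \<Longrightarrow> h (tpure T (tobj T U V) W y w) = k w y" by metis
  then show ?thesis using that k(2) pure_closed[OF V(1,2)] by simp
qed

lemma trilinear_lift_right:
  fixes Z :: "('k, 'v, 'a) module_scheme"
  assumes V: "rep U" "rep V" "rep W" and Z: "vs Z"
    and vw: "\<And>u. u \<in> carrier U \<Longrightarrow> bilinear_map V W Z (\<tau> u)"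
    and u: "\<And>v w. v \<in> carrier V \<Longrightarrow> w \<in> carrier W \<Longrightarrow> lin U Z (\<lambda>u. \<tau> u v w)"
  obtains h where "lin (tobj T U (tobj T V W)) Z h"
    "\<And>u v w. u \<in> carrier U \<Longrightarrow> v \<in> carrier V \<Longrightarrow> w \<in> carrier W \<Longrightarrow>
       h (tpure T U (tobj T V W) u (tpure T V W v w)) = \<tau> u v w"
proof -
  have "\<forall>u\<in>carrier U. \<exists>k. lin (tobj T V W) Z k \<and>
      (\<forall>v\<in>carrier V. \<forall>w\<in>carrier W. k (tpure T V W v w) = \<tau> u v w)"
    using tensor_lift[OF is_tensor[OF V(2,3)] vw Z] by metis
  then obtain k where k: "\<And>u. u \<in> carrier U \<Longrightarrow> lin (tobj T V W) Z (k u)"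
    "\<And>u v w. u \<in> carrier U \<Longrightarrow> v \<in> carrier V \<Longrightarrow> w \<in> carrier W \<Longrightarrow> k u (tpure T V W v w) = \<tau> u v w"
    by metis
  note Uv = vsD[OF rep_vs[OF V(1)]]
  have "lin U Z (\<lambda>u. k u y)" if y: "y \<in> carrier (tobj T V W)" for y
    unfolding lin_iff
  proof (intro conjI ballI allI)
    fix a b assume ab: "a \<in> carrier U" "b \<in> carrier U"
    show "k (a \<oplus>\<^bsub>U\<^esub> b) y = k a y \<oplus>\<^bsub>Z\<^esub> k b y"
      by (rule unique2[OF V(2,3) k(1) lin_add[OF k(1) k(1)] _ y])
        (use ab Uv(2) k(2) linD(4)[OF u] in auto)
  next
    fix c a assume a: "a \<in> carrier U"
    show "k (c \<odot>\<^bsub>U\<^esub> a) y = c \<odot>\<^bsub>Z\<^esub> k a y"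
      by (rule unique2[OF V(2,3) k(1) lin_smult[OF k(1)] _ y])
        (use a Uv(3) k(2) linD(5)[OF u] in auto)
  qed (use rep_vs[OF V(1)] Z linD(3)[OF k(1) y] in auto)
  then have "bilinear_map U (tobj T V W) Z k"
    using k(1) by (intro bilinear_mapI) auto
  from tensor_lift[OF is_tensor[OF V(1) rep_tobj[OF V(2,3)]] this Z]
  obtain h where "lin (tobj T U (tobj T V W)) Z h"
    "\<And>u y. u \<in> carrier U \<Longrightarrow> y \<in> carrier (tobj T V W) \<Longrightarrow> h (tpure T U (tobj T V W) u y) = k u y" by metis
  then show ?thesis using that k(2) pure_closed[OF V(2,3)] by simp
qed

lemma assoc_spec:
  assumes V: "rep U" "rep V" "rep W"
  shows "lin (tobj T (tobj T U V) W) (tobj T U (tobj T V W)) (assoc T U V W)"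
    and "u \<in> carrier U \<Longrightarrow> v \<in> carrier V \<Longrightarrow> w \<in> carrier W \<Longrightarrow>
      assoc T U V W (tpure T (tobj T U V) W (tpure T U V u v) w) =
      tpure T U (tobj T V W) u (tpure T V W v w)"
proof -
  note VW = rep_tobj[OF V(2,3)]
  have "\<exists>h. lin (tobj T (tobj T U V) W) (tobj T U (tobj T V W)) h \<and>
      (\<forall>u\<in>carrier U. \<forall>v\<in>carrier V. \<forall>w\<in>carrier W.
        h (tpure T (tobj T U V) W (tpure T U V u v) w) = tpure T U (tobj T V W) u (tpure T V W v w))"
    (is "\<exists>h. ?P h")
  proof (rule trilinear_lift_left[OF V rep_vs[OF rep_tobj[OF V(1) VW]],
        of "\<lambda>u v w. tpure T U (tobj T V W) u (tpure T V W v w)"])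
    fix w assume w: "w \<in> carrier W"
    show "bilinear_map U V (tobj T U (tobj T V W)) (\<lambda>u v. tpure T U (tobj T V W) u (tpure T V W v w))"
      by (intro bilinear_mapI lin_comp[OF pure_lin_left[OF V(2,3) w] pure_lin_right[OF V(1) VW]]
          pure_lin_left[OF V(1) VW] pure_closed[OF V(2,3)] w)
  next
    fix u v assume uv: "u \<in> carrier U" "v \<in> carrier V"
    show "lin W (tobj T U (tobj T V W)) (\<lambda>w. tpure T U (tobj T V W) u (tpure T V W v w))"
      by (rule lin_comp[OF pure_lin_right[OF V(2,3) uv(2)] pure_lin_right[OF V(1) VW uv(1)]])
  qed blast
  from someI_ex[OF this] show "lin (tobj T (tobj T U V) W) (tobj T U (tobj T V W)) (assoc T U V W)"
    and "u \<in> carrier U \<Longrightarrow> v \<in> carrier V \<Longrightarrow> w \<in> carrier W \<Longrightarrow>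
      assoc T U V W (tpure T (tobj T U V) W (tpure T U V u v) w) =
      tpure T U (tobj T V W) u (tpure T V W v w)"
    by (auto simp: assoc_def)
qed

text \<open>\<open>assoc_inv\<close> is defined through \<open>inv_into\<close>, which is
  informative only once \<open>assoc\<close> is known to be bijective. So a linear map
  \<open>k\<close> in the opposite direction is built from the universal property and shown to be a
  two-sided inverse.\<close>

lemma assoc_inv_spec:
  assumes V: "rep U" "rep V" "rep W"
  shows "lin (tobj T U (tobj T V W)) (tobj T (tobj T U V) W) (assoc_inv T U V W)"
    and "u \<in> carrier U \<Longrightarrow> v \<in> carrier V \<Longrightarrow> w \<in> carrier W \<Longrightarrow>
      assoc_inv T U V W (tpure T U (tobj T V W) u (tpure T V W v w)) =
      tpure T (tobj T U V) W (tpure T U V u v) w"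
proof -
  note VW = rep_tobj[OF V(2,3)] and UV = rep_tobj[OF V(1,2)]
  note a = assoc_spec[OF V]
  have "\<exists>h. lin (tobj T U (tobj T V W)) (tobj T (tobj T U V) W) h \<and>
      (\<forall>u\<in>carrier U. \<forall>v\<in>carrier V. \<forall>w\<in>carrier W.
        h (tpure T U (tobj T V W) u (tpure T V W v w)) = tpure T (tobj T U V) W (tpure T U V u v) w)"
  proof (rule trilinear_lift_right[OF V rep_vs[OF rep_tobj[OF UV V(3)]],
        of "\<lambda>u v w. tpure T (tobj T U V) W (tpure T U V u v) w"])
    fix u assume u: "u \<in> carrier U"
    show "bilinear_map V W (tobj T (tobj T U V) W) (\<lambda>v w. tpure T (tobj T U V) W (tpure T U V u v) w)"
      by (intro bilinear_mapI lin_comp[OF pure_lin_right[OF V(1,2) u] pure_lin_left[OF UV V(3)]]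
          pure_lin_right[OF UV V(3)] pure_closed[OF V(1,2)] u)
  next
    fix v w assume vw: "v \<in> carrier V" "w \<in> carrier W"
    show "lin U (tobj T (tobj T U V) W) (\<lambda>u. tpure T (tobj T U V) W (tpure T U V u v) w)"
      by (rule lin_comp[OF pure_lin_left[OF V(1,2) vw(1)] pure_lin_left[OF UV V(3) vw(2)]])
  qed blast
  then obtain k where k: "lin (tobj T U (tobj T V W)) (tobj T (tobj T U V) W) k"
    "\<And>u v w. u \<in> carrier U \<Longrightarrow> v \<in> carrier V \<Longrightarrow> w \<in> carrier W \<Longrightarrow>
      k (tpure T U (tobj T V W) u (tpure T V W v w)) = tpure T (tobj T U V) W (tpure T U V u v) w" by blast
  have ka: "k (assoc T U V W x) = x" if x: "x \<in> carrier (tobj T (tobj T U V) W)" for x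
    by (rule unique3_left[OF V lin_comp[OF a(1) k(1)] lin_id[OF rep_vs[OF rep_tobj[OF UV V(3)]]] _ x])
      (simp add: a k(2))
  have ak: "assoc T U V W (k x) = x" if x: "x \<in> carrier (tobj T U (tobj T V W))" for x
    by (rule unique3_right[OF V lin_comp[OF k(1) a(1)] lin_id[OF rep_vs[OF rep_tobj[OF V(1) VW]]] _ x])
      (simp add: a k(2))
  have "inj_on (assoc T U V W) (carrier (tobj T (tobj T U V) W))"
    using ka by (metis inj_onI)
  then have eq: "assoc_inv T U V W x = k x" if "x \<in> carrier (tobj T U (tobj T V W))" for x
    unfolding assoc_inv_def using ak[OF that] linD(3)[OF k(1) that] by (metis inv_into_f_f)
  show "lin (tobj T U (tobj T V W)) (tobj T (tobj T U V) W) (assoc_inv T U V W)"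
    using k(1) by (simp add: lin_iff eq vsD)
  show "u \<in> carrier U \<Longrightarrow> v \<in> carrier V \<Longrightarrow> w \<in> carrier W \<Longrightarrow>
      assoc_inv T U V W (tpure T U (tobj T V W) u (tpure T V W v w)) =
      tpure T (tobj T U V) W (tpure T U V u v) w"
    using eq k(2) pure_closed[OF V(1) VW] pure_closed[OF V(2,3)] by simp
qed

end

section \<open>The regular representation\<close>

text \<open>For an infinite set K there is a bijection between K x K and K. Adding one group element
  \<open>a\<close> at a time, the value at \<open>a\<close> and the code of the remaining function
  are packed into a single element of K.\<close>

lemma finite_support_functions_inject:
  fixes C :: "'g set"
  assumes "finite C" "infinite (UNIV :: 'k::zero set)"
  shows "\<exists>i :: ('g \<Rightarrow> 'k) \<Rightarrow> 'k. inj_on i {f. \<forall>x. x \<notin> C \<longrightarrow> f x = 0}"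
  using assms(1)
proof (induction C rule: finite_induct)
  case empty
  have "{f :: 'g \<Rightarrow> 'k. \<forall>x. x \<notin> {} \<longrightarrow> f x = 0} = {\<lambda>_. 0}" by auto
  then show ?case by simp
next
  case (insert a C)
  then obtain i :: "('g \<Rightarrow> 'k) \<Rightarrow> 'k" where i: "inj_on i {f. \<forall>x. x \<notin> C \<longrightarrow> f x = 0}" by blast
  obtain p where "bij_betw p ((UNIV :: 'k set) \<times> (UNIV :: 'k set)) (UNIV :: 'k set)"
    using card_of_Times_same_infinite[OF assms(2)] card_of_ordIso by blast
  then have p: "inj p" by (simp add: bij_betw_def)
  have "inj_on (\<lambda>f. p (f a, i (f(a := 0)))) {f. \<forall>x. x \<notin> insert a C \<longrightarrow> f x = 0}"
  proof (rule inj_onI)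
    fix f g :: "'g \<Rightarrow> 'k"
    assume f: "f \<in> {f. \<forall>x. x \<notin> insert a C \<longrightarrow> f x = 0}" and g: "g \<in> {f. \<forall>x. x \<notin> insert a C \<longrightarrow> f x = 0}"
      and "p (f a, i (f(a := 0))) = p (g a, i (g(a := 0)))"
    then have eq: "f a = g a" "i (f(a := 0)) = i (g(a := 0))" using p by (auto dest: injD)
    have "f(a := 0) = g(a := 0)"
      using inj_onD[OF i, of "f(a := 0)" "g(a := 0)"] eq(2) f g by auto
    then show "f = g" using eq(1) by (metis fun_upd_triv fun_upd_upd)
  qed
  then show ?case by blast
qed

text \<open>The carrier of the regular representation has to be a set of elements of \<open>'v\<close>.\<close>

locale function_embedding = usual_tensor G T
  for G :: "('g, 'm) monoid_scheme" (structure) and T :: "('k::field, 'v, 'g) tensor" +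
  fixes emb :: "('g \<Rightarrow> 'k) \<Rightarrow> 'v"
  assumes fin: "finite (carrier G)"
    and emb_inj: "inj_on emb {f. \<forall>x. x \<notin> carrier G \<longrightarrow> f x = 0}"
begin

definition fspace :: "('g \<Rightarrow> 'k) set" where
  "fspace = {f. \<forall>x. x \<notin> carrier G \<longrightarrow> f x = 0}"

definition coord :: "'v \<Rightarrow> 'g \<Rightarrow> 'k" where
  "coord = inv_into fspace emb"

text \<open>The group algebra as functions on the group, with (g x)(h) = x(g^-1 h), so that
  \<open>g\<close> moves \<open>delta h\<close> to \<open>delta (g \<otimes> h)\<close>. As
  \<open>emb\<close> is merely injective, all operations are defined by transport along it.\<close>

definition reg :: "('k, 'v, 'g) rep" where
  "reg = \<lparr>carrier = emb ` fspace, monoid.mult = undefined, one = undefined,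
     zero = emb (\<lambda>_. 0), add = (\<lambda>x y. emb (\<lambda>h. coord x h + coord y h)),
     module.smult = (\<lambda>c x. emb (\<lambda>h. c * coord x h)),
     act = (\<lambda>g x. emb (\<lambda>h. if h \<in> carrier G then coord x (inv g \<otimes> h) else 0))\<rparr>"

definition delta :: "'g \<Rightarrow> 'v" where
  "delta g = emb (\<lambda>h. if h = g then 1 else 0)"

lemma coord_emb: "f \<in> fspace \<Longrightarrow> coord (emb f) = f"
  unfolding coord_def fspace_def using emb_inj by (simp add: inv_into_f_f)

lemma emb_closed: "f \<in> fspace \<Longrightarrow> emb f \<in> carrier reg"
  by (simp add: reg_def)

lemma coord_fspace: "x \<in> carrier reg \<Longrightarrow> coord x \<in> fspace"
  using coord_emb by (auto simp: reg_def)

lemma emb_coord: "x \<in> carrier reg \<Longrightarrow> emb (coord x) = x"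
  using coord_emb by (auto simp: reg_def)

lemma reg_eqI:
  assumes "x \<in> carrier reg" "y \<in> carrier reg" "\<And>g. g \<in> carrier G \<Longrightarrow> coord x g = coord y g"
  shows "x = y"
proof -
  have "coord x = coord y"
    using assms coord_fspace[OF assms(1)] coord_fspace[OF assms(2)]
    by (auto simp: fspace_def fun_eq_iff) (metis)
  then show ?thesis using assms(1,2) emb_coord by metis
qed

lemma fspace_closed:
  "f \<in> fspace \<Longrightarrow> f' \<in> fspace \<Longrightarrow> (\<lambda>h. f h + f' h) \<in> fspace"
  "f \<in> fspace \<Longrightarrow> (\<lambda>h. c * f h) \<in> fspace"
  "(\<lambda>_. 0) \<in> fspace"
  "(\<lambda>h. if h \<in> carrier G then k h else 0) \<in> fspace"
  "g \<in> carrier G \<Longrightarrow> (\<lambda>h. if h = g then 1 else 0) \<in> fspace"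
  by (auto simp: fspace_def)

lemma reg_closed:
  "x \<in> carrier reg \<Longrightarrow> y \<in> carrier reg \<Longrightarrow> x \<oplus>\<^bsub>reg\<^esub> y \<in> carrier reg"
  "x \<in> carrier reg \<Longrightarrow> c \<odot>\<^bsub>reg\<^esub> x \<in> carrier reg"
  "\<zero>\<^bsub>reg\<^esub> \<in> carrier reg"
  "act reg g x \<in> carrier reg"
  "g \<in> carrier G \<Longrightarrow> delta g \<in> carrier reg"
  using fspace_closed coord_fspace by (auto simp: reg_def delta_def)

lemma coord_simps:
  "x \<in> carrier reg \<Longrightarrow> y \<in> carrier reg \<Longrightarrow> coord (x \<oplus>\<^bsub>reg\<^esub> y) h = coord x h + coord y h"
  "x \<in> carrier reg \<Longrightarrow> coord (c \<odot>\<^bsub>reg\<^esub> x) h = c * coord x h"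
  "coord \<zero>\<^bsub>reg\<^esub> h = 0"
  "coord (act reg g x) h = (if h \<in> carrier G then coord x (inv g \<otimes> h) else 0)"
  "g \<in> carrier G \<Longrightarrow> coord (delta g) h = (if h = g then 1 else 0)"
  using coord_emb[OF fspace_closed(1)[OF coord_fspace coord_fspace]]
    coord_emb[OF fspace_closed(2)[OF coord_fspace]] coord_emb[OF fspace_closed(3)]
    coord_emb[OF fspace_closed(4)] coord_emb[OF fspace_closed(5)]
  by (simp_all add: reg_def delta_def)

lemma reg_vs: "vs reg"
proof (rule vs_criteria[OF class_field])
  have "x \<oplus>\<^bsub>reg\<^esub> (- 1) \<odot>\<^bsub>reg\<^esub> x = \<zero>\<^bsub>reg\<^esub>" if "x \<in> carrier reg" for x
    by (rule reg_eqI) (use that in \<open>simp_all add: reg_closed coord_simps\<close>)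
  then show "\<forall>v\<in>carrier reg. \<exists>w\<in>carrier reg. v \<oplus>\<^bsub>reg\<^esub> w = \<zero>\<^bsub>reg\<^esub>"
    using reg_closed(2) by blast
qed (auto intro!: reg_eqI reg_closed simp: coord_simps reg_closed algebra_simps)

lemma functional_coord: "linear_functional reg (\<lambda>x. \<Sum>g\<in>carrier G. coord x g * F g)"
  unfolding linear_functional_def
  by (simp add: coord_simps sum.distrib sum_distrib_left distrib_right mult.assoc)

lemma functional_coord_delta: "h \<in> carrier G \<Longrightarrow> (\<Sum>g\<in>carrier G. coord (delta h) g * F g) = F h"
proof -
  assume h: "h \<in> carrier G"
  have "(\<Sum>g\<in>carrier G. coord (delta h) g * F g) = (\<Sum>g\<in>carrier G. if g = h then F g else 0)"
    by (rule sum.cong) (use h in \<open>auto simp: coord_simps\<close>)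
  then show ?thesis using h fin by simp
qed

lemma functional_coord1: "linear_functional reg (\<lambda>x. coord x g)"
  by (simp add: linear_functional_def coord_simps)

lemma reg_expand:
  assumes x: "x \<in> carrier reg"
  shows "(\<Oplus>\<^bsub>reg\<^esub>h\<in>carrier G. coord x h \<odot>\<^bsub>reg\<^esub> delta h) = x"
proof (rule reg_eqI[OF _ x])
  interpret M: abelian_monoid reg using vsD(14)[OF reg_vs] .
  show "(\<Oplus>\<^bsub>reg\<^esub>h\<in>carrier G. coord x h \<odot>\<^bsub>reg\<^esub> delta h) \<in> carrier reg"
    by (rule M.finsum_closed) (use reg_closed in auto)
  fix g assume g: "g \<in> carrier G"
  have "coord (\<Oplus>\<^bsub>reg\<^esub>h\<in>carrier G. coord x h \<odot>\<^bsub>reg\<^esub> delta h) g = (\<Sum>h\<in>carrier G. coord (coord x h \<odot>\<^bsub>reg\<^esub> delta h) g)"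
    by (rule functional_finsum[OF reg_vs functional_coord1 fin]) (simp add: reg_closed)
  also have "\<dots> = (\<Sum>h\<in>carrier G. if g = h then coord x h else 0)"
    by (rule sum.cong) (auto simp: coord_simps reg_closed)
  also have "\<dots> = coord x g" using g fin by simp
  finally show "coord (\<Oplus>\<^bsub>reg\<^esub>h\<in>carrier G. coord x h \<odot>\<^bsub>reg\<^esub> delta h) g = coord x g" .
qed

lemma delta_inj: "inj_on delta (carrier G)"
proof (rule inj_onI)
  fix g h assume gh: "g \<in> carrier G" "h \<in> carrier G" "delta g = delta h"
  then have "coord (delta g) h = 1" using coord_simps(5)[of h h] by simp
  then show "g = h" using coord_simps(5)[of g h] gh by (auto split: if_splits)
qed

lemma reg_fin_dim: "vectorspace.fin_dim class_ring reg"
proof -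
  interpret P: vectorspace class_ring reg by (rule reg_vs)
  have sub: "delta ` carrier G \<subseteq> carrier reg" using reg_closed by auto
  have "x \<in> P.span (delta ` carrier G)" if x: "x \<in> carrier reg" for x
  proof -
    define a where "a v = coord x (inv_into (carrier G) delta v)" for v
    have "P.lincomb a (delta ` carrier G) = (\<Oplus>\<^bsub>reg\<^esub>h\<in>carrier G. a (delta h) \<odot>\<^bsub>reg\<^esub> delta h)"
      unfolding P.lincomb_def by (rule P.finsum_reindex[OF _ delta_inj]) (use reg_closed in auto)
    also have "\<dots> = (\<Oplus>\<^bsub>reg\<^esub>h\<in>carrier G. coord x h \<odot>\<^bsub>reg\<^esub> delta h)"
      by (rule P.finsum_cong') (use reg_closed delta_inj in \<open>auto simp: a_def inv_into_f_f\<close>)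
    also have "\<dots> = x" by (rule reg_expand[OF x])
    finally show ?thesis
      using P.finite_span[OF finite_imageI[OF fin] sub] by (auto intro!: exI[of _ a])
  qed
  moreover have "P.span (delta ` carrier G) \<subseteq> carrier reg"
    using P.span_is_subset2[OF sub] .
  ultimately have "P.gen_set (delta ` carrier G)" by blast
  then show ?thesis using sub fin unfolding P.fin_dim_def by blast
qed

lemma reg_rep: "rep reg"
  unfolding is_rep_def
proof (intro conjI ballI)
  show "vs reg" by (rule reg_vs)
  show "vectorspace.fin_dim class_ring reg" by (rule reg_fin_dim)
  fix g assume g: "g \<in> carrier G"
  show "lin reg reg (act reg g)"
    unfolding lin_iff by (auto intro!: reg_eqI reg_vs simp: coord_simps reg_closed g)
next
  fix v assume "v \<in> carrier reg"
  then show "act reg \<one> v = v" by (intro reg_eqI) (auto simp: coord_simps reg_closed)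
next
  fix g h v assume "g \<in> carrier G" "h \<in> carrier G" "v \<in> carrier reg"
  then show "act reg (g \<otimes> h) v = act reg g (act reg h v)"
    by (intro reg_eqI) (auto simp: coord_simps reg_closed inv_mult_group m_assoc)
qed

lemma act_delta: "g \<in> carrier G \<Longrightarrow> h \<in> carrier G \<Longrightarrow> act reg g (delta h) = delta (g \<otimes> h)"
proof (rule reg_eqI)
  fix k assume gh: "g \<in> carrier G" "h \<in> carrier G" and k: "k \<in> carrier G"
  have "inv g \<otimes> k = h \<longleftrightarrow> k = g \<otimes> h"
    using gh k by (auto simp flip: m_assoc)
  then show "coord (act reg g (delta h)) k = coord (delta (g \<otimes> h)) k"
    using gh k by (simp add: coord_simps)
qed (use reg_closed in auto)

text \<open>The homomorphism from the group algebra to \<open>V\<close> that sends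
  \<open>delta \<one>\<close> to \<open>v\<close>; through it, naturality reaches arbitrary
  vectors.\<close>

definition orbit_map :: "('k, 'v, 'g) rep \<Rightarrow> 'v \<Rightarrow> 'v \<Rightarrow> 'v" where
  "orbit_map V v x = (\<Oplus>\<^bsub>V\<^esub>h\<in>carrier G. coord x h \<odot>\<^bsub>V\<^esub> act V h v)"

lemma orbit_map_hom:
  assumes V: "rep V" and v: "v \<in> carrier V"
  shows "orbit_map V v \<in> rep_hom G reg V"
    and "g \<in> carrier G \<Longrightarrow> orbit_map V v (delta g) = act V g v"
proof -
  note Vv = vsD[OF rep_vs[OF V]]
  interpret V: abelian_monoid V by (rule Vv(14))
  have av: "act V h v \<in> carrier V" if "h \<in> carrier G" for h using act_closed[OF V that v] .
  have cl: "(\<lambda>h. k h \<odot>\<^bsub>V\<^esub> act V h v) \<in> carrier G \<rightarrow> carrier V" for k using av Vv(3) by auto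
  have "lin reg V (orbit_map V v)"
    unfolding lin_iff
  proof (intro conjI ballI allI)
    fix x assume x: "x \<in> carrier reg"
    show "orbit_map V v x \<in> carrier V" unfolding orbit_map_def by (rule V.finsum_closed[OF cl])
    fix y assume y: "y \<in> carrier reg"
    have "orbit_map V v (x \<oplus>\<^bsub>reg\<^esub> y) =
        (\<Oplus>\<^bsub>V\<^esub>h\<in>carrier G. coord x h \<odot>\<^bsub>V\<^esub> act V h v \<oplus>\<^bsub>V\<^esub> coord y h \<odot>\<^bsub>V\<^esub> act V h v)"
      unfolding orbit_map_def
      by (rule V.finsum_cong') (use av x y Vv in \<open>auto simp: coord_simps\<close>)
    then show "orbit_map V v (x \<oplus>\<^bsub>reg\<^esub> y) = orbit_map V v x \<oplus>\<^bsub>V\<^esub> orbit_map V v y"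
      unfolding orbit_map_def using V.finsum_addf[OF cl cl] by simp
  next
    fix c x assume x: "x \<in> carrier reg"
    have "orbit_map V v (c \<odot>\<^bsub>reg\<^esub> x) = (\<Oplus>\<^bsub>V\<^esub>h\<in>carrier G. c \<odot>\<^bsub>V\<^esub> (coord x h \<odot>\<^bsub>V\<^esub> act V h v))"
      unfolding orbit_map_def
      by (rule V.finsum_cong') (use av x Vv in \<open>auto simp: coord_simps\<close>)
    also have "\<dots> = c \<odot>\<^bsub>V\<^esub> orbit_map V v x"
      unfolding orbit_map_def
      using lin_finsum[OF lin_smult[OF lin_id[OF rep_vs[OF V]]] fin, of "\<lambda>h. coord x h \<odot>\<^bsub>V\<^esub> act V h v" c] av Vv(3)
      by simp
    finally show "orbit_map V v (c \<odot>\<^bsub>reg\<^esub> x) = c \<odot>\<^bsub>V\<^esub> orbit_map V v x" .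
  qed (use reg_vs rep_vs[OF V] in auto)
  moreover have "orbit_map V v (act reg g x) = act V g (orbit_map V v x)"
    if g: "g \<in> carrier G" and x: "x \<in> carrier reg" for g x
  proof -
    \<comment> \<open>Equivariance is the substitution of \<open>g \<otimes> h\<close> for the
      summation index.\<close>
    have bij: "inj_on (\<lambda>h. g \<otimes> h) (carrier G)" "(\<lambda>h. g \<otimes> h) ` carrier G = carrier G"
      using g by (auto simp: inj_on_def surj_const_mult)
    have "orbit_map V v (act reg g x) = (\<Oplus>\<^bsub>V\<^esub>h\<in>(\<lambda>h. g \<otimes> h) ` carrier G. coord (act reg g x) h \<odot>\<^bsub>V\<^esub> act V h v)"
      unfolding orbit_map_def bij(2) ..
    also have "\<dots> = (\<Oplus>\<^bsub>V\<^esub>h\<in>carrier G. coord (act reg g x) (g \<otimes> h) \<odot>\<^bsub>V\<^esub> act V (g \<otimes> h) v)"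
      by (rule V.finsum_reindex[OF _ bij(1)]) (use cl bij(2) in auto)
    also have "\<dots> = (\<Oplus>\<^bsub>V\<^esub>h\<in>carrier G. act V g (coord x h \<odot>\<^bsub>V\<^esub> act V h v))"
    proof (rule V.finsum_cong'[OF refl])
      show "(\<lambda>h. act V g (coord x h \<odot>\<^bsub>V\<^esub> act V h v)) \<in> carrier G \<rightarrow> carrier V"
        using act_closed[OF V g] cl by auto
      fix h assume h: "h \<in> carrier G"
      have "act V (g \<otimes> h) v = act V g (act V h v)" using V g h v by (simp add: is_rep_def)
      moreover have "inv g \<otimes> (g \<otimes> h) = h" using g h by (simp flip: m_assoc)
      ultimately show "coord (act reg g x) (g \<otimes> h) \<odot>\<^bsub>V\<^esub> act V (g \<otimes> h) v = act V g (coord x h \<odot>\<^bsub>V\<^esub> act V h v)"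
        using linD(5)[OF act_lin[OF V g] av[OF h]] g h by (simp add: coord_simps)
    qed
    also have "\<dots> = act V g (orbit_map V v x)"
      unfolding orbit_map_def using lin_finsum[OF act_lin[OF V g] fin, of "\<lambda>h. coord x h \<odot>\<^bsub>V\<^esub> act V h v"] cl
      by (simp add: Pi_iff)
    finally show ?thesis .
  qed
  ultimately show "orbit_map V v \<in> rep_hom G reg V" by (simp add: rep_hom_def)
  assume g: "g \<in> carrier G"
  have "orbit_map V v (delta g) = (\<Oplus>\<^bsub>V\<^esub>h\<in>carrier G. if g = h then act V h v else \<zero>\<^bsub>V\<^esub>)"
    unfolding orbit_map_def by (rule V.finsum_cong') (use av Vv g in \<open>auto simp: coord_simps\<close>)
  also have "\<dots> = act V g v" by (rule V.finsum_singleton[OF g fin]) (use av in auto)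
  finally show "orbit_map V v (delta g) = act V g v" .
qed

lemma isotypical_vector:
  assumes A: "subgroup A G" and \<phi>: "mult_char G A \<phi>"
  obtains e where "e \<in> isotypical A reg \<phi>" "coord e \<one> = 1"
proof -
  \<comment> \<open>Up to the factor |A|, this is the idempotent of the group algebra of
    \<open>A\<close> that belongs to \<phi>. In this normalization the coordinate at \<one> is
    1.\<close>
  define f where "f x = (if x \<in> A then \<phi> (inv x) else 0)" for x
  note Ac = subgroup.mem_carrier[OF A] and Am = subgroup.m_closed[OF A]
    and Ai = subgroup.m_inv_closed[OF A] and A1 = subgroup.one_closed[OF A]
  have f: "f \<in> fspace" using Ac by (auto simp: f_def fspace_def)
  have "act reg a (emb f) = \<phi> a \<odot>\<^bsub>reg\<^esub> emb f" if a: "a \<in> A" for a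
  proof (rule reg_eqI)
    fix h assume h: "h \<in> carrier G"
    show "coord (act reg a (emb f)) h = coord (\<phi> a \<odot>\<^bsub>reg\<^esub> emb f) h"
    proof (cases "h \<in> A")
      case True
      have "inv (inv a \<otimes> h) = inv h \<otimes> a" using Ac a h by (simp add: inv_mult_group)
      then have "\<phi> (inv (inv a \<otimes> h)) = \<phi> a * \<phi> (inv h)"
        using \<phi> a True Ai by (simp add: mult_char_def mult.commute)
      then show ?thesis
        using True a h Am Ai coord_emb[OF f] emb_closed[OF f] by (simp add: coord_simps f_def)
    next
      case False
      have "inv a \<otimes> h \<notin> A"
      proof
        assume "inv a \<otimes> h \<in> A"
        then have "a \<otimes> (inv a \<otimes> h) \<in> A" using Am a by blast
        then show False using False a Ac h by (simp flip: m_assoc)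
      qed
      then show ?thesis
        using False a h coord_emb[OF f] emb_closed[OF f] by (simp add: coord_simps f_def)
    qed
  qed (use reg_closed emb_closed[OF f] in auto)
  then have "emb f \<in> isotypical A reg \<phi>" using emb_closed[OF f] by (simp add: isotypical_def)
  moreover have "coord (emb f) \<one> = 1"
    using A1 mult_char_one[OF A \<phi>] by (simp add: coord_emb[OF f] f_def)
  ultimately show ?thesis by (rule that)
qed

end

section \<open>Symmetries\<close>

locale symmetry = function_embedding G T emb
  for G :: "('g, 'm) monoid_scheme" (structure) and T :: "('k::field_char_0, 'v, 'g) tensor" and emb +
  fixes \<sigma> :: "('k, 'v, 'g) braiding"
  assumes sym: "is_symmetry G T \<sigma>"
begin

lemma sigma_hom: "rep V \<Longrightarrow> rep W \<Longrightarrow> \<sigma> V W \<in> rep_hom G (tobj T V W) (tobj T W V)"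
  using sym[unfolded is_symmetry_def, THEN conjunct1, rule_format, of V W]
  by (simp add: rep_iso_def)

lemma sigma_lin: "rep V \<Longrightarrow> rep W \<Longrightarrow> lin (tobj T V W) (tobj T W V) (\<sigma> V W)"
  using sigma_hom by (simp add: rep_hom_def)

lemma sigma_act:
  "rep V \<Longrightarrow> rep W \<Longrightarrow> g \<in> carrier G \<Longrightarrow> x \<in> carrier (tobj T V W) \<Longrightarrow>
    \<sigma> V W (act (tobj T V W) g x) = act (tobj T W V) g (\<sigma> V W x)"
  using sigma_hom by (simp add: rep_hom_def)

lemma sigma_closed: "rep V \<Longrightarrow> rep W \<Longrightarrow> x \<in> carrier (tobj T V W) \<Longrightarrow> \<sigma> V W x \<in> carrier (tobj T W V)"
  using linD(3)[OF sigma_lin] .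

lemma sigma_natural:
  "rep V \<Longrightarrow> rep W \<Longrightarrow> rep V' \<Longrightarrow> rep W' \<Longrightarrow> f \<in> rep_hom G V V' \<Longrightarrow> g \<in> rep_hom G W W' \<Longrightarrow>
    x \<in> carrier (tobj T V W) \<Longrightarrow>
    \<sigma> V' W' (tmap T V W V' W' f g x) = tmap T W V W' V' g f (\<sigma> V W x)"
  using sym[unfolded is_symmetry_def, THEN conjunct2, THEN conjunct1, rule_format, of V W V' W' f g x] by blast

lemma sigma_sigma:
  "rep V \<Longrightarrow> rep W \<Longrightarrow> x \<in> carrier (tobj T V W) \<Longrightarrow> \<sigma> W V (\<sigma> V W x) = x"
  using sym[unfolded is_symmetry_def, THEN conjunct2, THEN conjunct2, THEN conjunct1, rule_format, of V W x] by blast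

lemma sigma_hexagon1:
  "rep U \<Longrightarrow> rep V \<Longrightarrow> rep W \<Longrightarrow> x \<in> carrier (tobj T (tobj T U V) W) \<Longrightarrow>
    assoc T V W U (\<sigma> U (tobj T V W) (assoc T U V W x)) =
    tmap T V (tobj T U W) V (tobj T W U) (\<lambda>v. v) (\<sigma> U W)
      (assoc T V U W (tmap T (tobj T U V) W (tobj T V U) W (\<sigma> U V) (\<lambda>w. w) x))"
  using sym[unfolded is_symmetry_def, THEN conjunct2, THEN conjunct2, THEN conjunct2, THEN conjunct1,
      rule_format, of U V W x] by blast

lemma sigma_hexagon2:
  "rep U \<Longrightarrow> rep V \<Longrightarrow> rep W \<Longrightarrow> x \<in> carrier (tobj T U (tobj T V W)) \<Longrightarrow>
    assoc_inv T W U V (\<sigma> (tobj T U V) W (assoc_inv T U V W x)) =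
    tmap T (tobj T U W) V (tobj T W U) V (\<sigma> U W) (\<lambda>v. v)
      (assoc_inv T U W V (tmap T U (tobj T V W) U (tobj T W V) (\<lambda>u. u) (\<sigma> V W) x))"
  using sym[unfolded is_symmetry_def, THEN conjunct2, THEN conjunct2, THEN conjunct2, THEN conjunct2,
      rule_format, of U V W x] by blast

section \<open>Expansion of a symmetry in the square of the regular representation\<close>

abbreviation "reg2 \<equiv> tobj T reg reg"
abbreviation "pure2 \<equiv> tpure T reg reg"

definition coord2 :: "'g \<Rightarrow> 'g \<Rightarrow> 'v \<Rightarrow> 'k" where
  "coord2 g h = (SOME L. linear_functional (reg2) L \<and>
     (\<forall>v\<in>carrier reg. \<forall>w\<in>carrier reg. L (pure2 v w) = coord v g * coord w h))"

lemma coord2: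
  shows "linear_functional (reg2) (coord2 g h)"
    and "v \<in> carrier reg \<Longrightarrow> w \<in> carrier reg \<Longrightarrow> coord2 g h (pure2 v w) = coord v g * coord w h"
proof -
  have "\<exists>L. linear_functional (reg2) L \<and>
     (\<forall>v\<in>carrier reg. \<forall>w\<in>carrier reg. L (pure2 v w) = coord v g * coord w h)"
    by (rule functional_product[OF reg_rep reg_rep functional_coord1 functional_coord1])
  from someI_ex[OF this] show "linear_functional (reg2) (coord2 g h)"
    and "v \<in> carrier reg \<Longrightarrow> w \<in> carrier reg \<Longrightarrow> coord2 g h (pure2 v w) = coord v g * coord w h"
    by (auto simp: coord2_def)
qed

text \<open>No basis of the tensor product is given. The expansion and the identity are both linear
  maps, so they are compared on pure tensors, where the two factors can be expanded
  separately.\<close>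

lemma reg2_expand:
  assumes x: "x \<in> carrier (reg2)"
  shows "(\<Oplus>\<^bsub>reg2\<^esub>h\<in>carrier G. \<Oplus>\<^bsub>reg2\<^esub>k\<in>carrier G.
           coord2 h k x \<odot>\<^bsub>reg2\<^esub> pure2 (delta h) (delta k)) = x"
proof -
  let ?Q = "reg2"
  have Q: "vs ?Q" using rep_vs[OF rep_tobj[OF reg_rep reg_rep]] .
  have dd: "pure2 (delta h) (delta k) \<in> carrier ?Q" if "h \<in> carrier G" "k \<in> carrier G" for h k
    using pure_closed[OF reg_rep reg_rep] reg_closed(5) that by blast
  have l: "lin ?Q ?Q (\<lambda>x. \<Oplus>\<^bsub>?Q\<^esub>h\<in>carrier G. \<Oplus>\<^bsub>?Q\<^esub>k\<in>carrier G. coord2 h k x \<odot>\<^bsub>?Q\<^esub> pure2 (delta h) (delta k))"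
    by (intro lin_finsum_fun[OF Q Q fin] lin_functional_smult[OF Q Q coord2(1)] dd)
  show ?thesis
  proof (rule unique2[OF reg_rep reg_rep l lin_id[OF Q] _ x])
    fix v w assume v: "v \<in> carrier reg" and w: "w \<in> carrier reg"
    have dw: "pure2 (delta h) w \<in> carrier ?Q" if "h \<in> carrier G" for h
      using pure_closed[OF reg_rep reg_rep reg_closed(5)[OF that] w] .
    have "pure2 v w = pure2 (\<Oplus>\<^bsub>reg\<^esub>h\<in>carrier G. coord v h \<odot>\<^bsub>reg\<^esub> delta h) w"
      using reg_expand[OF v] by simp
    also have "\<dots> = (\<Oplus>\<^bsub>?Q\<^esub>h\<in>carrier G. pure2 (coord v h \<odot>\<^bsub>reg\<^esub> delta h) w)"
      using lin_finsum[OF pure_lin_left[OF reg_rep reg_rep w] fin] reg_closed by simp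
    also have "\<dots> = (\<Oplus>\<^bsub>?Q\<^esub>h\<in>carrier G. \<Oplus>\<^bsub>?Q\<^esub>k\<in>carrier G.
        coord2 h k (pure2 v w) \<odot>\<^bsub>?Q\<^esub> pure2 (delta h) (delta k))"
    proof (rule finsum_cong_in[OF Q])
      fix h assume h: "h \<in> carrier G"
      show "(\<Oplus>\<^bsub>?Q\<^esub>k\<in>carrier G. coord2 h k (pure2 v w) \<odot>\<^bsub>?Q\<^esub> pure2 (delta h) (delta k)) \<in> carrier ?Q"
        by (rule finsum_in[OF Q]) (use dd h vsD(3)[OF Q] in auto)
      have "pure2 (coord v h \<odot>\<^bsub>reg\<^esub> delta h) w =
          pure2 (coord v h \<odot>\<^bsub>reg\<^esub> delta h) (\<Oplus>\<^bsub>reg\<^esub>k\<in>carrier G. coord w k \<odot>\<^bsub>reg\<^esub> delta k)"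
        using reg_expand[OF w] by simp
      also have "\<dots> = (\<Oplus>\<^bsub>?Q\<^esub>k\<in>carrier G. pure2 (coord v h \<odot>\<^bsub>reg\<^esub> delta h) (coord w k \<odot>\<^bsub>reg\<^esub> delta k))"
        by (rule lin_finsum[OF pure_lin_right[OF reg_rep reg_rep] fin]) (use reg_closed h in auto)
      also have "\<dots> = (\<Oplus>\<^bsub>?Q\<^esub>k\<in>carrier G. coord2 h k (pure2 v w) \<odot>\<^bsub>?Q\<^esub> pure2 (delta h) (delta k))"
      proof (rule finsum_cong_in[OF Q])
        fix k assume k: "k \<in> carrier G"
        show "coord2 h k (pure2 v w) \<odot>\<^bsub>?Q\<^esub> pure2 (delta h) (delta k) \<in> carrier ?Q"
          using vsD(3)[OF Q dd[OF h k]] .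
        show "pure2 (coord v h \<odot>\<^bsub>reg\<^esub> delta h) (coord w k \<odot>\<^bsub>reg\<^esub> delta k) =
            coord2 h k (pure2 v w) \<odot>\<^bsub>?Q\<^esub> pure2 (delta h) (delta k)"
          using pure_smult[OF reg_rep reg_rep] reg_closed h k coord2(2)[OF v w] vsD(8)[OF Q dd[OF h k]]
          by (simp add: mult.commute)
      qed
      finally show "pure2 (coord v h \<odot>\<^bsub>reg\<^esub> delta h) w =
          (\<Oplus>\<^bsub>?Q\<^esub>k\<in>carrier G. coord2 h k (pure2 v w) \<odot>\<^bsub>?Q\<^esub> pure2 (delta h) (delta k))" .
    qed
    finally show "(\<Oplus>\<^bsub>?Q\<^esub>h\<in>carrier G. \<Oplus>\<^bsub>?Q\<^esub>k\<in>carrier G.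
        coord2 h k (pure2 v w) \<odot>\<^bsub>?Q\<^esub> pure2 (delta h) (delta k)) = pure2 v w" by simp
  qed
qed

text \<open>The order of the indices is such that \<open>\<sigma>(1 \<otimes> 1) = \<Sum> rmat a b (b \<otimes> a)\<close>.\<close>

definition rmat :: "'g \<Rightarrow> 'g \<Rightarrow> 'k" where
  "rmat a b = coord2 b a (\<sigma> reg reg (pure2 (delta \<one>) (delta \<one>)))"

lemma act_one: "rep V \<Longrightarrow> v \<in> carrier V \<Longrightarrow> act V \<one> v = v"
  by (simp add: is_rep_def)

lemma act_mult: "rep V \<Longrightarrow> g \<in> carrier G \<Longrightarrow> h \<in> carrier G \<Longrightarrow> v \<in> carrier V \<Longrightarrow>
    act V g (act V h v) = act V (g \<otimes> h) v"
  by (simp add: is_rep_def)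

lemma sigma_pure:
  assumes V: "rep V" and W: "rep W" and v: "v \<in> carrier V" and w: "w \<in> carrier W"
  shows "\<sigma> V W (tpure T V W v w) = (\<Oplus>\<^bsub>tobj T W V\<^esub>b\<in>carrier G. \<Oplus>\<^bsub>tobj T W V\<^esub>a\<in>carrier G.
      rmat a b \<odot>\<^bsub>tobj T W V\<^esub> tpure T W V (act W b w) (act V a v))"
proof -
  let ?Q = "reg2" and ?Z = "tobj T W V"
  let ?d = "pure2 (delta \<one>) (delta \<one>)"
  have Q: "vs ?Q" using rep_vs[OF rep_tobj[OF reg_rep reg_rep]] .
  have Z: "vs ?Z" using rep_vs[OF rep_tobj[OF W V]] .
  note hv = orbit_map_hom[OF V v] and hw = orbit_map_hom[OF W w]
  have lv: "lin reg V (orbit_map V v)" and lw: "lin reg W (orbit_map W w)"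
    using hv(1) hw(1) by (auto simp: rep_hom_def)
  note t = tmap_spec[OF reg_rep reg_rep W V lw lv]
  note d1 = reg_closed(5)[OF one_closed]
  have d: "?d \<in> carrier ?Q" using pure_closed[OF reg_rep reg_rep d1 d1] .
  have dd: "pure2 (delta h) (delta k) \<in> carrier ?Q" if "h \<in> carrier G" "k \<in> carrier G" for h k
    using pure_closed[OF reg_rep reg_rep] reg_closed(5) that by blast
  \<comment> \<open>Both vectors are images of the unit of the group algebra under orbit maps, so
    naturality reduces everything to the one value that defines \<open>rmat\<close>.\<close>
  have "tpure T V W v w = tmap T reg reg V W (orbit_map V v) (orbit_map W w) ?d"
    using tmap_spec(2)[OF reg_rep reg_rep V W lv lw d1 d1] hv(2)[of \<one>] hw(2)[of \<one>] act_one[OF V v] act_one[OF W w]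
    by simp
  then have "\<sigma> V W (tpure T V W v w) = tmap T reg reg W V (orbit_map W w) (orbit_map V v) (\<sigma> reg reg ?d)"
    using sigma_natural[OF reg_rep reg_rep V W hv(1) hw(1) d] by simp
  also have "\<sigma> reg reg ?d = (\<Oplus>\<^bsub>?Q\<^esub>b\<in>carrier G. \<Oplus>\<^bsub>?Q\<^esub>a\<in>carrier G. rmat a b \<odot>\<^bsub>?Q\<^esub> pure2 (delta b) (delta a))"
    unfolding rmat_def using reg2_expand[OF sigma_closed[OF reg_rep reg_rep d]] by simp
  also have "tmap T reg reg W V (orbit_map W w) (orbit_map V v) \<dots> =
      (\<Oplus>\<^bsub>?Z\<^esub>b\<in>carrier G. tmap T reg reg W V (orbit_map W w) (orbit_map V v)
        (\<Oplus>\<^bsub>?Q\<^esub>a\<in>carrier G. rmat a b \<odot>\<^bsub>?Q\<^esub> pure2 (delta b) (delta a)))"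
    by (rule lin_finsum[OF t(1) fin]) (intro finsum_in[OF Q] vsD(3)[OF Q] dd)
  also have "\<dots> = (\<Oplus>\<^bsub>?Z\<^esub>b\<in>carrier G. \<Oplus>\<^bsub>?Z\<^esub>a\<in>carrier G. rmat a b \<odot>\<^bsub>?Z\<^esub> tpure T W V (act W b w) (act V a v))"
  proof (rule finsum_cong_in[OF Z])
    fix b assume b: "b \<in> carrier G"
    have cl: "rmat a b \<odot>\<^bsub>?Z\<^esub> tpure T W V (act W b w) (act V a v) \<in> carrier ?Z" if "a \<in> carrier G" for a
      using vsD(3)[OF Z pure_closed[OF W V act_closed[OF W b w] act_closed[OF V that v]]] .
    then show "(\<Oplus>\<^bsub>?Z\<^esub>a\<in>carrier G. rmat a b \<odot>\<^bsub>?Z\<^esub> tpure T W V (act W b w) (act V a v)) \<in> carrier ?Z"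
      by (intro finsum_in[OF Z])
    have "tmap T reg reg W V (orbit_map W w) (orbit_map V v)
        (\<Oplus>\<^bsub>?Q\<^esub>a\<in>carrier G. rmat a b \<odot>\<^bsub>?Q\<^esub> pure2 (delta b) (delta a)) =
      (\<Oplus>\<^bsub>?Z\<^esub>a\<in>carrier G. tmap T reg reg W V (orbit_map W w) (orbit_map V v)
        (rmat a b \<odot>\<^bsub>?Q\<^esub> pure2 (delta b) (delta a)))"
      by (rule lin_finsum[OF t(1) fin]) (intro vsD(3)[OF Q] dd b)
    also have "\<dots> = (\<Oplus>\<^bsub>?Z\<^esub>a\<in>carrier G. rmat a b \<odot>\<^bsub>?Z\<^esub> tpure T W V (act W b w) (act V a v))"
    proof (rule finsum_cong_in[OF Z cl])
      fix a assume a: "a \<in> carrier G"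
      show "tmap T reg reg W V (orbit_map W w) (orbit_map V v) (rmat a b \<odot>\<^bsub>?Q\<^esub> pure2 (delta b) (delta a)) =
          rmat a b \<odot>\<^bsub>?Z\<^esub> tpure T W V (act W b w) (act V a v)"
        using linD(5)[OF t(1) dd[OF b a]] t(2)[OF reg_closed(5)[OF b] reg_closed(5)[OF a]] hv(2)[OF a] hw(2)[OF b]
        by simp
    qed
    finally show "tmap T reg reg W V (orbit_map W w) (orbit_map V v)
        (\<Oplus>\<^bsub>?Q\<^esub>a\<in>carrier G. rmat a b \<odot>\<^bsub>?Q\<^esub> pure2 (delta b) (delta a)) =
      (\<Oplus>\<^bsub>?Z\<^esub>a\<in>carrier G. rmat a b \<odot>\<^bsub>?Z\<^esub> tpure T W V (act W b w) (act V a v))" .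
  qed
  finally show ?thesis .
qed

text \<open>A functional turns the sums in the tensor product into sums of scalars. Linear maps that
  follow the symmetry, such as associators and further symmetries, can be absorbed into
  \<open>L\<close>.\<close>

lemma functional_sigma:
  assumes V: "rep V" and W: "rep W" and v: "v \<in> carrier V" and w: "w \<in> carrier W"
    and L: "linear_functional (tobj T W V) L"
  shows "L (\<sigma> V W (tpure T V W v w)) =
    (\<Sum>a\<in>carrier G. \<Sum>b\<in>carrier G. rmat a b * L (tpure T W V (act W b w) (act V a v)))"
proof -
  let ?Z = "tobj T W V"
  have Z: "vs ?Z" using rep_vs[OF rep_tobj[OF W V]] .
  have p: "tpure T W V (act W b w) (act V a v) \<in> carrier ?Z" if "a \<in> carrier G" "b \<in> carrier G" for a b
    using pure_closed[OF W V act_closed[OF W _ w] act_closed[OF V _ v]] that by blast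
  have "L (\<sigma> V W (tpure T V W v w)) =
      (\<Sum>b\<in>carrier G. L (\<Oplus>\<^bsub>?Z\<^esub>a\<in>carrier G. rmat a b \<odot>\<^bsub>?Z\<^esub> tpure T W V (act W b w) (act V a v)))"
    unfolding sigma_pure[OF V W v w]
    by (rule functional_finsum[OF Z L fin]) (intro finsum_in[OF Z] vsD(3)[OF Z] p)
  also have "\<dots> = (\<Sum>b\<in>carrier G. \<Sum>a\<in>carrier G. L (rmat a b \<odot>\<^bsub>?Z\<^esub> tpure T W V (act W b w) (act V a v)))"
    by (intro sum.cong refl functional_finsum[OF Z L fin] vsD(3)[OF Z] p)
  also have "\<dots> = (\<Sum>b\<in>carrier G. \<Sum>a\<in>carrier G. rmat a b * L (tpure T W V (act W b w) (act V a v)))"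
    using L p by (simp add: linear_functional_def)
  finally show ?thesis by (subst sum.swap) simp
qed

text \<open>On the left a single symmetry occurs, and \<open>b\<close> acts on V \<otimes> W
  diagonally, hence on both \<open>v\<close> and \<open>w\<close>. On the right two symmetries occur
  with independent coefficients, and their actions on \<open>u\<close> compose to
  \<open>c \<otimes> a\<close>.\<close>

lemma functional_hexagon1:
  assumes U: "rep U" and V: "rep V" and W: "rep W"
    and u: "u \<in> carrier U" and v: "v \<in> carrier V" and w: "w \<in> carrier W"
    and L: "linear_functional (tobj T V (tobj T W U)) L"
  shows "(\<Sum>a\<in>carrier G. \<Sum>b\<in>carrier G. rmat a b *
            L (tpure T V (tobj T W U) (act V b v) (tpure T W U (act W b w) (act U a u)))) =
         (\<Sum>a\<in>carrier G. \<Sum>b\<in>carrier G. rmat a b * (\<Sum>c\<in>carrier G. \<Sum>d\<in>carrier G. rmat c d *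
            L (tpure T V (tobj T W U) (act V b v) (tpure T W U (act W d w) (act U (c \<otimes> a) u)))))"
proof -
  note UV = rep_tobj[OF U V] and VU = rep_tobj[OF V U] and VW = rep_tobj[OF V W]
    and WU = rep_tobj[OF W U] and UW = rep_tobj[OF U W]
  let ?x = "tpure T (tobj T U V) W (tpure T U V u v) w"
  have x: "?x \<in> carrier (tobj T (tobj T U V) W)" by (intro pure_closed UV W U V u v w)
  have "L (assoc T V W U (\<sigma> U (tobj T V W) (assoc T U V W ?x))) =
      L (assoc T V W U (\<sigma> U (tobj T V W) (tpure T U (tobj T V W) u (tpure T V W v w))))"
    using assoc_spec(2)[OF U V W u v w] by simp
  also have "\<dots> = (\<Sum>a\<in>carrier G. \<Sum>b\<in>carrier G. rmat a b *
      L (assoc T V W U (tpure T (tobj T V W) U (act (tobj T V W) b (tpure T V W v w)) (act U a u))))"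
    by (rule functional_sigma[OF U VW u pure_closed[OF V W v w] functional_comp[OF assoc_spec(1)[OF V W U] L]])
  also have "\<dots> = (\<Sum>a\<in>carrier G. \<Sum>b\<in>carrier G. rmat a b *
            L (tpure T V (tobj T W U) (act V b v) (tpure T W U (act W b w) (act U a u))))"
    by (intro sum.cong refl)
      (simp add: act_pure[OF V W _ v w] assoc_spec(2)[OF V W U act_closed[OF V _ v] act_closed[OF W _ w] act_closed[OF U _ u]])
  finally have lhs: "L (assoc T V W U (\<sigma> U (tobj T V W) (assoc T U V W ?x))) = \<dots>" .
  define M where "M = tmap T V (tobj T U W) V (tobj T W U) (\<lambda>v. v) (\<sigma> U W)"
  note tM = tmap_spec[OF V UW V WU lin_id[OF rep_vs[OF V]] sigma_lin[OF U W], folded M_def]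
  have "L (M (assoc T V U W (tmap T (tobj T U V) W (tobj T V U) W (\<sigma> U V) (\<lambda>w. w) ?x))) =
      L (M (assoc T V U W (tpure T (tobj T V U) W (\<sigma> U V (tpure T U V u v)) w)))"
    using tmap_spec(2)[OF UV W VU W sigma_lin[OF U V] lin_id[OF rep_vs[OF W]] pure_closed[OF U V u v] w] by simp
  also have "\<dots> = (\<Sum>a\<in>carrier G. \<Sum>b\<in>carrier G. rmat a b *
      L (M (assoc T V U W (tpure T (tobj T V U) W (tpure T V U (act V b v) (act U a u)) w))))"
    by (rule functional_sigma[OF U V u v functional_comp[OF pure_lin_left[OF VU W w]
          functional_comp[OF assoc_spec(1)[OF V U W] functional_comp[OF tM(1) L]]]])
  also have "\<dots> = (\<Sum>a\<in>carrier G. \<Sum>b\<in>carrier G. rmat a b *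
      L (tpure T V (tobj T W U) (act V b v) (\<sigma> U W (tpure T U W (act U a u) w))))"
    by (intro sum.cong refl)
      (simp add: assoc_spec(2)[OF V U W act_closed[OF V _ v] act_closed[OF U _ u] w]
        tM(2)[OF act_closed[OF V _ v] pure_closed[OF U W act_closed[OF U _ u] w]])
  also have "\<dots> = (\<Sum>a\<in>carrier G. \<Sum>b\<in>carrier G. rmat a b * (\<Sum>c\<in>carrier G. \<Sum>d\<in>carrier G. rmat c d *
            L (tpure T V (tobj T W U) (act V b v) (tpure T W U (act W d w) (act U c (act U a u))))))"
    by (intro sum.cong refl arg_cong2[where f = "(*)"]
        functional_sigma[OF U W act_closed[OF U _ u] w functional_comp[OF pure_lin_right[OF V WU act_closed[OF V _ v]] L]])
  also have "\<dots> = (\<Sum>a\<in>carrier G. \<Sum>b\<in>carrier G. rmat a b * (\<Sum>c\<in>carrier G. \<Sum>d\<in>carrier G. rmat c d *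
            L (tpure T V (tobj T W U) (act V b v) (tpure T W U (act W d w) (act U (c \<otimes> a) u)))))"
    by (intro sum.cong refl arg_cong2[where f = "(*)"]) (simp add: act_mult[OF U _ _ u])
  finally show ?thesis
    using lhs sigma_hexagon1[OF U V W x, folded M_def] by simp
qed

text \<open>The mirror image: now \<open>a\<close> acts diagonally on U \<otimes> V on the left, and
  on the right the two actions on \<open>w\<close> compose to \<open>d \<otimes> b\<close>.\<close>

lemma functional_hexagon2:
  assumes U: "rep U" and V: "rep V" and W: "rep W"
    and u: "u \<in> carrier U" and v: "v \<in> carrier V" and w: "w \<in> carrier W"
    and L: "linear_functional (tobj T (tobj T W U) V) L"
  shows "(\<Sum>a\<in>carrier G. \<Sum>b\<in>carrier G. rmat a b *
            L (tpure T (tobj T W U) V (tpure T W U (act W b w) (act U a u)) (act V a v))) =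
         (\<Sum>a\<in>carrier G. \<Sum>b\<in>carrier G. rmat a b * (\<Sum>c\<in>carrier G. \<Sum>d\<in>carrier G. rmat c d *
            L (tpure T (tobj T W U) V (tpure T W U (act W (d \<otimes> b) w) (act U c u)) (act V a v))))"
proof -
  note UV = rep_tobj[OF U V] and WV = rep_tobj[OF W V] and VW = rep_tobj[OF V W]
    and WU = rep_tobj[OF W U] and UW = rep_tobj[OF U W]
  let ?x = "tpure T U (tobj T V W) u (tpure T V W v w)"
  have x: "?x \<in> carrier (tobj T U (tobj T V W))" by (intro pure_closed VW W U V u v w)
  have "L (assoc_inv T W U V (\<sigma> (tobj T U V) W (assoc_inv T U V W ?x))) =
      L (assoc_inv T W U V (\<sigma> (tobj T U V) W (tpure T (tobj T U V) W (tpure T U V u v) w)))"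
    using assoc_inv_spec(2)[OF U V W u v w] by simp
  also have "\<dots> = (\<Sum>a\<in>carrier G. \<Sum>b\<in>carrier G. rmat a b *
      L (assoc_inv T W U V (tpure T W (tobj T U V) (act W b w) (act (tobj T U V) a (tpure T U V u v)))))"
    by (rule functional_sigma[OF UV W pure_closed[OF U V u v] w functional_comp[OF assoc_inv_spec(1)[OF W U V] L]])
  also have "\<dots> = (\<Sum>a\<in>carrier G. \<Sum>b\<in>carrier G. rmat a b *
            L (tpure T (tobj T W U) V (tpure T W U (act W b w) (act U a u)) (act V a v)))"
    by (intro sum.cong refl)
      (simp add: act_pure[OF U V _ u v] assoc_inv_spec(2)[OF W U V act_closed[OF W _ w] act_closed[OF U _ u] act_closed[OF V _ v]])
  finally have lhs: "L (assoc_inv T W U V (\<sigma> (tobj T U V) W (assoc_inv T U V W ?x))) = \<dots>" .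
  define M where "M = tmap T (tobj T U W) V (tobj T W U) V (\<sigma> U W) (\<lambda>v. v)"
  note tM = tmap_spec[OF UW V WU V sigma_lin[OF U W] lin_id[OF rep_vs[OF V]], folded M_def]
  have "L (M (assoc_inv T U W V (tmap T U (tobj T V W) U (tobj T W V) (\<lambda>u. u) (\<sigma> V W) ?x))) =
      L (M (assoc_inv T U W V (tpure T U (tobj T W V) u (\<sigma> V W (tpure T V W v w)))))"
    using tmap_spec(2)[OF U VW U WV lin_id[OF rep_vs[OF U]] sigma_lin[OF V W] u pure_closed[OF V W v w]] by simp
  also have "\<dots> = (\<Sum>a\<in>carrier G. \<Sum>b\<in>carrier G. rmat a b *
      L (M (assoc_inv T U W V (tpure T U (tobj T W V) u (tpure T W V (act W b w) (act V a v))))))"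
    by (rule functional_sigma[OF V W v w functional_comp[OF pure_lin_right[OF U WV u]
          functional_comp[OF assoc_inv_spec(1)[OF U W V] functional_comp[OF tM(1) L]]]])
  also have "\<dots> = (\<Sum>a\<in>carrier G. \<Sum>b\<in>carrier G. rmat a b *
      L (tpure T (tobj T W U) V (\<sigma> U W (tpure T U W u (act W b w))) (act V a v)))"
    by (intro sum.cong refl)
      (simp add: assoc_inv_spec(2)[OF U W V u act_closed[OF W _ w] act_closed[OF V _ v]]
        tM(2)[OF pure_closed[OF U W u act_closed[OF W _ w]] act_closed[OF V _ v]])
  also have "\<dots> = (\<Sum>a\<in>carrier G. \<Sum>b\<in>carrier G. rmat a b * (\<Sum>c\<in>carrier G. \<Sum>d\<in>carrier G. rmat c d *
            L (tpure T (tobj T W U) V (tpure T W U (act W d (act W b w)) (act U c u)) (act V a v))))"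
    by (intro sum.cong refl arg_cong2[where f = "(*)"]
        functional_sigma[OF U W u act_closed[OF W _ w] functional_comp[OF pure_lin_left[OF WU V act_closed[OF V _ v]] L]])
  also have "\<dots> = (\<Sum>a\<in>carrier G. \<Sum>b\<in>carrier G. rmat a b * (\<Sum>c\<in>carrier G. \<Sum>d\<in>carrier G. rmat c d *
            L (tpure T (tobj T W U) V (tpure T W U (act W (d \<otimes> b) w) (act U c u)) (act V a v))))"
    by (intro sum.cong refl arg_cong2[where f = "(*)"]) (simp add: act_mult[OF W _ _ w])
  finally show ?thesis
    using lhs sigma_hexagon2[OF U V W x, folded M_def] by simp
qed

section \<open>From the axioms of a symmetry to those of the matrix\<close>

lemma reg_functional2:
  obtains L where "linear_functional (reg2) L"
    "\<And>g h. g \<in> carrier G \<Longrightarrow> h \<in> carrier G \<Longrightarrow> L (pure2 (delta g) (delta h)) = F g * H h"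
proof -
  obtain L where "linear_functional (reg2) L"
    "\<And>v w. v \<in> carrier reg \<Longrightarrow> w \<in> carrier reg \<Longrightarrow> L (pure2 v w) =
      (\<Sum>g\<in>carrier G. coord v g * F g) * (\<Sum>g\<in>carrier G. coord w g * H g)"
    using functional_product[OF reg_rep reg_rep functional_coord[of F] functional_coord[of H]] by blast
  then show thesis using that[of L] by (simp add: reg_closed functional_coord_delta)
qed

lemma act_delta_one: "g \<in> carrier G \<Longrightarrow> act reg g (delta \<one>) = delta g"
  by (simp add: act_delta)

text \<open>The hexagon at 1 \<otimes> 1 \<otimes> 1 in the group algebra, tested on the indicators
  of \<open>y\<close> and \<open>z\<close> and on \<open>F\<close>. On the one-symmetry side the
  same index has to equal both \<open>y\<close> and \<open>z\<close>, which is the origin of the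
  case distinction.\<close>

lemma rmat_hexagon1:
  assumes y: "y \<in> carrier G" and z: "z \<in> carrier G"
  shows "(\<Sum>a\<in>carrier G. \<Sum>c\<in>carrier G. rmat a y * rmat c z * F (c \<otimes> a)) =
    (if y = z then \<Sum>a\<in>carrier G. rmat a y * F a else 0)"
proof -
  define I where "I v u = (if u = v then 1 else 0 :: 'k)" for u v :: 'g
  obtain L' where L': "linear_functional (reg2) L'"
    "\<And>g h. g \<in> carrier G \<Longrightarrow> h \<in> carrier G \<Longrightarrow> L' (pure2 (delta g) (delta h)) = I z g * F h"
    using reg_functional2 by metis
  note QR = rep_tobj[OF reg_rep reg_rep]
  obtain L where L: "linear_functional (tobj T reg (reg2)) L"
    "\<And>v w. v \<in> carrier reg \<Longrightarrow> w \<in> carrier (reg2) \<Longrightarrow>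
      L (tpure T reg (reg2) v w) = (\<Sum>g\<in>carrier G. coord v g * I y g) * L' w"
    using functional_product[OF reg_rep QR functional_coord[of "I y"] L'(1)] by blast
  have Lp: "L (tpure T reg (reg2) (delta b) (pure2 (delta d) (delta a))) = I y b * (I z d * F a)"
    if "b \<in> carrier G" "d \<in> carrier G" "a \<in> carrier G" for a b d
    using that by (simp add: L(2) L'(2) reg_closed pure_closed[OF reg_rep reg_rep] functional_coord_delta)
  note d1 = reg_closed(5)[OF one_closed]
  have "(\<Sum>a\<in>carrier G. \<Sum>b\<in>carrier G. rmat a b * (I y b * (I z b * F a))) =
      (\<Sum>a\<in>carrier G. \<Sum>b\<in>carrier G. rmat a b * (\<Sum>c\<in>carrier G. \<Sum>d\<in>carrier G. rmat c d * (I y b * (I z d * F (c \<otimes> a)))))"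
    using functional_hexagon1[OF reg_rep reg_rep reg_rep d1 d1 d1 L(1)]
    by (simp add: act_delta_one Lp cong: sum.cong)
  moreover have "(\<Sum>a\<in>carrier G. \<Sum>b\<in>carrier G. rmat a b * (I y b * (I z b * F a))) =
      (\<Sum>a\<in>carrier G. \<Sum>b\<in>carrier G. (rmat a b * (I z b * F a)) * (if b = y then 1 else 0))"
    by (simp add: I_def[of y] mult_ac)
  moreover have "\<dots> = (\<Sum>a\<in>carrier G. rmat a y * (I z y * F a))"
    by (rule sum.cong[OF refl], rule sum_delta_mult[OF fin y])
  moreover have "\<dots> = (if y = z then \<Sum>a\<in>carrier G. rmat a y * F a else 0)"
    by (simp add: I_def)
  moreover have "(\<Sum>c\<in>carrier G. \<Sum>d\<in>carrier G. rmat c d * (I y b * (I z d * F (c \<otimes> a)))) =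
      I y b * (\<Sum>c\<in>carrier G. rmat c z * F (c \<otimes> a))" for a b
  proof -
    have "(\<Sum>c\<in>carrier G. \<Sum>d\<in>carrier G. rmat c d * (I y b * (I z d * F (c \<otimes> a)))) =
        (\<Sum>c\<in>carrier G. \<Sum>d\<in>carrier G. (rmat c d * (I y b * F (c \<otimes> a))) * (if d = z then 1 else 0))"
      by (simp add: I_def[of z] mult_ac)
    also have "\<dots> = (\<Sum>c\<in>carrier G. rmat c z * (I y b * F (c \<otimes> a)))"
      by (rule sum.cong[OF refl], rule sum_delta_mult[OF fin z])
    finally show ?thesis by (simp add: sum_distrib_left mult_ac)
  qed
  moreover have "(\<Sum>a\<in>carrier G. \<Sum>b\<in>carrier G. rmat a b * (I y b * (\<Sum>c\<in>carrier G. rmat c z * F (c \<otimes> a)))) =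
      (\<Sum>a\<in>carrier G. \<Sum>c\<in>carrier G. rmat a y * rmat c z * F (c \<otimes> a))"
  proof (rule sum.cong[OF refl])
    fix a
    have "(\<Sum>b\<in>carrier G. rmat a b * (I y b * (\<Sum>c\<in>carrier G. rmat c z * F (c \<otimes> a)))) =
        (\<Sum>b\<in>carrier G. (rmat a b * (\<Sum>c\<in>carrier G. rmat c z * F (c \<otimes> a))) * (if b = y then 1 else 0))"
      by (simp add: I_def mult_ac)
    also have "\<dots> = rmat a y * (\<Sum>c\<in>carrier G. rmat c z * F (c \<otimes> a))"
      by (rule sum_delta_mult[OF fin y])
    finally show "(\<Sum>b\<in>carrier G. rmat a b * (I y b * (\<Sum>c\<in>carrier G. rmat c z * F (c \<otimes> a)))) =
        (\<Sum>c\<in>carrier G. rmat a y * rmat c z * F (c \<otimes> a))"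
      by (simp add: sum_distrib_left mult_ac)
  qed
  ultimately show ?thesis by simp
qed

text \<open>As for the first hexagon, but the indicators of \<open>a\<close> and \<open>c\<close>
  now fix first indices, and \<open>F\<close> is evaluated at the product of second indices.\<close>

lemma rmat_hexagon2:
  assumes a: "a \<in> carrier G" and c: "c \<in> carrier G"
  shows "(\<Sum>b\<in>carrier G. \<Sum>d\<in>carrier G. rmat a b * rmat c d * F (d \<otimes> b)) =
    (if a = c then \<Sum>b\<in>carrier G. rmat a b * F b else 0)"
proof -
  define I where "I v u = (if u = v then 1 else 0 :: 'k)" for u v :: 'g
  obtain L' where L': "linear_functional (reg2) L'"
    "\<And>g h. g \<in> carrier G \<Longrightarrow> h \<in> carrier G \<Longrightarrow> L' (pure2 (delta g) (delta h)) = F g * I c h"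
    using reg_functional2 by metis
  note QR = rep_tobj[OF reg_rep reg_rep]
  obtain L where L: "linear_functional (tobj T (reg2) reg) L"
    "\<And>v w. v \<in> carrier (reg2) \<Longrightarrow> w \<in> carrier reg \<Longrightarrow>
      L (tpure T (reg2) reg v w) = L' v * (\<Sum>g\<in>carrier G. coord w g * I a g)"
    using functional_product[OF QR reg_rep L'(1) functional_coord[of "I a"]] by blast
  have Lp: "L (tpure T (reg2) reg (pure2 (delta g) (delta h)) (delta k)) = F g * I c h * I a k"
    if "g \<in> carrier G" "h \<in> carrier G" "k \<in> carrier G" for g h k
    using that by (simp add: L(2) L'(2) reg_closed pure_closed[OF reg_rep reg_rep] functional_coord_delta)
  note d1 = reg_closed(5)[OF one_closed]
  have "(\<Sum>x\<in>carrier G. \<Sum>b\<in>carrier G. rmat x b * (F b * I c x * I a x)) =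
      (\<Sum>x\<in>carrier G. \<Sum>b\<in>carrier G. rmat x b * (\<Sum>y\<in>carrier G. \<Sum>d\<in>carrier G. rmat y d * (F (d \<otimes> b) * I c y * I a x)))"
    using functional_hexagon2[OF reg_rep reg_rep reg_rep d1 d1 d1 L(1)]
    by (simp add: act_delta_one Lp cong: sum.cong)
  moreover have "(\<Sum>x\<in>carrier G. \<Sum>b\<in>carrier G. rmat x b * (F b * I c x * I a x)) =
      (\<Sum>x\<in>carrier G. (\<Sum>b\<in>carrier G. rmat x b * (F b * I c x)) * (if x = a then 1 else 0))"
    by (simp add: I_def[of a] sum_distrib_left sum_distrib_right mult_ac)
  moreover have "\<dots> = (\<Sum>b\<in>carrier G. rmat a b * (F b * I c a))"
    by (rule sum_delta_mult[OF fin a])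
  moreover have "\<dots> = (if a = c then \<Sum>b\<in>carrier G. rmat a b * F b else 0)"
    by (simp add: I_def)
  moreover have "(\<Sum>y\<in>carrier G. \<Sum>d\<in>carrier G. rmat y d * (F (d \<otimes> b) * I c y * I a x)) =
      I a x * (\<Sum>d\<in>carrier G. rmat c d * F (d \<otimes> b))" for x b
  proof -
    have "(\<Sum>y\<in>carrier G. \<Sum>d\<in>carrier G. rmat y d * (F (d \<otimes> b) * I c y * I a x)) =
        (\<Sum>y\<in>carrier G. (\<Sum>d\<in>carrier G. rmat y d * (F (d \<otimes> b) * I a x)) * (if y = c then 1 else 0))"
      by (simp add: I_def[of c] sum_distrib_left sum_distrib_right mult_ac)
    also have "\<dots> = (\<Sum>d\<in>carrier G. rmat c d * (F (d \<otimes> b) * I a x))"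
      by (rule sum_delta_mult[OF fin c])
    finally show ?thesis by (simp add: sum_distrib_left mult_ac)
  qed
  moreover have "(\<Sum>x\<in>carrier G. \<Sum>b\<in>carrier G. rmat x b * (I a x * (\<Sum>d\<in>carrier G. rmat c d * F (d \<otimes> b)))) =
      (\<Sum>b\<in>carrier G. \<Sum>d\<in>carrier G. rmat a b * rmat c d * F (d \<otimes> b))"
  proof -
    have "(\<Sum>x\<in>carrier G. \<Sum>b\<in>carrier G. rmat x b * (I a x * (\<Sum>d\<in>carrier G. rmat c d * F (d \<otimes> b)))) =
        (\<Sum>x\<in>carrier G. (\<Sum>b\<in>carrier G. rmat x b * (\<Sum>d\<in>carrier G. rmat c d * F (d \<otimes> b))) * (if x = a then 1 else 0))"
      by (simp add: I_def sum_distrib_left sum_distrib_right mult_ac)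
    also have "\<dots> = (\<Sum>b\<in>carrier G. rmat a b * (\<Sum>d\<in>carrier G. rmat c d * F (d \<otimes> b)))"
      by (rule sum_delta_mult[OF fin a])
    finally show ?thesis by (simp add: sum_distrib_left mult_ac)
  qed
  ultimately show ?thesis by simp
qed

lemma rmat_symmetric:
  "(\<Sum>a\<in>carrier G. \<Sum>b\<in>carrier G. \<Sum>c\<in>carrier G. \<Sum>d\<in>carrier G.
      rmat a b * rmat c d * (F (d \<otimes> a) * H (c \<otimes> b))) = F \<one> * H \<one>"
proof -
  obtain L where L: "linear_functional (reg2) L"
    "\<And>g h. g \<in> carrier G \<Longrightarrow> h \<in> carrier G \<Longrightarrow> L (pure2 (delta g) (delta h)) = F g * H h"
    using reg_functional2 by metis
  note d1 = reg_closed(5)[OF one_closed]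
  let ?d = "pure2 (delta \<one>) (delta \<one>)"
  have d: "?d \<in> carrier (reg2)" using pure_closed[OF reg_rep reg_rep d1 d1] .
  have "F \<one> * H \<one> = L (\<sigma> reg reg (\<sigma> reg reg ?d))"
    using sigma_sigma[OF reg_rep reg_rep d] L(2) by simp
  also have "\<dots> = (\<Sum>a\<in>carrier G. \<Sum>b\<in>carrier G. rmat a b *
      L (\<sigma> reg reg (pure2 (act reg b (delta \<one>)) (act reg a (delta \<one>)))))"
    by (rule functional_sigma[OF reg_rep reg_rep d1 d1 functional_comp[OF sigma_lin[OF reg_rep reg_rep] L(1)]])
  also have "\<dots> = (\<Sum>a\<in>carrier G. \<Sum>b\<in>carrier G. rmat a b *
      (\<Sum>c\<in>carrier G. \<Sum>d\<in>carrier G. rmat c d * (F (d \<otimes> a) * H (c \<otimes> b))))"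
    by (intro sum.cong refl arg_cong2[where f = "(*)"])
      (simp add: act_delta act_delta_one functional_sigma[OF reg_rep reg_rep _ _ L(1)] reg_closed L(2) cong: sum.cong)
  finally show ?thesis by (simp add: sum_distrib_left mult_ac)
qed

text \<open>The symmetry commutes with the action of \<open>g\<close>; both sides are computed at 1
  \<otimes> 1. The functional is H \<otimes> F in this order because the symmetry exchanges the
  factors.\<close>

lemma rmat_equivariant:
  assumes g: "g \<in> carrier G"
  shows "(\<Sum>a\<in>carrier G. \<Sum>b\<in>carrier G. rmat a b * (F (a \<otimes> g) * H (b \<otimes> g))) =
    (\<Sum>a\<in>carrier G. \<Sum>b\<in>carrier G. rmat a b * (F (g \<otimes> a) * H (g \<otimes> b)))"
proof -
  obtain L where L: "linear_functional (reg2) L"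
    "\<And>x y. x \<in> carrier G \<Longrightarrow> y \<in> carrier G \<Longrightarrow> L (pure2 (delta x) (delta y)) = H x * F y"
    using reg_functional2 by metis
  note d1 = reg_closed(5)[OF one_closed] and dg = reg_closed(5)[OF g]
  note Q = rep_tobj[OF reg_rep reg_rep]
  let ?d = "pure2 (delta \<one>) (delta \<one>)"
  have d: "?d \<in> carrier (reg2)" using pure_closed[OF reg_rep reg_rep d1 d1] .
  have "L (\<sigma> reg reg (act (reg2) g ?d)) = L (act (reg2) g (\<sigma> reg reg ?d))"
    using sigma_act[OF reg_rep reg_rep g d] by simp
  moreover have "act (reg2) g ?d = pure2 (delta g) (delta g)"
    using act_pure[OF reg_rep reg_rep g d1 d1] act_delta_one[OF g] by simp
  moreover have "L (\<sigma> reg reg (pure2 (delta g) (delta g))) =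
      (\<Sum>a\<in>carrier G. \<Sum>b\<in>carrier G. rmat a b * (F (a \<otimes> g) * H (b \<otimes> g)))"
    unfolding functional_sigma[OF reg_rep reg_rep dg dg L(1)]
    by (intro sum.cong refl) (simp add: act_delta g L(2) mult.commute)
  moreover have "L (act (reg2) g (\<sigma> reg reg ?d)) =
      (\<Sum>a\<in>carrier G. \<Sum>b\<in>carrier G. rmat a b * L (act (reg2) g (pure2 (act reg b (delta \<one>)) (act reg a (delta \<one>)))))"
    by (rule functional_sigma[OF reg_rep reg_rep d1 d1 functional_comp[OF act_lin[OF Q g] L(1)]])
  moreover have "\<dots> = (\<Sum>a\<in>carrier G. \<Sum>b\<in>carrier G. rmat a b * (F (g \<otimes> a) * H (g \<otimes> b)))"
    by (intro sum.cong refl)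
      (simp add: act_delta act_delta_one g L(2) act_pure[OF reg_rep reg_rep g] reg_closed mult.commute)
  ultimately show ?thesis by simp
qed

sublocale r_matrix G rmat
  by unfold_locales (fact fin rmat_hexagon1 rmat_hexagon2 rmat_symmetric rmat_equivariant)+

text \<open>Where \<open>rmat a b\<close> is nonzero, both indices lie in \<open>supp\<close> and
  act on the two vectors by scalars; elsewhere the action is unknown, but its coefficient is
  zero.\<close>

lemma sigma_isotypical:
  assumes V: "rep V" and W: "rep W" and v: "v \<in> isotypical supp V \<phi>" and w: "w \<in> isotypical supp W \<psi>"
  shows "\<sigma> V W (tpure T V W v w) = pairing \<phi> \<psi> \<odot>\<^bsub>tobj T W V\<^esub> tpure T W V w v"
proof -
  let ?Z = "tobj T W V"
  have Z: "vs ?Z" using rep_vs[OF rep_tobj[OF W V]] .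
  have vw: "v \<in> carrier V" "w \<in> carrier W"
    and av: "\<And>a. a \<in> supp \<Longrightarrow> act V a v = \<phi> a \<odot>\<^bsub>V\<^esub> v"
    and aw: "\<And>a. a \<in> supp \<Longrightarrow> act W a w = \<psi> a \<odot>\<^bsub>W\<^esub> w"
    using v w by (auto simp: isotypical_def)
  have p: "tpure T W V w v \<in> carrier ?Z" by (rule pure_closed[OF W V vw(2,1)])
  have "\<sigma> V W (tpure T V W v w) = (\<Oplus>\<^bsub>?Z\<^esub>b\<in>carrier G. \<Oplus>\<^bsub>?Z\<^esub>a\<in>carrier G.
      rmat a b \<odot>\<^bsub>?Z\<^esub> tpure T W V (act W b w) (act V a v))"
    by (rule sigma_pure[OF V W vw])
  also have "\<dots> = (\<Oplus>\<^bsub>?Z\<^esub>b\<in>carrier G. \<Oplus>\<^bsub>?Z\<^esub>a\<in>carrier G. (rmat a b * (\<phi> a * \<psi> b)) \<odot>\<^bsub>?Z\<^esub> tpure T W V w v)"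
  proof (intro finsum_cong_in[OF Z] finsum_in[OF Z] vsD(3)[OF Z] p)
    fix a b assume ab: "b \<in> carrier G" "a \<in> carrier G"
    have q: "tpure T W V (act W b w) (act V a v) \<in> carrier ?Z"
      using pure_closed[OF W V act_closed[OF W ab(1) vw(2)] act_closed[OF V ab(2) vw(1)]] .
    show "rmat a b \<odot>\<^bsub>?Z\<^esub> tpure T W V (act W b w) (act V a v) = (rmat a b * (\<phi> a * \<psi> b)) \<odot>\<^bsub>?Z\<^esub> tpure T W V w v"
    proof (cases "rmat a b = 0")
      case True
      then show ?thesis using vsD(10)[OF Z] p q by simp
    next
      case False
      then have "a \<in> supp" "b \<in> supp" using R_supp[of a b] ab by auto
      then show ?thesis
        using av aw pure_smult[OF W V] vw vsD(3)[OF rep_vs[OF V]] vsD(8)[OF Z] p vsD(3)[OF Z]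
        by (simp add: mult_ac)
    qed
  qed
  also have "\<dots> = (\<Oplus>\<^bsub>?Z\<^esub>b\<in>carrier G. (\<Sum>a\<in>carrier G. rmat a b * (\<phi> a * \<psi> b)) \<odot>\<^bsub>?Z\<^esub> tpure T W V w v)"
    using smult_sum_finsum[OF Z fin p] by simp
  also have "\<dots> = (\<Sum>b\<in>carrier G. \<Sum>a\<in>carrier G. rmat a b * (\<phi> a * \<psi> b)) \<odot>\<^bsub>?Z\<^esub> tpure T W V w v"
    using smult_sum_finsum[OF Z fin p] by simp
  also have "(\<Sum>b\<in>carrier G. \<Sum>a\<in>carrier G. rmat a b * (\<phi> a * \<psi> b)) = pairing \<phi> \<psi>"
    unfolding pairing_def by (rule sum.swap)
  finally show ?thesis .
qed

end

section \<open>Exterior powers\<close>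

text \<open>The tensor power of \<open>v\<close>, with an additional leftmost factor
  \<open>u\<close> from the unit object, because the powers of \<open>V\<close> start with
  \<open>tunit\<close>.\<close>

primrec pure_pow ::
  "('k::field, 'v, 'g) tensor \<Rightarrow> ('k, 'v, 'g) rep \<Rightarrow> 'v \<Rightarrow> 'v \<Rightarrow> nat \<Rightarrow> 'v" where
  "pure_pow T V u v 0 = u"
| "pure_pow T V u v (Suc n) = tpure T (tpow T V n) V (pure_pow T V u v n) v"

section \<open>Words in adjacent transpositions\<close>

lemma word_perm_append: "word_perm (is @ js) = word_perm is \<circ> word_perm js"
  by (induction "is") (simp_all add: word_perm_def comp_assoc)

lemma word_perm_single: "word_perm [i] = transpose i (Suc i)"
  by (simp add: word_perm_def)

text \<open>The parity of the length is the same for all words of a permutation, so an operator that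
  contributes -1 per letter gives the same scalar for each of them.\<close>

lemma word_perm_sign: "permutation (word_perm is) \<and> sign (word_perm is) = (- 1) ^ length is"
proof (induction "is")
  case Nil
  then show ?case by (simp add: word_perm_def)
next
  case (Cons i "is")
  have eq: "word_perm (i # is) = transpose i (Suc i) \<circ> word_perm is" by (simp add: word_perm_def)
  have perm: "permutation (word_perm (i # is))"
    unfolding eq using Cons by (intro permutation_compose permutation_swap_id) auto
  have "sign (word_perm (i # is)) = sign (transpose i (Suc i)) * sign (word_perm is)"
    unfolding eq using Cons by (intro sign_compose permutation_swap_id) auto
  then show ?case using perm Cons by (simp add: sign_swap_id)
qed

lemma transpose_word:
  assumes "a < b" "b < n"
  shows "\<exists>is. (\<forall>i\<in>set is. Suc i < n) \<and> word_perm is = transpose a b"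
  using assms
proof (induction b rule: less_induct)
  case (less b)
  then obtain b' where b: "b = Suc b'" by (cases b) auto
  show ?case
  proof (cases "a = b'")
    case True
    then show ?thesis using less.prems b by (intro exI[of _ "[b']"]) (simp add: word_perm_single)
  next
    case False
    then have "a < b'" using less.prems b by simp
    then obtain "is" where *: "\<forall>i\<in>set is. Suc i < n" "word_perm is = transpose a b'"
      using less.IH[of b'] less.prems b by auto
    have "transpose a b = transpose b' (Suc b') \<circ> transpose a b' \<circ> transpose b' (Suc b')"
      using \<open>a < b'\<close> b by (auto simp: fun_eq_iff transpose_def)
    then have "word_perm ([b'] @ is @ [b']) = transpose a b"
      by (simp only: word_perm_append word_perm_single *(2) o_assoc)
    then show ?thesis using * less.prems b by (intro exI[of _ "[b'] @ is @ [b']"]) auto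
  qed
qed

text \<open>Shows that the choice of a word in \<open>perm_op\<close> can be satisfied.\<close>

lemma permutes_word:
  assumes "p permutes {..<n}"
  shows "\<exists>is. (\<forall>i\<in>set is. Suc i < n) \<and> word_perm is = p"
  using assms finite_lessThan
proof (induction rule: permutes_induct)
  case id
  then show ?case by (intro exI[of _ "[]"]) (simp add: word_perm_def)
next
  case (swap a b p)
  then obtain js where js: "\<forall>i\<in>set js. Suc i < n" "word_perm js = p" by blast
  obtain "is" where "is": "\<forall>i\<in>set is. Suc i < n" "word_perm is = transpose a b"
  proof (cases "a < b")
    case True
    then show ?thesis using transpose_word[of a b n] swap that by auto
  next
    case False
    then have "b < a" using swap by simp
    then show ?thesis using transpose_word[of b a n] swap that by (auto simp: transpose_commute)
  qed
  show ?case using js "is" by (intro exI[of _ "is @ js"]) (auto simp: word_perm_append)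
qed

context symmetry
begin

section \<open>Antisymmetry of the powers of a vector\<close>

lemma rep_tpow: "rep V \<Longrightarrow> rep (tpow T V n)"
  by (induction n) (auto simp: rep_tunit rep_tobj)

lemma pure_pow_closed:
  assumes "rep V" "u \<in> carrier (tunit T)" "v \<in> carrier V"
  shows "pure_pow T V u v n \<in> carrier (tpow T V n)"
  using assms by (induction n) (auto intro: pure_closed rep_tpow)

lemma pure_pow_functional:
  assumes V: "rep V" and u: "linear_functional (tunit T) \<kappa>" "\<kappa> u = 1" "u \<in> carrier (tunit T)"
    and v: "linear_functional V f" "f v = 1" "v \<in> carrier V"
  shows "\<exists>L. linear_functional (tpow T V n) L \<and> L (pure_pow T V u v n) = 1"
proof (induction n)
  case 0
  then show ?case using u by auto
next
  case (Suc n)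
  then obtain L where L: "linear_functional (tpow T V n) L" "L (pure_pow T V u v n) = 1" by blast
  show ?case
    using functional_product[OF rep_tpow[OF V] V L(1) v(1)] L(2) v(2,3) pure_pow_closed[OF V u(3) v(3)]
    by auto
qed

lemma swap_op_lin:
  assumes V: "rep V"
  shows "lin (tpow T V n) (tpow T V n) (swap_op T \<sigma> V n i)"
proof (induction n arbitrary: i)
  case 0
  then show ?case using lin_id[OF rep_vs[OF rep_tpow[OF V, of 0]]] by simp
next
  case (Suc n)
  show ?case
  proof (cases n)
    case 0
    then show ?thesis using lin_id[OF rep_vs[OF rep_tpow[OF V, of "Suc 0"]]] by simp
  next
    case (Suc m)
    note M = rep_tpow[OF V, of m] and VV = rep_tobj[OF V V]
    have "lin (tpow T V (Suc (Suc m))) (tpow T V (Suc (Suc m)))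
      (\<lambda>x. assoc_inv T (tpow T V m) V V (tmap T (tpow T V m) (tobj T V V) (tpow T V m) (tobj T V V) (\<lambda>x. x) (\<sigma> V V)
        (assoc T (tpow T V m) V V x)))"
      unfolding tpow.simps
      by (rule lin_comp[OF lin_comp[OF assoc_spec(1)[OF M V V]
            tmap_spec(1)[OF M VV M VV lin_id[OF rep_vs[OF M]] sigma_lin[OF V V]]] assoc_inv_spec(1)[OF M V V]])
    moreover have "lin (tpow T V (Suc (Suc m))) (tpow T V (Suc (Suc m)))
        (tmap T (tpow T V (Suc m)) V (tpow T V (Suc m)) V (swap_op T \<sigma> V (Suc m) i) (\<lambda>v. v))"
      using tmap_spec(1)[OF rep_tpow[OF V, of "Suc m"] V rep_tpow[OF V, of "Suc m"] V
          Suc.IH[of i, unfolded Suc] lin_id[OF rep_vs[OF V]]] by simp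
    ultimately show ?thesis unfolding Suc by (simp add: comp_def)
  qed
qed

text \<open>All factors are the same vector, so exchanging two neighbours only produces the scalar
  -1, wherever they stand. The induction removes last factors until the pair to be exchanged stands
  at the end.\<close>

lemma swap_op_pure_pow:
  assumes V: "rep V" and u: "u \<in> carrier (tunit T)" and v: "v \<in> carrier V"
    and neg: "\<sigma> V V (tpure T V V v v) = (- 1) \<odot>\<^bsub>tobj T V V\<^esub> tpure T V V v v"
    and i: "Suc i < n"
  shows "swap_op T \<sigma> V n i (pure_pow T V u v n) = (- 1) \<odot>\<^bsub>tpow T V n\<^esub> pure_pow T V u v n"
  using i
proof (induction n arbitrary: i)
  case (Suc n)
  then obtain m where n: "n = Suc m" by (cases n) auto
  note M = rep_tpow[OF V, of m] and VV = rep_tobj[OF V V] and S = rep_tpow[OF V, of "Suc m"]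
  have x: "pure_pow T V u v m \<in> carrier (tpow T V m)" by (rule pure_pow_closed[OF V u v])
  have y: "pure_pow T V u v (Suc m) \<in> carrier (tpow T V (Suc m))" by (rule pure_pow_closed[OF V u v])
  have z: "tpure T (tpow T V m) (tobj T V V) (pure_pow T V u v m) (tpure T V V v v)
      \<in> carrier (tobj T (tpow T V m) (tobj T V V))"
    by (intro pure_closed M VV V x v)
  show ?case
  proof (cases "i = m")
    case True
    let ?t = "tmap T (tpow T V m) (tobj T V V) (tpow T V m) (tobj T V V) (\<lambda>x. x) (\<sigma> V V)"
    have "swap_op T \<sigma> V (Suc n) i (pure_pow T V u v (Suc n)) =
        assoc_inv T (tpow T V m) V V (?t (assoc T (tpow T V m) V V
          (tpure T (tobj T (tpow T V m) V) V (tpure T (tpow T V m) V (pure_pow T V u v m) v) v)))"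
      using True by (simp add: n)
    also have "\<dots> = assoc_inv T (tpow T V m) V V
        (tpure T (tpow T V m) (tobj T V V) (pure_pow T V u v m) (\<sigma> V V (tpure T V V v v)))"
      using assoc_spec(2)[OF M V V x v v]
        tmap_spec(2)[OF M VV M VV lin_id[OF rep_vs[OF M]] sigma_lin[OF V V] x pure_closed[OF V V v v]] by simp
    also have "\<dots> = assoc_inv T (tpow T V m) V V
        ((- 1) \<odot>\<^bsub>tobj T (tpow T V m) (tobj T V V)\<^esub> tpure T (tpow T V m) (tobj T V V) (pure_pow T V u v m) (tpure T V V v v))"
      using pure_smult(2)[OF M VV x pure_closed[OF V V v v]] neg by simp
    also have "\<dots> = (- 1) \<odot>\<^bsub>tpow T V (Suc n)\<^esub> pure_pow T V u v (Suc n)"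
      using linD(5)[OF assoc_inv_spec(1)[OF M V V] z] assoc_inv_spec(2)[OF M V V x v v] by (simp add: n)
    finally show ?thesis .
  next
    case False
    then have i: "Suc i < Suc m" using Suc.prems n by simp
    have "swap_op T \<sigma> V (Suc n) i (pure_pow T V u v (Suc n)) =
        tmap T (tpow T V (Suc m)) V (tpow T V (Suc m)) V (swap_op T \<sigma> V (Suc m) i) (\<lambda>v. v)
          (tpure T (tpow T V (Suc m)) V (pure_pow T V u v (Suc m)) v)"
      using False by (simp add: n)
    also have "\<dots> = tpure T (tpow T V (Suc m)) V ((- 1) \<odot>\<^bsub>tpow T V (Suc m)\<^esub> pure_pow T V u v (Suc m)) v"
      using tmap_spec(2)[OF S V S V swap_op_lin[OF V] lin_id[OF rep_vs[OF V]] y v] Suc.IH[of i] i n by simp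
    also have "\<dots> = (- 1) \<odot>\<^bsub>tpow T V (Suc n)\<^esub> pure_pow T V u v (Suc n)"
      using pure_smult(1)[OF S V y v] by (simp add: n)
    finally show ?thesis .
  qed
qed simp

text \<open>Each letter of the chosen word contributes -1, and the parity of its length is the sign
  of \<open>p\<close>.\<close>

lemma perm_op_pure_pow:
  assumes V: "rep V" and u: "u \<in> carrier (tunit T)" and v: "v \<in> carrier V"
    and neg: "\<sigma> V V (tpure T V V v v) = (- 1) \<odot>\<^bsub>tobj T V V\<^esub> tpure T V V v v"
    and p: "p permutes {..<n}"
  shows "perm_op T \<sigma> V n p (pure_pow T V u v n) = of_int (sign p) \<odot>\<^bsub>tpow T V n\<^esub> pure_pow T V u v n"
proof -
  let ?x = "pure_pow T V u v n" and ?N = "tpow T V n"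
  note N = vsD[OF rep_vs[OF rep_tpow[OF V, of n]]] and x = pure_pow_closed[OF V u v, of n]
  have fold: "foldr (\<lambda>i f. swap_op T \<sigma> V n i \<circ> f) is id ?x = (- 1) ^ length is \<odot>\<^bsub>?N\<^esub> ?x"
    if "\<forall>i\<in>set is. Suc i < n" for "is"
    using that
  proof (induction "is")
    case Nil
    then show ?case using N(9)[OF x] by simp
  next
    case (Cons i "is")
    then show ?case
      using linD(5)[OF swap_op_lin[OF V, of n i] x] swap_op_pure_pow[OF V u v neg, of i n] N(8)[OF x] by simp
  qed
  define w where "w = (SOME is. (\<forall>i\<in>set is. Suc i < n) \<and> word_perm is = p)"
  have w: "\<forall>i\<in>set w. Suc i < n" "word_perm w = p"
    unfolding w_def using someI_ex[OF permutes_word[OF p]] by auto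
  have "sign p = (- 1) ^ length w" using word_perm_sign[of w] w(2) by simp
  then show ?thesis unfolding perm_op_def w_def[symmetric] fold[OF w(1)] by simp
qed

text \<open>The antisymmetrizer fixes the power of \<open>v\<close>: the sign in its definition
  cancels the sign by which the permutation acts, so it averages n! equal vectors. The functional
  with value 1 on this power shows that it is nonzero.\<close>

lemma exterior_power_nonzero:
  assumes V: "rep V" and u: "linear_functional (tunit T) \<kappa>" "\<kappa> u = 1" "u \<in> carrier (tunit T)"
    and v: "linear_functional V f" "f v = 1" "v \<in> carrier V"
    and neg: "\<sigma> V V (tpure T V V v v) = (- 1) \<odot>\<^bsub>tobj T V V\<^esub> tpure T V V v v"
  shows "exterior_power T \<sigma> V n \<noteq> {\<zero>\<^bsub>tpow T V n\<^esub>}"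
proof
  let ?x = "pure_pow T V u v n" and ?N = "tpow T V n"
  assume "exterior_power T \<sigma> V n = {\<zero>\<^bsub>?N\<^esub>}"
  moreover have x: "?x \<in> carrier ?N" by (rule pure_pow_closed[OF V u(3) v(3)])
  ultimately have zero: "antisymmetrizer T \<sigma> V n ?x = \<zero>\<^bsub>?N\<^esub>" by (auto simp: exterior_power_def)
  obtain L where L: "linear_functional ?N L" "L ?x = 1"
    using pure_pow_functional[OF V u v] by blast
  have vN: "vs ?N" by (rule rep_vs[OF rep_tpow[OF V]])
  note N = vsD[OF vN]
  let ?P = "{p. p permutes {..<n}}"
  have fP: "finite ?P" by (simp add: finite_permutations)
  have t: "of_int (sign p) \<odot>\<^bsub>?N\<^esub> perm_op T \<sigma> V n p ?x = ?x" if "p \<in> ?P" for p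
  proof -
    have "of_int (sign p) * of_int (sign p) = (1::'k)"
      by (metis of_int_1 of_int_mult sign_idempotent)
    then show ?thesis
      using perm_op_pure_pow[OF V u(3) v(3) neg, of p n] that N(8,9)[OF x] by simp
  qed
  have S: "(\<Oplus>\<^bsub>?N\<^esub>p\<in>?P. of_int (sign p) \<odot>\<^bsub>?N\<^esub> perm_op T \<sigma> V n p ?x) = (\<Oplus>\<^bsub>?N\<^esub>p\<in>?P. ?x)"
    by (rule finsum_cong_in[OF vN x t])
  have cl: "(\<Oplus>\<^bsub>?N\<^esub>p\<in>?P. ?x) \<in> carrier ?N" by (rule finsum_in[OF vN x])
  have "L (\<Oplus>\<^bsub>?N\<^esub>p\<in>?P. ?x) = of_nat (card ?P)"
    using functional_finsum[OF vN L(1) fP, of "\<lambda>_. ?x"] x L(2) by simp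
  also have "card ?P = fact n" by (rule card_permutations) auto
  finally have "L (antisymmetrizer T \<sigma> V n ?x) = 1"
    unfolding antisymmetrizer_def S using L(1) cl by (simp add: linear_functional_def)
  moreover have "L \<zero>\<^bsub>?N\<^esub> = 0"
    using L(1) N(1) N(10)[OF N(1)] by (metis linear_functional_def mult_zero_left)
  ultimately show False using zero by simp
qed

lemma pairing_alternating:
  assumes ext: "\<exists>N. \<forall>n\<ge>N. exterior_power T \<sigma> reg n = {\<zero>\<^bsub>tpow T reg n\<^esub>}"
    and \<phi>: "mult_char G supp \<phi>"
  shows "pairing \<phi> \<phi> = 1"
proof (rule ccontr)
  assume "pairing \<phi> \<phi> \<noteq> 1"
  \<comment> \<open>Skewness at equal arguments leaves 1 and -1 as the only possible values.\<close>
  moreover have "pairing \<phi> \<phi> ^ 2 = 1" using pairing_skew[OF \<phi> \<phi>] by (simp add: power2_eq_square)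
  ultimately have m: "pairing \<phi> \<phi> = - 1" by (simp add: power2_eq_1_iff)
  obtain e where e: "e \<in> isotypical supp reg \<phi>" "coord e \<one> = 1"
    using isotypical_vector[OF supp_subgroup \<phi>] by metis
  have ec: "e \<in> carrier reg" using e by (simp add: isotypical_def)
  obtain u \<kappa> where u: "u \<in> carrier (tunit T)" "linear_functional (tunit T) \<kappa>" "\<kappa> u = 1" using tunit_functional by metis
  show False
    using ext exterior_power_nonzero[OF reg_rep u(2,3,1) functional_coord1 e(2) ec]
      sigma_isotypical[OF reg_rep reg_rep e(1) e(1)] m by auto
qed

end

section \<open>Characters and the main theorem\<close>

lemma units_class_ring: "carrier (units_of (class_ring :: 'k::field ring)) = {x. x \<noteq> 0}"
proof -
  have "x \<in> Units (class_ring :: 'k ring) \<longleftrightarrow> x \<noteq> 0" for x :: 'k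
    by (auto simp: Units_def intro!: exI[of _ "inverse x"])
  then show ?thesis by (auto simp: units_of_def)
qed

text \<open>Homomorphisms into \<open>units_of class_ring\<close> become functions into the field;
  extensionality is what singles out one representative of each character.\<close>

lemma char_group_iff:
  "\<phi> \<in> carrier (char_group G A) \<longleftrightarrow> mult_char G A (\<phi> :: 'g \<Rightarrow> 'k::field) \<and> \<phi> \<in> extensional A"
  unfolding char_group_def using units_class_ring[where 'k = 'k]
  by (auto simp: hom_def mult_char_def units_of_def Pi_iff)

lemma char_group_simps:
  "\<phi> \<otimes>\<^bsub>char_group G A\<^esub> \<psi> = (\<lambda>a\<in>A. \<phi> a * \<psi> a)" "\<one>\<^bsub>char_group G A\<^esub> = (\<lambda>a\<in>A. 1)"
  by (simp_all add: char_group_def)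

lemma mult_char_cong:
  assumes "subgroup A G" "\<And>a. a \<in> A \<Longrightarrow> f a = f' a"
  shows "mult_char G A f \<longleftrightarrow> mult_char G A f'"
  using assms by (auto simp: mult_char_def subgroup.m_closed)

lemma comm_group_char_group:
  assumes A: "subgroup A G"
  shows "comm_group (char_group G A :: ('g \<Rightarrow> 'k::field) monoid)"
proof (rule comm_groupI)
  fix \<phi> \<psi> :: "'g \<Rightarrow> 'k"
  assume p: "\<phi> \<in> carrier (char_group G A)" "\<psi> \<in> carrier (char_group G A)"
  have "mult_char G A (\<lambda>a\<in>A. \<phi> a * \<psi> a) \<longleftrightarrow> mult_char G A (\<lambda>a. \<phi> a * \<psi> a)"
    by (rule mult_char_cong[OF A]) simp
  then show "\<phi> \<otimes>\<^bsub>char_group G A\<^esub> \<psi> \<in> carrier (char_group G A)"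
    using p by (auto simp: char_group_iff char_group_simps mult_char_def)
  show "\<phi> \<otimes>\<^bsub>char_group G A\<^esub> \<psi> = \<psi> \<otimes>\<^bsub>char_group G A\<^esub> \<phi>"
    by (auto simp: char_group_simps mult.commute)
next
  have "mult_char G A (\<lambda>a\<in>A. 1 :: 'k)"
    using A by (auto simp: mult_char_def subgroup.m_closed)
  then show "\<one>\<^bsub>char_group G A\<^esub> \<in> carrier (char_group G A :: ('g \<Rightarrow> 'k) monoid)"
    by (simp add: char_group_iff char_group_simps)
next
  fix \<phi> \<psi> \<chi> :: "'g \<Rightarrow> 'k"
  show "\<phi> \<otimes>\<^bsub>char_group G A\<^esub> \<psi> \<otimes>\<^bsub>char_group G A\<^esub> \<chi> = \<phi> \<otimes>\<^bsub>char_group G A\<^esub> (\<psi> \<otimes>\<^bsub>char_group G A\<^esub> \<chi>)"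
    by (auto simp: char_group_simps mult.assoc)
next
  fix \<phi> :: "'g \<Rightarrow> 'k"
  assume p: "\<phi> \<in> carrier (char_group G A)"
  then show "\<one>\<^bsub>char_group G A\<^esub> \<otimes>\<^bsub>char_group G A\<^esub> \<phi> = \<phi>"
    by (auto simp: char_group_simps char_group_iff extensional_def)
  have "mult_char G A (\<lambda>a\<in>A. inverse (\<phi> a)) \<longleftrightarrow> mult_char G A (\<lambda>a. inverse (\<phi> a))"
    by (rule mult_char_cong[OF A]) simp
  then have "(\<lambda>a\<in>A. inverse (\<phi> a)) \<in> carrier (char_group G A)"
    using p by (auto simp: char_group_iff mult_char_def)
  moreover have "(\<lambda>a\<in>A. inverse (\<phi> a)) \<otimes>\<^bsub>char_group G A\<^esub> \<phi> = \<one>\<^bsub>char_group G A\<^esub>"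
    using p by (auto simp: char_group_simps char_group_iff mult_char_def)
  ultimately show "\<exists>\<psi>\<in>carrier (char_group G A). \<psi> \<otimes>\<^bsub>char_group G A\<^esub> \<phi> = \<one>\<^bsub>char_group G A\<^esub>" by blast
qed

text \<open>All values are roots of unity of order dividing |G|, of which a field contains only
  finitely many.\<close>

lemma finite_char_group:
  assumes G: "group G" "finite (carrier G)" and A: "subgroup A G"
  shows "finite (carrier (char_group G A :: ('g \<Rightarrow> 'k::field) monoid))"
proof -
  interpret group G by (rule G)
  let ?n = "Coset.order G"
  have n: "?n > 0" using G(2) by (simp add: order_gt_0_iff_finite)
  define p where "p = Polynomial.monom (1::'k) ?n - 1"
  have "poly p x = x ^ ?n - 1" for x by (simp add: p_def poly_monom)
  moreover have "poly p 0 \<noteq> 0" using n calculation by (simp add: power_0_left)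
  then have "p \<noteq> 0" by auto
  ultimately have fin: "finite {x :: 'k. x ^ ?n = 1}" using poly_roots_finite[of p] by simp
  have "finite A" using G(2) subgroup.subset[OF A] finite_subset by blast
  then have "finite (A \<rightarrow>\<^sub>E {x :: 'k. x ^ ?n = 1})" using fin by (simp add: finite_PiE)
  moreover have "carrier (char_group G A) \<subseteq> A \<rightarrow>\<^sub>E {x :: 'k. x ^ ?n = 1}"
  proof
    fix \<phi> :: "'g \<Rightarrow> 'k" assume "\<phi> \<in> carrier (char_group G A)"
    then have f: "mult_char G A \<phi>" "\<phi> \<in> extensional A" by (auto simp: char_group_iff)
    have "\<phi> a ^ ?n = 1" if "a \<in> A" for a
      using mult_char_pow[OF A f(1) that, of ?n] mult_char_one[OF A f(1)]
        pow_order_eq_1[of a] subgroup.mem_carrier[OF A that] by simp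
    then show "\<phi> \<in> A \<rightarrow>\<^sub>E {x. x ^ ?n = 1}" using f(2) by (auto simp: PiE_iff)
  qed
  ultimately show ?thesis by (rule rev_finite_subset)
qed

text \<open>Both sides of the cocycle equation expand to \<alpha>(x, y) \<alpha>(x, z) \<alpha>(y,
  z).\<close>

lemma bicharacter_two_cocycle:
  assumes "\<And>x. x \<in> carrier X \<Longrightarrow> mult_char X (carrier X) (\<alpha> x)"
    and "\<And>y. y \<in> carrier X \<Longrightarrow> mult_char X (carrier X) (\<lambda>x. \<alpha> x y)"
  shows "two_cocycle X \<alpha>"
  unfolding two_cocycle_def using assms by (auto simp: mult_char_def mult_ac)

theorem theorem4p1:
  fixes G :: "('g, 'm) monoid_scheme"
    and T :: "('k::{alg_closed_field, field_char_0}, 'v, 'g) tensor"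
    and \<sigma> :: "('k, 'v, 'g) braiding"
  assumes "group G" and "finite (carrier G)"
    and "is_usual_tensor G T"
    and "is_symmetry G T \<sigma>"
    and "\<And>V. is_rep G V \<Longrightarrow>
           \<exists>N. \<forall>n\<ge>N. exterior_power T \<sigma> V n = {\<zero>\<^bsub>tpow T V n\<^esub>}"
  shows "\<exists>A (\<alpha> :: ('g \<Rightarrow> 'k) \<Rightarrow> ('g \<Rightarrow> 'k) \<Rightarrow> 'k).
           A \<lhd> G \<and> comm_group (G\<lparr>carrier := A\<rparr>) \<and>
           two_cocycle (char_group G A) \<alpha> \<and>
           nondegenerate_cocycle (char_group G A) \<alpha> \<and>
           invariant_class G A \<alpha> \<and>
           (\<forall>V W. is_rep G V \<and> is_rep G W \<longrightarrow>
              (\<forall>\<phi>\<^sub>1 \<in> carrier (char_group G A). \<forall>\<phi>\<^sub>2 \<in> carrier (char_group G A).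
               \<forall>v \<in> isotypical A V \<phi>\<^sub>1. \<forall>w \<in> isotypical A W \<phi>\<^sub>2.
                 \<sigma> V W (tpure T V W v w) =
                   (\<alpha> \<phi>\<^sub>1 \<phi>\<^sub>2 / \<alpha> \<phi>\<^sub>2 \<phi>\<^sub>1) \<odot>\<^bsub>tobj T W V\<^esub> tpure T W V w v))"
proof -
  have ut: "usual_tensor G T" using assms(1,3) by (simp add: usual_tensor_def usual_tensor_axioms_def)
  \<comment> \<open>The unit object contains a copy of the field, and functions on the finite group
    inject into the infinite field; the composite makes room for the regular representation in
    \<open>'v\<close>.\<close>
  obtain emb :: "('g \<Rightarrow> 'k) \<Rightarrow> 'v" where emb: "inj_on emb {f. \<forall>x. x \<notin> carrier G \<longrightarrow> f x = 0}"
  proof -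
    interpret usual_tensor G T by (rule ut)
    obtain u \<kappa> where u: "u \<in> carrier (tunit T)" "linear_functional (tunit T) \<kappa>" "\<kappa> u = 1" using tunit_functional by metis
    have "inj (\<lambda>c. c \<odot>\<^bsub>tunit T\<^esub> u)"
      using u by (intro inj_on_inverseI[where g = \<kappa>]) (simp add: linear_functional_def)
    moreover obtain i :: "('g \<Rightarrow> 'k) \<Rightarrow> 'k" where "inj_on i {f. \<forall>x. x \<notin> carrier G \<longrightarrow> f x = 0}"
      using finite_support_functions_inject[OF assms(2), where 'k = 'k] infinite_UNIV_char_0 by blast
    ultimately have "inj_on ((\<lambda>c. c \<odot>\<^bsub>tunit T\<^esub> u) \<circ> i) {f. \<forall>x. x \<notin> carrier G \<longrightarrow> f x = 0}"
      by (intro comp_inj_on) (auto intro: inj_on_subset)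
    then show ?thesis by (rule that)
  qed
  have sy: "symmetry G T emb \<sigma>"
    using ut assms(2,4) emb
    by (simp add: symmetry_def symmetry_axioms_def function_embedding_def function_embedding_axioms_def)
  interpret symmetry G T emb \<sigma> by (rule sy)
  define X where "X = (char_group G supp :: ('g \<Rightarrow> 'k) monoid)"
  have X: "comm_group X" "finite (carrier X)"
    unfolding X_def using comm_group_char_group[OF supp_subgroup] finite_char_group[OF assms(1,2) supp_subgroup] by auto
  have Xc: "\<phi> \<in> carrier X \<longleftrightarrow> mult_char G supp \<phi> \<and> \<phi> \<in> extensional supp" for \<phi>
    by (simp add: X_def char_group_iff)
  have Xm: "\<phi> \<otimes>\<^bsub>X\<^esub> \<psi> = (\<lambda>a\<in>supp. \<phi> a * \<psi> a)" and X1: "\<one>\<^bsub>X\<^esub> = (\<lambda>a\<in>supp. 1)" for \<phi> \<psi>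
    by (simp_all add: X_def char_group_simps)
  interpret X: comm_group X by (rule X)
  have pairing_nz: "pairing \<phi> \<psi> \<noteq> 0" if "\<phi> \<in> carrier X" "\<psi> \<in> carrier X" for \<phi> \<psi>
    using pairing_skew[of \<phi> \<psi>] that Xc by auto
  have pr: "mult_char X (carrier X) (pairing \<phi>)" if "\<phi> \<in> carrier X" for \<phi>
    unfolding mult_char_def
  proof (intro conjI ballI)
    fix \<psi> \<psi>' assume "\<psi> \<in> carrier X" "\<psi>' \<in> carrier X"
    have "pairing \<phi> (\<psi> \<otimes>\<^bsub>X\<^esub> \<psi>') = pairing \<phi> (\<lambda>a. \<psi> a * \<psi>' a)"
      by (rule pairing_cong) (simp_all add: Xm)
    then show "pairing \<phi> (\<psi> \<otimes>\<^bsub>X\<^esub> \<psi>') = pairing \<phi> \<psi> * pairing \<phi> \<psi>'"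
      using pairing_mult_right[of \<phi>] that Xc by simp
  qed (use pairing_nz that in auto)
  have pl: "mult_char X (carrier X) (\<lambda>\<phi>. pairing \<phi> \<psi>)" if "\<psi> \<in> carrier X" for \<psi>
    unfolding mult_char_def
  proof (intro conjI ballI)
    fix \<phi> \<phi>' assume p: "\<phi> \<in> carrier X" "\<phi>' \<in> carrier X"
    have "pairing (\<phi> \<otimes>\<^bsub>X\<^esub> \<phi>') \<psi> = pairing (\<lambda>a. \<phi> a * \<phi>' a) \<psi>"
      by (rule pairing_cong) (simp_all add: Xm)
    then show "pairing (\<phi> \<otimes>\<^bsub>X\<^esub> \<phi>') \<psi> = pairing \<phi> \<psi> * pairing \<phi>' \<psi>"
      using pairing_mult_left[of \<phi> \<phi>' \<psi>] that p Xc by simp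
  qed (use pairing_nz that in auto)
  have alt: "pairing \<phi> \<phi> = 1" if "\<phi> \<in> carrier X" for \<phi>
    using pairing_alternating[OF assms(5)[OF reg_rep]] that Xc by auto
  obtain \<alpha> where ar: "\<And>x. x \<in> carrier X \<Longrightarrow> mult_char X (carrier X) (\<alpha> x)"
    and al: "\<And>y. y \<in> carrier X \<Longrightarrow> mult_char X (carrier X) (\<lambda>x. \<alpha> x y)"
    and \<alpha>: "\<And>x y. x \<in> carrier X \<Longrightarrow> y \<in> carrier X \<Longrightarrow> pairing x y = \<alpha> x y / \<alpha> y x"
    using alternating_bicharacter_splits[OF X pr pl alt] by blast
  have a0: "\<alpha> x y \<noteq> 0" if "x \<in> carrier X" "y \<in> carrier X" for x y
    using ar[OF that(1)] that(2) by (auto simp: mult_char_def)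
  have comm: "comm_group (G\<lparr>carrier := supp\<rparr>)"
    using subgroup.subgroup_is_group[OF supp_subgroup is_group] supp_commute
    by (intro group.group_comm_groupI) auto
  have nondeg_left: "x = \<one>\<^bsub>X\<^esub>" if x: "x \<in> carrier X" and triv: "\<And>y. y \<in> carrier X \<Longrightarrow> pairing x y = 1" for x
  proof -
    have "pairing x \<phi> = 1" if \<phi>: "mult_char G supp \<phi>" for \<phi>
    proof -
      \<comment> \<open>The non-degeneracy lemma tests against characters given as arbitrary
        functions, the character group contains only extensional ones; the pairing sees only values
        on \<open>supp\<close>, so restriction is harmless.\<close>
      have "mult_char G supp (restrict \<phi> supp)"
        using \<phi> mult_char_cong[OF supp_subgroup, of "restrict \<phi> supp" \<phi>] by simp
      then have "pairing x (restrict \<phi> supp) = 1" using triv Xc by simp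
      then show ?thesis using pairing_cong[of x x "restrict \<phi> supp" \<phi>] by simp
    qed
    then have "x a = 1" if "a \<in> supp" for a
      using pairing_nondegenerate[of x a] x that Xc by auto
    then show ?thesis using x unfolding Xc X1 by (auto simp: extensional_def)
  qed
  have skew: "pairing y x = 1 / pairing x y" if "x \<in> carrier X" "y \<in> carrier X" for x y
    using pairing_skew[of y x] that Xc pairing_nz[OF that] by (simp add: field_simps)
  have nondeg: "nondegenerate_cocycle X \<alpha>"
    unfolding nondegenerate_cocycle_def nondegenerate_pairing_def
  proof (intro conjI ballI impI)
    fix x assume x: "x \<in> carrier X" and "\<forall>y\<in>carrier X. \<alpha> x y / \<alpha> y x = 1"
    then show "x = \<one>\<^bsub>X\<^esub>" using nondeg_left[OF x] \<alpha> by simp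
  next
    fix y assume y: "y \<in> carrier X" and "\<forall>x\<in>carrier X. \<alpha> x y / \<alpha> y x = 1"
    then have "pairing x y = 1" if "x \<in> carrier X" for x using \<alpha> that by simp
    then show "y = \<one>\<^bsub>X\<^esub>" using nondeg_left[OF y] skew[OF _ y] by simp
  qed
  have inv: "invariant_class G supp \<alpha>"
    unfolding invariant_class_def X_def[symmetric]
  proof
    fix q assume q: "q \<in> carrier (G Mod supp)"
    interpret N: normal supp G by (rule supp_normal)
    have "inv\<^bsub>G Mod supp\<^esub> q \<in> carrier (G Mod supp)"
      using group.inv_closed[OF N.factorgroup_is_group q] .
    then obtain h where h: "h \<in> carrier G" "inv\<^bsub>G Mod supp\<^esub> q = supp #>\<^bsub>G\<^esub> h"
      by (auto simp: FactGroup_def RCOSETS_def)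
    \<comment> \<open>Exactly the representative that \<open>coset_char\<close> picks for the
      inverse coset, so that \<open>c\<close> below is its action on characters.\<close>
    define g where "g = (SOME g. g \<in> inv\<^bsub>G Mod supp\<^esub> q)"
    have "h \<in> inv\<^bsub>G Mod supp\<^esub> q" using h rcos_self[OF h(1) supp_subgroup] by simp
    then have "g \<in> supp #>\<^bsub>G\<^esub> h" unfolding g_def h(2)[symmetric] by (rule someI)
    then have g: "g \<in> carrier G"
      using h(1) supp_carrier by (auto simp: r_coset_def)
    define c where "c \<phi> = (\<lambda>a\<in>supp. \<phi> (inv\<^bsub>G\<^esub> g \<otimes>\<^bsub>G\<^esub> a \<otimes>\<^bsub>G\<^esub> g))" for \<phi> :: "'g \<Rightarrow> 'k"
    have cc: "coset_cocycle G supp q \<alpha> \<phi> \<psi> = \<alpha> (c \<phi>) (c \<psi>)" for \<phi> \<psi>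
      by (simp add: coset_cocycle_def coset_char_def c_def g_def Let_def)
    have conj: "inv\<^bsub>G\<^esub> g \<otimes>\<^bsub>G\<^esub> a \<otimes>\<^bsub>G\<^esub> g \<in> supp" if "a \<in> supp" for a
      using N.inv_op_closed1[OF g that] .
    have conj_mult: "inv\<^bsub>G\<^esub> g \<otimes>\<^bsub>G\<^esub> (a \<otimes>\<^bsub>G\<^esub> b) \<otimes>\<^bsub>G\<^esub> g =
        (inv\<^bsub>G\<^esub> g \<otimes>\<^bsub>G\<^esub> a \<otimes>\<^bsub>G\<^esub> g) \<otimes>\<^bsub>G\<^esub> (inv\<^bsub>G\<^esub> g \<otimes>\<^bsub>G\<^esub> b \<otimes>\<^bsub>G\<^esub> g)"
      if "a \<in> supp" "b \<in> supp" for a b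
    proof -
      have "g \<otimes>\<^bsub>G\<^esub> (inv\<^bsub>G\<^esub> g \<otimes>\<^bsub>G\<^esub> (b \<otimes>\<^bsub>G\<^esub> g)) = b \<otimes>\<^bsub>G\<^esub> g"
        using g supp_carrier[OF that(2)] by (simp flip: m_assoc)
      then show ?thesis using g that supp_carrier by (simp add: m_assoc)
    qed
    have cX: "c \<phi> \<in> carrier X" if "\<phi> \<in> carrier X" for \<phi>
      using that conj conj_mult supp_mult by (auto simp: Xc c_def mult_char_def)
    have c_mult: "c (\<phi> \<otimes>\<^bsub>X\<^esub> \<psi>) = c \<phi> \<otimes>\<^bsub>X\<^esub> c \<psi>" for \<phi> \<psi>
      using conj by (auto simp: Xm c_def)
    have pc: "pairing (c \<phi>) (c \<psi>) = pairing \<phi> \<psi>" for \<phi> \<psi>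
      using pairing_cong[of "c \<phi>" "\<lambda>a. \<phi> (inv\<^bsub>G\<^esub> g \<otimes>\<^bsub>G\<^esub> a \<otimes>\<^bsub>G\<^esub> g)" "c \<psi>" "\<lambda>a. \<psi> (inv\<^bsub>G\<^esub> g \<otimes>\<^bsub>G\<^esub> a \<otimes>\<^bsub>G\<^esub> g)"]
        pairing_conjugate[OF g] by (simp add: c_def)
    \<comment> \<open>The quotient of the conjugated cocycle by \<alpha>. Conjugation preserves the
      pairing, so both cocycles have the same alternating quotient, which is to say that \<delta> is
      symmetric.\<close>
    define \<delta> where "\<delta> \<phi> \<psi> = \<alpha> (c \<phi>) (c \<psi>) / \<alpha> \<phi> \<psi>" for \<phi> \<psi>
    have "two_cocycle X \<delta>"
      using ar al cX by (intro bicharacter_two_cocycle) (auto simp: mult_char_def \<delta>_def c_mult)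
    moreover have "\<delta> \<phi> \<psi> = \<delta> \<psi> \<phi>" if "\<phi> \<in> carrier X" "\<psi> \<in> carrier X" for \<phi> \<psi>
      using pc[of \<phi> \<psi>] \<alpha> cX that a0 by (simp add: \<delta>_def field_simps)
    ultimately obtain \<gamma> where \<gamma>: "\<forall>x\<in>carrier X. \<gamma> x \<noteq> 0"
      "\<forall>x\<in>carrier X. \<forall>y\<in>carrier X. \<delta> x y = \<gamma> x * \<gamma> y / \<gamma> (x \<otimes>\<^bsub>X\<^esub> y)"
      using symmetric_two_cocycle_is_coboundary[OF X, of \<delta>] by blast
    have "coset_cocycle G supp q \<alpha> x y = \<alpha> x y * (\<gamma> x * \<gamma> y / \<gamma> (x \<otimes>\<^bsub>X\<^esub> y))"
      if xy: "x \<in> carrier X" "y \<in> carrier X" for x y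
    proof -
      have "\<delta> x y = \<gamma> x * \<gamma> y / \<gamma> (x \<otimes>\<^bsub>X\<^esub> y)" using \<gamma>(2) xy by blast
      then show ?thesis unfolding cc using a0[OF xy] by (simp add: \<delta>_def field_simps)
    qed
    then show "cohomologous X (coset_cocycle G supp q \<alpha>) \<alpha>"
      unfolding cohomologous_def using \<gamma>(1) by blast
  qed
  have "\<sigma> V W (tpure T V W v w) = (\<alpha> \<phi> \<psi> / \<alpha> \<psi> \<phi>) \<odot>\<^bsub>tobj T W V\<^esub> tpure T W V w v"
    if "is_rep G V" "is_rep G W" "\<phi> \<in> carrier X" "\<psi> \<in> carrier X"
      "v \<in> isotypical supp V \<phi>" "w \<in> isotypical supp W \<psi>" for V W \<phi> \<psi> v w
    using sigma_isotypical[OF that(1,2,5,6)] \<alpha>[OF that(3,4)] by simp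
  then show ?thesis
    using supp_normal comm bicharacter_two_cocycle[OF ar al] nondeg inv
    unfolding X_def by (intro exI[of _ supp] exI[of _ \<alpha>]) blast
qed

end
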